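(* Let $r\in\{3,4,5,6,7\}$. Then the generating function $I_r(x)=\sum_{n\ge 0}a_{n,r}x^n$, where $a_{n,r}$ is the number of involutions of $\{1,\dots,n\}$ which contain $3412$ exactly $r$ times, is given by $$I_r(x)=\frac{1}{2x^2}F_r(x)+\frac{1}{2x^2}G_r(x)\left(\sqrt{1-2x-3x^2}\right)^{1-2r},$$ where $(1-x^2)F_3(x)=-(1-2x)(1+x+x^2)$, $(1-x^2)F_4(x)=-1+3x+4x^2-8x^3-2x^4$, $(1-x^2)F_5(x)=3-7x-7x^2+12x^3+6x^4$, $(1-x^2)^2F_6(x)=-5+9x+21x^2-25x^3-34x^4+16x^5+24x^6-2x^7-2x^8$, $(1-x^2)^2F_7(x)=7-11x-28x^2+20x^3+54x^4-2x^5-46x^6+2x^8$, and $(1-x)^2G_3(x)=1-8x+18x^2+x^3-29x^4-12x^5+14x^6+41x^7+2x^8-18x^9$, $(1-x)^4G_4(x)=1-14x+71x^2-124x^3-166x^4+874x^5-624x^6-1332x^7+1909x^8+426x^9-1585x^{10}+292x^{11}+400x^{12}-126x^{13}$, $(1-x)^4G_5(x)=-3+46x-267x^2+627x^3+134x^4-3321x^5+3954x^6+5214x^7-11775x^8-2186x^9+14525x^{10}-1701x^{11}-8824x^{12}+1537x^{13}+2594x^{14}-216x^{15}-324x^{16}$, $(1-x)^6G_6(x)=5-94x+712x^2-2582x^3+3124x^4+8364x^5-31620x^6+15464x^7+77508x^8-107098x^9-76814x^{10}+214160x^{11}+5782x^{12}-231050x^{13}+62700x^{14}+146176x^{15}-65653x^{16}-50328x^{17}+29646x^{18}+6462x^{19}-5346x^{20}+486x^{21}$,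 $(1-x)^6G_7(x)=-7+144x-1210x^2+5020x^3-8206x^4-12180x^5+69464x^6-54210x^7-181468x^8+315366x^9+239852x^{10}-779338x^{11}-124766x^{12}+1226006x^{13}-168810x^{14}-1272344x^{15}+418555x^{16}+813368x^{17}-373802x^{18}-279554x^{19}+153648x^{20}+37188x^{21}-23166x^{22}+486x^{23}$.
   Context: An involution is a permutation $\pi$ with $\pi=\pi^{-1}$. A permutation contains $3412$ exactly $r$ times if exactly $r$ of its four-term subsequences (in one-line notation) are order-isomorphic to $3412$. *)

theory Defs
  imports "HOL-Combinatorics.Permutations" "HOL-Computational_Algebra.Formal_Laurent_Series"
begin

definition order_isomorphic :: "nat list \<Rightarrow> nat list \<Rightarrow> bool" where
  "order_isomorphic u v \<longleftrightarrow> length u = length v \<and>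
     (\<forall>i<length u. \<forall>j<length u. u ! i < u ! j \<longleftrightarrow> v ! i < v ! j)"

text \<open>Subsequences are distinguished by their sets of positions (counted from 0).\<close>

definition occurrences :: "nat list \<Rightarrow> nat list \<Rightarrow> nat set set" where
  "occurrences \<tau> w = {I. I \<subseteq> {..<length w} \<and> order_isomorphic (nths w I) \<tau>}"

definition one_line :: "nat \<Rightarrow> (nat \<Rightarrow> nat) \<Rightarrow> nat list" where
  "one_line n \<pi> = map \<pi> [1..<Suc n]"

definition involutions :: "nat \<Rightarrow> (nat \<Rightarrow> nat) set" where
  "involutions n = {\<pi>. \<pi> permutes {1..n} \<and> \<pi> = inv \<pi>}"

definition num_involutions_3412 :: "nat \<Rightarrow> nat \<Rightarrow> nat" where
  "num_involutions_3412 n r =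
     card {\<pi> \<in> involutions n. card (occurrences [3, 4, 1, 2] (one_line n \<pi>)) = r}"

definition gf_involutions_3412 :: "nat \<Rightarrow> real fps" where
  "gf_involutions_3412 r = Abs_fps (\<lambda>n. real (num_involutions_3412 n r))"

text \<open>Identities involving \<open>1 / (2 x\<^sup>2)\<close> are read in the field of formal Laurent series,
  because division of formal power series by \<open>x\<^sup>2\<close> discards the two lowest coefficients.\<close>

abbreviation X :: "real fls" where
  "X \<equiv> fls_X"

text \<open>The formal square root of \<open>1 - 2 x - 3 x\<^sup>2\<close> with constant term 1.\<close>

definition sqrt_disc :: "real fls" where
  "sqrt_disc = fps_to_fls (fps_radical root 2 (1 - 2 * fps_X - 3 * fps_X ^ 2))"

end

theory Submission
  imports Defs
begin

text \<open>
  An occurrence of 3412 in an involution consists of two ascending pairs, the second one to the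
  south-east of the first. Draw the involution as a set of arcs. If the arcs over a cut between two
  positions are pairwise nested, then no occurrence has points on both sides of the cut. So scan the
  involution from left to right and close the arcs that are still open in nested order: this gives a
  partial involution with a well-defined number of occurrences. Let \<open>W n h\<close> enumerate those with \<open>n\<close>
  points and \<open>h\<close> open arcs by occurrences. With fewer than 8 occurrences, an arc that is closed at the
  last point can be crossed in only five ways, because every other configuration contains one of
  finitely many patterns with at least 8 occurrences. This yields a linear recursion for \<open>W\<close>, the one
  for lattice paths with weighted up, down and level steps, in which the weight of a level step
  counts involutions with few ascending pairs. Hence the generating function of \<open>W n 0\<close> satisfies a
  quadratic equation, and the coefficients of its solution can be compared with the claim.
\<close>

subsection \<open>Occurrences of 3412 in involutions of a finite set\<close>

text \<open>With q marking occurrences, everything is read modulo q^8 because r is at most 7.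
  Without such a bound arbitrarily many arcs could cross the closed arc, and no finite list of
  crossings would do. A level step of weight \<open>fps_X * D k\<close> is a pair of crossing arcs
  around k points: an ascending pair among these completes one occurrence with the left ends of the
  two arcs and one with the right ends, whence the exponent \<open>occ + 2 * asc\<close>. The shape
  of the answer comes from the quadratic equation \<alpha> I^2 + \<beta> I + g = 0. Its discriminant
  reduces to 1 - 2x - 3x^2 at q = 0, so the coefficient of q^r in its square root is a rational
  function times the power 1 - 2r of the square root of 1 - 2x - 3x^2. As \<alpha> reduces to x^2,
  solving for I takes place over Laurent series in x, with q as the outer variable. Roots and
  quotients are not computed there: they are stated as lists of coefficients and verified by
  squaring or multiplying back.\<close>

definition involutions_on :: "nat set \<Rightarrow> (nat \<Rightarrow> nat) set" where
  "involutions_on S = {f. (\<forall>x\<in>S. f x \<in> S) \<and> (\<forall>x. f (f x) = x) \<and> (\<forall>x. x \<notin> S \<longrightarrow> f x = x)}"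

definition occ_tuples :: "nat set \<Rightarrow> (nat \<Rightarrow> nat) \<Rightarrow> (nat \<times> nat \<times> nat \<times> nat) set" where
  "occ_tuples S f = {(i, j, k, l). i \<in> S \<and> j \<in> S \<and> k \<in> S \<and> l \<in> S \<and> i < j \<and> j < k \<and> k < l \<and>
     f k < f l \<and> f l < f i \<and> f i < f j}"

definition occ :: "nat set \<Rightarrow> (nat \<Rightarrow> nat) \<Rightarrow> nat" where
  "occ S f = card (occ_tuples S f)"

definition asc_pairs :: "nat set \<Rightarrow> (nat \<Rightarrow> nat) \<Rightarrow> (nat \<times> nat) set" where
  "asc_pairs S f = {(i, j). i \<in> S \<and> j \<in> S \<and> i < j \<and> f i < f j}"

definition asc :: "nat set \<Rightarrow> (nat \<Rightarrow> nat) \<Rightarrow> nat" where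
  "asc S f = card (asc_pairs S f)"

definition restr :: "nat set \<Rightarrow> (nat \<Rightarrow> nat) \<Rightarrow> nat \<Rightarrow> nat" where
  "restr S f = (\<lambda>x. if x \<in> S then f x else x)"

lemma finite_occ_tuples [simp]: "finite S \<Longrightarrow> finite (occ_tuples S f)"
  by (rule finite_subset [of _ "S \<times> S \<times> S \<times> S"]) (auto simp: occ_tuples_def)

lemma finite_asc_pairs [simp]: "finite S \<Longrightarrow> finite (asc_pairs S f)"
  by (rule finite_subset [of _ "S \<times> S"]) (auto simp: asc_pairs_def)

lemma finite_involutions_on [simp]:
  assumes "finite S"
  shows "finite (involutions_on S)"
proof (rule finite_subset)
  show "involutions_on S \<subseteq> {f. \<forall>x. (x \<in> S \<longrightarrow> f x \<in> S) \<and> (x \<notin> S \<longrightarrow> f x = x)}"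
    by (auto simp: involutions_on_def)
  show "finite {f. \<forall>x. (x \<in> S \<longrightarrow> f x \<in> S) \<and> (x \<notin> S \<longrightarrow> f x = x)}"
  proof (rule finite_imageD)
    let ?r = "\<lambda>f. restrict f S"
    let ?A = "{f. \<forall>x. (x \<in> S \<longrightarrow> f x \<in> S) \<and> (x \<notin> S \<longrightarrow> f x = (x::nat))}"
    have "?r ` ?A \<subseteq> (S \<rightarrow>\<^sub>E S)" by (intro image_subsetI PiE_I) auto
    then show "finite (?r ` ?A)" by (rule finite_subset) (simp add: assms finite_PiE)
    show "inj_on ?r ?A"
    proof (rule inj_onI, rule ext)
      fix f g x assume "f \<in> ?A" "g \<in> ?A" "?r f = ?r g"
      then show "f x = g x" by (cases "x \<in> S") (metis restrict_apply', metis (mono_tags, lifting) mem_Collect_eq)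
    qed
  qed
qed

lemma occ_tuples_cong:
  assumes "\<And>x. x \<in> S \<Longrightarrow> f x = g x"
  shows "occ_tuples S f = occ_tuples S g"
  using assms by (auto simp: occ_tuples_def)

lemma occ_cong: "(\<And>x. x \<in> S \<Longrightarrow> f x = g x) \<Longrightarrow> occ S f = occ S g"
  unfolding occ_def by (metis occ_tuples_cong)

lemma asc_cong: "(\<And>x. x \<in> S \<Longrightarrow> f x = g x) \<Longrightarrow> asc S f = asc S g"
  unfolding asc_def by (rule arg_cong [where f = card]) (auto simp: asc_pairs_def)

lemma occ_restr [simp]: "occ S (restr S f) = occ S f"
  by (rule occ_cong) (simp add: restr_def)

lemma asc_restr [simp]: "asc S (restr S f) = asc S f"
  by (rule asc_cong) (simp add: restr_def)

lemma occ_tuples_mono: "A \<subseteq> S \<Longrightarrow> occ_tuples A f \<subseteq> occ_tuples S f"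
  by (auto simp: occ_tuples_def)

lemma occ_mono: "finite S \<Longrightarrow> A \<subseteq> S \<Longrightarrow> occ A f \<le> occ S f"
  unfolding occ_def by (intro card_mono finite_occ_tuples occ_tuples_mono)

lemma occ_iso:
  assumes mono: "\<And>x y. x \<in> A \<Longrightarrow> y \<in> A \<Longrightarrow> \<phi> x < \<phi> y \<longleftrightarrow> x < y"
    and iso: "\<And>x y. x \<in> A \<Longrightarrow> y \<in> A \<Longrightarrow> g (\<phi> x) < g (\<phi> y) \<longleftrightarrow> f x < f y"
  shows "occ (\<phi> ` A) g = occ A f"
proof -
  let ?\<psi> = "\<lambda>(i, j, k, l). (\<phi> i, \<phi> j, \<phi> k, \<phi> l)"
  have inj: "inj_on \<phi> A"
    by (rule inj_onI) (metis less_irrefl linorder_neqE_nat mono)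
  have "occ_tuples (\<phi> ` A) g = ?\<psi> ` occ_tuples A f"
  proof (intro set_eqI iffI)
    fix p assume "p \<in> occ_tuples (\<phi> ` A) g"
    then obtain i j k l where "p = (\<phi> i, \<phi> j, \<phi> k, \<phi> l)" "i \<in> A" "j \<in> A" "k \<in> A" "l \<in> A"
      "(\<phi> i, \<phi> j, \<phi> k, \<phi> l) \<in> occ_tuples (\<phi> ` A) g"
      by (auto simp: occ_tuples_def)
    then show "p \<in> ?\<psi> ` occ_tuples A f"
      by (intro rev_image_eqI [of "(i, j, k, l)"]) (simp_all add: occ_tuples_def mono iso)
  qed (auto simp: occ_tuples_def mono iso)
  moreover have "inj_on ?\<psi> (occ_tuples A f)"
    using inj by (auto simp: occ_tuples_def inj_on_def)
  ultimately show ?thesis unfolding occ_def by (simp add: card_image)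
qed

lemma asc_iso:
  assumes mono: "\<And>x y. x \<in> A \<Longrightarrow> y \<in> A \<Longrightarrow> \<phi> x < \<phi> y \<longleftrightarrow> x < y"
    and iso: "\<And>x y. x \<in> A \<Longrightarrow> y \<in> A \<Longrightarrow> g (\<phi> x) < g (\<phi> y) \<longleftrightarrow> f x < f y"
  shows "asc (\<phi> ` A) g = asc A f"
proof -
  let ?\<psi> = "\<lambda>(i, j). (\<phi> i, \<phi> j)"
  have inj: "inj_on \<phi> A"
    by (rule inj_onI) (metis less_irrefl linorder_neqE_nat mono)
  have "asc_pairs (\<phi> ` A) g = ?\<psi> ` asc_pairs A f"
  proof (intro set_eqI iffI)
    fix p assume "p \<in> asc_pairs (\<phi> ` A) g"
    then obtain i j where "p = (\<phi> i, \<phi> j)" "i \<in> A" "j \<in> A" "(\<phi> i, \<phi> j) \<in> asc_pairs (\<phi> ` A) g"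
      by (auto simp: asc_pairs_def)
    then show "p \<in> ?\<psi> ` asc_pairs A f"
      by (intro rev_image_eqI [of "(i, j)"]) (simp_all add: asc_pairs_def mono iso)
  qed (auto simp: asc_pairs_def mono iso)
  moreover have "inj_on ?\<psi> (asc_pairs A f)"
    using inj by (auto simp: asc_pairs_def inj_on_def)
  ultimately show ?thesis unfolding asc_def by (simp add: card_image)
qed

lemma occ_split:
  assumes "finite S" "A \<subseteq> S" "B \<subseteq> S"
    and "\<And>i j k l. (i, j, k, l) \<in> occ_tuples S f \<Longrightarrow> {i, j, k, l} \<subseteq> A \<or> {i, j, k, l} \<subseteq> B"
    and "occ_tuples (A \<inter> B) f = {}"
  shows "occ S f = occ A f + occ B f"
proof -
  have "occ_tuples S f = occ_tuples A f \<union> occ_tuples B f"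
  proof
    show "occ_tuples S f \<subseteq> occ_tuples A f \<union> occ_tuples B f"
    proof
      fix p assume p: "p \<in> occ_tuples S f"
      obtain i j k l where "p = (i, j, k, l)" by (cases p) auto
      then show "p \<in> occ_tuples A f \<union> occ_tuples B f"
        using assms(4) [of i j k l] p by (auto simp: occ_tuples_def)
    qed
  qed (use assms(2,3) occ_tuples_mono in blast)
  moreover have "occ_tuples A f \<inter> occ_tuples B f = {}"
    using assms(5) by (auto simp: occ_tuples_def)
  ultimately show ?thesis
    unfolding occ_def using assms(1-3) finite_subset
    by (metis card_Un_disjoint finite_occ_tuples)
qed

text \<open>If the points of the ascending pair \<open>(i, j)\<close> lie before the cut and their
  values after it, then their arcs cross over the cut, against \<open>nested\<close>; the pair
  \<open>(k, l)\<close> is treated through its values. So an occurrence cannot contain both a point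
  whose arc lies wholly before the cut and one whose arc lies wholly after it. The arcs over the cut
  belong to both parts, but form no occurrence among themselves.\<close>

lemma occ_nested_cut:
  assumes S: "finite S" and f: "f \<in> involutions_on S"
    and nested: "\<And>x y. x \<in> S \<Longrightarrow> y \<in> S \<Longrightarrow> x < y \<Longrightarrow> y < g \<Longrightarrow> g \<le> f x \<Longrightarrow> g \<le> f y \<Longrightarrow> f y < f x"
  shows "occ S f = occ {x \<in> S. x < g \<or> f x < g} f + occ {x \<in> S. g \<le> x \<or> g \<le> f x} f"
proof (rule occ_split)
  have inv: "f (f x) = x" for x using f by (simp add: involutions_on_def)
  have cl: "f x \<in> S" if "x \<in> S" for x using f that by (simp add: involutions_on_def)
  have NW: "\<not> (j < g \<and> g \<le> f i)" and SE: "\<not> (g \<le> k \<and> f l < g)"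
    if "(i, j, k, l) \<in> occ_tuples S f" for i j k l
    using nested [of i j] nested [of "f k" "f l"] cl inv that
    by (auto simp: occ_tuples_def)
  show "{i, j, k, l} \<subseteq> {x \<in> S. x < g \<or> f x < g} \<or> {i, j, k, l} \<subseteq> {x \<in> S. g \<le> x \<or> g \<le> f x}"
    if "(i, j, k, l) \<in> occ_tuples S f" for i j k l
    using that NW [OF that] SE [OF that] by (auto simp: occ_tuples_def)
  show "occ_tuples ({x \<in> S. x < g \<or> f x < g} \<inter> {x \<in> S. g \<le> x \<or> g \<le> f x}) f = {}"
  proof (rule ccontr)
    let ?C = "{x \<in> S. x < g \<or> f x < g} \<inter> {x \<in> S. g \<le> x \<or> g \<le> f x}"
    assume "occ_tuples ?C f \<noteq> {}"
    then obtain i j k l where o: "(i, j, k, l) \<in> occ_tuples ?C f" by auto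
    then have "(i, j, k, l) \<in> occ_tuples S f" by (auto simp: occ_tuples_def)
    from NW [OF this] SE [OF this] o show False by (auto simp: occ_tuples_def)
  qed
qed (use S in auto)

text \<open>Each point of an occurrence lies in an ascending pair, \<open>i\<close> with
  \<open>j\<close> and \<open>k\<close> with \<open>l\<close>. Hence points that are in no ascending
  pair can be deleted.\<close>

lemma occ_remove:
  assumes "\<And>x y. x \<in> U \<Longrightarrow> y \<in> S \<Longrightarrow> x < y \<Longrightarrow> f y \<le> f x"
    and "\<And>x y. x \<in> U \<Longrightarrow> y \<in> S \<Longrightarrow> y < x \<Longrightarrow> f x \<le> f y"
  shows "occ (S - U) f = occ S f"
proof -
  have "occ_tuples S f \<subseteq> occ_tuples (S - U) f"
    using assms by (auto simp: occ_tuples_def not_le [symmetric])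
  then have "occ_tuples (S - U) f = occ_tuples S f"
    using occ_tuples_mono [of "S - U" S f] by blast
  then show ?thesis by (simp add: occ_def)
qed

lemma occ_antitone:
  assumes "\<And>x y. x \<in> S \<Longrightarrow> y \<in> S \<Longrightarrow> x < y \<Longrightarrow> f y \<le> f x"
  shows "occ S f = 0"
proof -
  have "p \<notin> occ_tuples S f" for p
    using assms by (cases p) (auto simp: occ_tuples_def not_le [symmetric])
  then have "occ_tuples S f = {}" by blast
  then show ?thesis by (simp add: occ_def)
qed

section \<open>Evaluating the number of occurrences in a concrete pattern\<close>

lemma length_filter_upt: "length (filter P [a..<b]) = card {l \<in> {a..<b}. P l}"
  by (subst distinct_card [symmetric]) (auto intro: arg_cong [where f = card])

text \<open>Each comparison is made before the next index is introduced, which keeps the evaluation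
  by \<open>code_simp\<close> short.\<close>

definition occ_list :: "nat list \<Rightarrow> nat" where
  "occ_list p = (let n = length p in
     \<Sum>i\<leftarrow>[0..<n]. \<Sum>j\<leftarrow>[Suc i..<n]. if p ! i < p ! j then
       \<Sum>k\<leftarrow>[Suc j..<n]. if p ! k < p ! i then
         length (filter (\<lambda>l. p ! k < p ! l \<and> p ! l < p ! i) [Suc k..<n]) else 0 else 0)"

lemma occ_list_eq: "occ_list p = occ {..<length p} ((!) p)"
proof -
  let ?n = "length p"
  have "occ_tuples {..<?n} ((!) p) = (SIGMA i : {0..<?n}. SIGMA j : {j \<in> {Suc i..<?n}. p ! i < p ! j}.
      SIGMA k : {k \<in> {Suc j..<?n}. p ! k < p ! i}. {l \<in> {Suc k..<?n}. p ! k < p ! l \<and> p ! l < p ! i})"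
    by (auto simp: occ_tuples_def)
  moreover have "(\<Sum>k\<leftarrow>[a..<b]. if P k then F k else 0) = sum F {k \<in> {a..<b}. P k}"
    for P a b and F :: "nat \<Rightarrow> nat"
    by (simp only: interv_sum_list_conv_sum_set_nat set_upt sum.inter_filter finite_atLeastLessThan)
  moreover have "finite {k \<in> {a..<b}. P k}" for P and a b :: nat by simp
  ultimately show ?thesis
    unfolding occ_def occ_list_def Let_def
    by (simp only: card_SigmaI finite_SigmaI finite_atLeastLessThan Ball_def length_filter_upt
        interv_sum_list_conv_sum_set_nat set_upt simp_thms)
qed

section \<open>Partial involutions, their weights and relabelling\<close>

lemma involutions_on_restr:
  assumes "f \<in> involutions_on S" "A \<subseteq> S" "f ` A \<subseteq> A"
  shows "restr A f \<in> involutions_on A"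
  using assms by (auto simp: involutions_on_def restr_def)

text \<open>The involutions whose last points \<open>Z\<close> are matched in nested order with points of \<open>T\<close>. They encode
  involutions of \<open>T\<close> in which some points are left open; \<open>Z\<close> closes these without a crossing.\<close>

definition nested_end :: "nat set \<Rightarrow> nat set \<Rightarrow> (nat \<Rightarrow> nat) set" where
  "nested_end T Z = {f \<in> involutions_on (T \<union> Z). f ` Z \<subseteq> T \<and> (\<forall>x\<in>Z. \<forall>y\<in>Z. x < y \<longrightarrow> f y < f x)}"

text \<open>The factor \<open>c\<close> is 0 for partial involutions and 2 for the points enclosed
  by two crossing arcs, where every ascending pair completes two occurrences.\<close>

definition weight :: "nat \<Rightarrow> nat set \<Rightarrow> (nat \<Rightarrow> nat) \<Rightarrow> real fps" where
  "weight c S f = fps_X ^ (occ S f + c * asc S f)"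

definition total_weight :: "nat \<Rightarrow> nat set \<Rightarrow> nat set \<Rightarrow> real fps" where
  "total_weight c T Z = (\<Sum>f\<in>nested_end T Z. weight c (T \<union> Z) f)"

text \<open>Conjugation by the relabelling \<phi>, extended by the identity outside the image as
  \<open>involutions_on\<close> demands.\<close>

definition transport :: "(nat \<Rightarrow> nat) \<Rightarrow> nat set \<Rightarrow> (nat \<Rightarrow> nat) \<Rightarrow> nat \<Rightarrow> nat" where
  "transport \<phi> A f = (\<lambda>y. if y \<in> \<phi> ` A then \<phi> (f (inv_into A \<phi> y)) else y)"

lemma transport_image [simp]: "inj_on \<phi> A \<Longrightarrow> x \<in> A \<Longrightarrow> transport \<phi> A f (\<phi> x) = \<phi> (f x)"
  by (simp add: transport_def)

lemma transport_involution:
  assumes "inj_on \<phi> A" "f \<in> involutions_on A"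
  shows "transport \<phi> A f \<in> involutions_on (\<phi> ` A)"
  unfolding involutions_on_def
proof (intro CollectI conjI ballI allI impI)
  have f: "f x \<in> A" if "x \<in> A" for x using assms(2) that by (simp add: involutions_on_def)
  show "transport \<phi> A f y \<in> \<phi> ` A" if "y \<in> \<phi> ` A" for y
    using that f assms(1) by auto
  show "transport \<phi> A f (transport \<phi> A f y) = y" for y
  proof (cases "y \<in> \<phi> ` A")
    case True
    then show ?thesis using assms f by (auto simp: involutions_on_def)
  qed (simp add: transport_def)
qed (simp add: transport_def)

lemma transport_cong:
  assumes "inj_on \<phi> A" "f \<in> involutions_on A" "\<And>x. x \<in> A \<Longrightarrow> \<chi> x = \<phi> x"
  shows "transport \<chi> A f = transport \<phi> A f"
proof
  fix y
  have im: "\<chi> ` A = \<phi> ` A" and inj: "inj_on \<chi> A"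
    using assms by (auto simp: inj_on_def image_iff)
  show "transport \<chi> A f y = transport \<phi> A f y"
  proof (cases "y \<in> \<phi> ` A")
    case True
    then obtain x where x: "x \<in> A" "y = \<phi> x" by auto
    then have "f x \<in> A" using assms(2) by (simp add: involutions_on_def)
    then show ?thesis using x assms transport_image [OF inj x(1)] by simp
  qed (simp add: transport_def im)
qed

lemma transport_transport:
  assumes "inj_on \<phi> A" "f \<in> involutions_on A"
  shows "transport (inv_into A \<phi>) (\<phi> ` A) (transport \<phi> A f) = f"
proof
  fix x
  have im: "inv_into A \<phi> ` \<phi> ` A = A" using assms(1) by force
  show "transport (inv_into A \<phi>) (\<phi> ` A) (transport \<phi> A f) x = f x"
  proof (cases "x \<in> A")
    case True
    then have "inv_into (\<phi> ` A) (inv_into A \<phi>) x = \<phi> x"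
      using assms(1) by (metis im inj_on_inv_into f_inv_into_f imageI inv_into_f_f subset_refl inv_into_into)
    then show ?thesis
      using True assms by (simp add: transport_def [of "inv_into A \<phi>"] im involutions_on_def)
  next
    case False
    then show ?thesis using assms by (simp add: transport_def im involutions_on_def)
  qed
qed

lemma transport_nested_end:
  assumes mono: "strict_mono_on (T \<union> Z) \<phi>" and f: "f \<in> nested_end T Z"
  shows "transport \<phi> (T \<union> Z) f \<in> nested_end (\<phi> ` T) (\<phi> ` Z)"
proof -
  have inj: "inj_on \<phi> (T \<union> Z)" using mono by (rule strict_mono_on_imp_inj_on)
  have less: "\<phi> x < \<phi> y \<longleftrightarrow> x < y" if "x \<in> T \<union> Z" "y \<in> T \<union> Z" for x y
    using mono that by (rule strict_mono_on_less)
  have "transport \<phi> (T \<union> Z) f \<in> involutions_on (\<phi> ` (T \<union> Z))"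
    using f by (intro transport_involution inj) (simp add: nested_end_def)
  moreover have "f x \<in> T" if "x \<in> Z" for x using f that by (auto simp: nested_end_def)
  ultimately show ?thesis
    using f inj by (auto simp: nested_end_def image_Un less)
qed

text \<open>Conjugation by \<phi> and by its inverse are mutually inverse bijections between the two
  sets of involutions, and \<open>occ\<close> and \<open>asc\<close> see only the relative
  order.\<close>

lemma total_weight_image:
  assumes mono: "strict_mono_on (T \<union> Z) \<phi>"
  shows "total_weight c (\<phi> ` T) (\<phi> ` Z) = total_weight c T Z"
proof -
  let ?A = "T \<union> Z" let ?\<psi> = "inv_into ?A \<phi>"
  have inj: "inj_on \<phi> ?A" using mono by (rule strict_mono_on_imp_inj_on)
  have less: "\<phi> x < \<phi> y \<longleftrightarrow> x < y" if "x \<in> ?A" "y \<in> ?A" for x y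
    using mono that by (rule strict_mono_on_less)
  have mono': "strict_mono_on (\<phi> ` T \<union> \<phi> ` Z) ?\<psi>"
    by (rule strict_mono_onI) (use inj less in auto)
  have im: "?\<psi> ` \<phi> ` T = T" "?\<psi> ` \<phi> ` Z = Z" 
    using inj by (force simp: image_iff)+
  have inj': "inj_on ?\<psi> (\<phi> ` ?A)" by (rule inj_on_inv_into) simp
  have inv': "inv_into (\<phi> ` ?A) ?\<psi> x = \<phi> x" if "x \<in> ?A" for x
    using that inj inj' by (metis imageI inv_into_f_f)
  \<comment> \<open>The inverse of the inverse agrees with \<phi> on \<open>?A\<close> only;
    \<open>transport_cong\<close> says that this is enough.\<close>
  have tr: "transport (inv_into (\<phi> ` ?A) ?\<psi>) (?\<psi> ` \<phi> ` ?A) f = transport \<phi> ?A f"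
    if "f \<in> involutions_on ?A" for f
    using transport_cong [OF inj that inv'] im by (simp add: image_Un)
  show ?thesis
    unfolding total_weight_def
  proof (rule sum.reindex_bij_witness [where i = "transport \<phi> ?A" and j = "transport ?\<psi> (\<phi> ` ?A)"])
    fix g assume g: "g \<in> nested_end (\<phi> ` T) (\<phi> ` Z)"
    then have g': "g \<in> involutions_on (\<phi> ` ?A)" by (simp add: nested_end_def image_Un)
    have *: "transport ?\<psi> (\<phi> ` ?A) g \<in> nested_end T Z"
      using transport_nested_end [OF mono' g] by (simp add: im image_Un)
    then show "transport ?\<psi> (\<phi> ` ?A) g \<in> nested_end T Z" .
    have "transport (inv_into (\<phi> ` ?A) ?\<psi>) (?\<psi> ` \<phi> ` ?A) (transport ?\<psi> (\<phi> ` ?A) g) = g"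
      by (rule transport_transport [OF inj' g'])
    then show eq: "transport \<phi> ?A (transport ?\<psi> (\<phi> ` ?A) g) = g"
      using tr * by (simp add: nested_end_def)
    let ?f = "transport ?\<psi> (\<phi> ` ?A) g"
    have f: "?f \<in> involutions_on ?A" using * by (simp add: nested_end_def)
    have gf: "g (\<phi> x) = \<phi> (?f x)" if "x \<in> ?A" for x
      using eq transport_image [OF inj that, of ?f] by metis
    have "?f x \<in> ?A" if "x \<in> ?A" for x using f that by (auto simp: involutions_on_def)
    then have iso: "g (\<phi> x) < g (\<phi> y) \<longleftrightarrow> ?f x < ?f y" if "x \<in> ?A" "y \<in> ?A" for x y
      using that less gf by simp
    have "occ (\<phi> ` ?A) g = occ ?A ?f" "asc (\<phi> ` ?A) g = asc ?A ?f"
      by (rule occ_iso asc_iso; use less iso in blast)+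
    then show "weight c ?A ?f = weight c (\<phi> ` T \<union> \<phi> ` Z) g"
      by (simp add: weight_def image_Un)
  next
    fix f assume f: "f \<in> nested_end T Z"
    then show "transport \<phi> ?A f \<in> nested_end (\<phi> ` T) (\<phi> ` Z)"
      by (rule transport_nested_end [OF mono])
    show "transport ?\<psi> (\<phi> ` ?A) (transport \<phi> ?A f) = f"
      using f inj by (intro transport_transport) (simp_all add: nested_end_def)
  qed
qed

lemma total_weight_card:
  assumes fin: "finite T" "finite Z" and less: "\<And>x y. x \<in> T \<Longrightarrow> y \<in> Z \<Longrightarrow> x < y"
  shows "total_weight c T Z = total_weight c {..<card T} {card T..<card T + card Z}"
proof -
  obtain h1 where h1: "bij_betw h1 {..<card T} T" "strict_mono_on {..<card T} h1"
    by (rule ex_bij_betw_strict_mono_card [OF fin(1)])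
  obtain h2 where h2: "bij_betw h2 {..<card Z} Z" "strict_mono_on {..<card Z} h2"
    by (rule ex_bij_betw_strict_mono_card [OF fin(2)])
  \<comment> \<open>The increasing enumerations of \<open>T\<close> and of \<open>Z\<close>, one
    after the other; the whole is increasing because \<open>Z\<close> lies behind
    \<open>T\<close>.\<close>
  define \<phi> where "\<phi> x = (if x < card T then h1 x else h2 (x - card T))" for x
  have "\<phi> ` {..<card T} = T"
    using h1(1) by (auto simp: \<phi>_def bij_betw_def)
  moreover have "\<phi> ` {card T..<card T + card Z} = h2 ` (\<lambda>x. x - card T) ` {card T..<card T + card Z}"
    by (simp add: \<phi>_def image_image)
  then have "\<phi> ` {card T..<card T + card Z} = Z"
    using h2(1) fin(2) by (auto simp: bij_betw_def image_minus_const_atLeastLessThan_nat atLeast0LessThan)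
  moreover have "strict_mono_on ({..<card T} \<union> {card T..<card T + card Z}) \<phi>"
  proof (rule strict_mono_onI)
    fix x y assume xy: "x \<in> {..<card T} \<union> {card T..<card T + card Z}"
      "y \<in> {..<card T} \<union> {card T..<card T + card Z}" "x < y"
    consider "y < card T" | "x < card T" "card T \<le> y" | "card T \<le> x" by linarith
    then show "\<phi> x < \<phi> y"
    proof cases
      case 1 then show ?thesis using xy h1(2) by (auto simp: \<phi>_def strict_mono_on_def)
    next
      case 2
      then have "h1 x \<in> T" "h2 (y - card T) \<in> Z"
        using xy h1(1) h2(1) by (auto simp: bij_betw_def)
      then show ?thesis using 2 less by (simp add: \<phi>_def)
    next
      case 3
      then show ?thesis using xy strict_mono_onD [OF h2(2), of "x - card T" "y - card T"]
        by (auto simp: \<phi>_def)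
    qed
  qed
  ultimately show ?thesis using total_weight_image by metis
qed

text \<open>An involution that preserves both of two disjoint sets is the same as the pair of its
  restrictions, so a product of weights sums to the product of the sums.\<close>

lemma sum_glue:
  fixes G H :: "(nat \<Rightarrow> nat) \<Rightarrow> 'a::comm_semiring_0"
  assumes disj: "A \<inter> B = {}" and Q: "\<Q> \<subseteq> involutions_on A" and R: "\<R> \<subseteq> involutions_on B"
  shows "(\<Sum>f | f \<in> involutions_on (A \<union> B) \<and> restr A f \<in> \<Q> \<and> restr B f \<in> \<R>. G (restr A f) * H (restr B f))
    = sum G \<Q> * sum H \<R>"
proof -
  have "(\<Sum>f | f \<in> involutions_on (A \<union> B) \<and> restr A f \<in> \<Q> \<and> restr B f \<in> \<R>. G (restr A f) * H (restr B f))
    = (\<Sum>(g, k)\<in>\<Q> \<times> \<R>. G g * H k)"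
  proof (rule sum.reindex_bij_witness [where j = "\<lambda>f. (restr A f, restr B f)"
        and i = "\<lambda>(g, k) x. if x \<in> A then g x else k x"])
    fix f assume f: "f \<in> {f. f \<in> involutions_on (A \<union> B) \<and> restr A f \<in> \<Q> \<and> restr B f \<in> \<R>}"
    then show "(case (restr A f, restr B f) of (g, k) \<Rightarrow> \<lambda>x. if x \<in> A then g x else k x) = f"
      by (auto simp: restr_def involutions_on_def)
  next
    fix p assume "p \<in> \<Q> \<times> \<R>"
    then obtain g k where p: "p = (g, k)" "g \<in> \<Q>" "k \<in> \<R>" by auto
    let ?f = "\<lambda>x. if x \<in> A then g x else k x"
    have g: "g \<in> involutions_on A" and k: "k \<in> involutions_on B" using p Q R by auto
    have kB: "k x \<notin> A" if "x \<notin> A" for x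
      using k that disj by (cases "x \<in> B") (auto simp: involutions_on_def)
    have 1: "restr A ?f = g"
      using g by (auto simp: restr_def involutions_on_def)
    have 2: "restr B ?f = k"
    proof
      show "restr B ?f x = k x" for x
        using k disj by (cases "x \<in> B") (auto simp: restr_def involutions_on_def)
    qed
    have "?f \<in> involutions_on (A \<union> B)"
      using g k kB by (auto simp: involutions_on_def)
    then show "(case p of (g, k) \<Rightarrow> \<lambda>x. if x \<in> A then g x else k x) \<in>
        {f. f \<in> involutions_on (A \<union> B) \<and> restr A f \<in> \<Q> \<and> restr B f \<in> \<R>}"
      using p 1 2 by simp
    show "(restr A (case p of (g, k) \<Rightarrow> \<lambda>x. if x \<in> A then g x else k x),
        restr B (case p of (g, k) \<Rightarrow> \<lambda>x. if x \<in> A then g x else k x)) = p"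
      using p 1 2 by simp
  qed auto
  then show ?thesis by (simp add: sum_product sum.cartesian_product)
qed

text \<open>Positions \<open>xs\<close> and values \<open>ys\<close> are separate lists, so that the
  chosen points need not be closed under \<open>f\<close>; \<open>p\<close> gives the ranks of the
  values.\<close>

lemma occ_pattern:
  assumes xs: "sorted_wrt (<) xs" and ys: "sorted_wrt (<) ys"
    and p: "map f xs = map ((!) ys) p" "\<forall>i\<in>set p. i < length ys"
  shows "occ (set xs) f = occ_list p"
proof -
  have len: "length p = length xs" using p(1) by (metis length_map)
  have "occ ((!) xs ` {..<length xs}) f = occ {..<length xs} ((!) p)"
  proof (rule occ_iso)
    fix i j assume ij: "i \<in> {..<length xs}" "j \<in> {..<length xs}"
    then show "xs ! i < xs ! j \<longleftrightarrow> i < j"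
      using xs by (metis lessThan_iff linorder_neqE_nat less_asym less_irrefl sorted_wrt_nth_less)
    have "f (xs ! m) = ys ! (p ! m)" if "m < length xs" for m
      using p(1) len that by (metis nth_map)
    moreover have "p ! i < length ys" "p ! j < length ys" using p(2) ij len by auto
    then have "ys ! (p ! i) < ys ! (p ! j) \<longleftrightarrow> p ! i < p ! j"
      using ys by (metis linorder_neqE_nat less_asym less_irrefl sorted_wrt_nth_less)
    ultimately show "f (xs ! i) < f (xs ! j) \<longleftrightarrow> p ! i < p ! j" using ij by simp
  qed
  moreover have "(!) xs ` {..<length xs} = set xs" by (auto simp: set_conv_nth)
  ultimately show ?thesis by (simp add: occ_list_eq len)
qed

lemma occ_ge_pattern:
  assumes "finite S" "set xs \<subseteq> S" "sorted_wrt (<) xs" "sorted_wrt (<) ys"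
    "map f xs = map ((!) ys) p" "\<forall>i\<in>set p. i < length ys"
  shows "occ_list p \<le> occ S f"
  using occ_mono [OF assms(1,2), of f] occ_pattern [OF assms(3-)] by simp

text \<open>All identities are needed only for fewer than 8 occurrences.\<close>

definition eq8 :: "real fps \<Rightarrow> real fps \<Rightarrow> bool" where
  "eq8 a b \<longleftrightarrow> (\<forall>k<8. fps_nth a k = fps_nth b k)"

lemma eq8_refl [simp]: "eq8 a a"
  by (simp add: eq8_def)

lemma eq8_sym: "eq8 a b \<Longrightarrow> eq8 b a"
  by (simp add: eq8_def)

lemma eq8_trans [trans]: "eq8 a b \<Longrightarrow> eq8 b c \<Longrightarrow> eq8 a c"
  by (simp add: eq8_def)

lemma eq8_add: "eq8 a b \<Longrightarrow> eq8 c d \<Longrightarrow> eq8 (a + c) (b + d)"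
  by (simp add: eq8_def)

lemma eq8_mult: "eq8 a b \<Longrightarrow> eq8 c d \<Longrightarrow> eq8 (a * c) (b * d)"
  by (auto simp: eq8_def fps_mult_nth intro!: sum.cong)

lemma eq8_sum: "(\<And>x. x \<in> A \<Longrightarrow> eq8 (f x) (g x)) \<Longrightarrow> eq8 (sum f A) (sum g A)"
  by (auto simp: eq8_def fps_sum_nth intro!: sum.cong)

text \<open>Involutions with 8 or more occurrences do not reach the first eight coefficients, so a
  classification may ignore them.\<close>

lemma eq8_sum_weight:
  assumes fin: "finite A" "finite B"
    and AB: "\<And>f. occ S f < 8 \<Longrightarrow> f \<in> A \<longleftrightarrow> f \<in> B"
  shows "eq8 (sum (weight 0 S) A) (sum (weight 0 S) B)"
proof -
  have small: "eq8 (sum (weight 0 S) C) (sum (weight 0 S) {f \<in> C. occ S f < 8})" if "finite C" for C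
    unfolding eq8_def
  proof (intro allI impI)
    fix k :: nat assume "k < 8"
    then show "fps_nth (sum (weight 0 S) C) k = fps_nth (sum (weight 0 S) {f \<in> C. occ S f < 8}) k"
      unfolding fps_sum_nth using that
      by (intro sum.mono_neutral_right) (auto simp: weight_def)
  qed
  have "{f \<in> A. occ S f < 8} = {f \<in> B. occ S f < 8}" using AB by blast
  then show ?thesis
    using eq8_trans [OF small [OF fin(1)]] eq8_sym [OF small [OF fin(2)]] by simp
qed

definition W :: "nat \<Rightarrow> nat \<Rightarrow> real fps" where
  "W n h = total_weight 0 {..<n} {n..<n + h}"

text \<open>The points enclosed by two crossing arcs; the occurrence formed by the two arcs alone is
  left out and reappears as a factor \<open>fps_X\<close>.\<close>

definition D :: "nat \<Rightarrow> real fps" where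
  "D n = total_weight 2 {..<n} {}"

lemma total_weight_W:
  "finite T \<Longrightarrow> finite Z \<Longrightarrow> (\<And>x y. x \<in> T \<Longrightarrow> y \<in> Z \<Longrightarrow> x < y) \<Longrightarrow> total_weight 0 T Z = W (card T) (card Z)"
  unfolding W_def by (rule total_weight_card)

lemma total_weight_D: "finite T \<Longrightarrow> total_weight 2 T {} = D (card T)"
  unfolding D_def using total_weight_card [of T "{}" 2] by simp

section \<open>Gluing a block of complete arcs into a partial involution\<close>

lemma finite_nested_end [simp]: "finite T \<Longrightarrow> finite Z \<Longrightarrow> finite (nested_end T Z)"
  by (rule finite_subset [of _ "involutions_on (T \<union> Z)"]) (auto simp: nested_end_def)

lemma nested_end_empty: "nested_end T {} = involutions_on T"
  by (auto simp: nested_end_def)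

text \<open>A partial involution on \<open>{..<b}\<close>, closed by \<open>Z\<close>, together with
  a block \<open>B\<close> that is matched within itself. In the applications \<open>B\<close> and
  \<open>Z\<close> are interleaved, and this is where the crossings come from.\<close>

definition glue :: "nat \<Rightarrow> nat set \<Rightarrow> nat set \<Rightarrow> (nat \<Rightarrow> nat) set \<Rightarrow> (nat \<Rightarrow> nat) set" where
  "glue b Z B \<R> = {f \<in> involutions_on ({..<b} \<union> Z \<union> B). f ` Z \<subseteq> {..<b} \<and>
     (\<forall>x\<in>Z. \<forall>y\<in>Z. x < y \<longrightarrow> f y < f x) \<and> restr B f \<in> \<R>}"

lemma involutions_on_closed_Un:
  assumes "f \<in> involutions_on (A \<union> B)" "A \<inter> B = {}" "f ` B \<subseteq> B"
  shows "f ` A \<subseteq> A"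
proof
  fix y assume "y \<in> f ` A"
  then obtain x where x: "x \<in> A" "y = f x" by auto
  have "f y = x" "y \<in> A \<union> B" using x assms(1) by (auto simp: involutions_on_def)
  moreover have "y \<notin> B" using x assms(2,3) \<open>f y = x\<close> by (metis disjoint_iff image_subset_iff)
  ultimately show "y \<in> A" by simp
qed

lemma glue_closed: "f \<in> glue b Z B \<R> \<Longrightarrow> \<R> \<subseteq> involutions_on B \<Longrightarrow> f ` B \<subseteq> B"
proof
  fix y assume f: "f \<in> glue b Z B \<R>" and R: "\<R> \<subseteq> involutions_on B" and "y \<in> f ` B"
  then obtain x where x: "x \<in> B" "y = f x" by auto
  have "restr B f \<in> involutions_on B" using f R by (auto simp: glue_def)
  then have "restr B f x \<in> B" using x(1) by (simp add: involutions_on_def)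
  then show "y \<in> B" using x by (simp add: restr_def)
qed

text \<open>Only the arcs with right end in \<open>K\<close> interact with the block \<open>B\<close>: the other arcs ending in \<open>Z\<close>
  surround the block.\<close>

lemma occ_glue:
  assumes fin: "finite Z" "finite B" and f: "f \<in> involutions_on ({..<b} \<union> Z \<union> B)"
    and fZ: "f ` Z \<subseteq> {..<b}" and anti: "\<And>x y. x \<in> Z \<Longrightarrow> y \<in> Z \<Longrightarrow> x < y \<Longrightarrow> f y < f x"
    and fB: "f ` B \<subseteq> B" and ge: "\<And>y. y \<in> B \<union> Z \<Longrightarrow> b \<le> y" and disj: "B \<inter> Z = {}"
    and K: "K \<subseteq> Z" "\<And>z y. z \<in> Z - K \<Longrightarrow> y \<in> B \<Longrightarrow> y < z"
  shows "occ ({..<b} \<union> Z \<union> B) f = occ ({..<b} \<union> Z) f + occ (B \<union> K \<union> f ` K) f"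
proof -
  let ?S = "{..<b} \<union> Z \<union> B"
  have inv: "f (f x) = x" for x using f by (simp add: involutions_on_def)
  have cl: "f x \<in> ?S" if "x \<in> ?S" for x using f that unfolding involutions_on_def by blast
  have Z: "f z < b" "b \<le> z" "z \<notin> B" "f z \<notin> B" if "z \<in> Z" for z
    using that fZ ge disj by (force simp: not_le)+
  have B: "f y \<in> B" "b \<le> y" "b \<le> f y" "y \<notin> Z" if "y \<in> B" for y
    using that fB ge disj by auto
  have anti': "y < x \<longleftrightarrow> f x < f y" if "x \<in> Z" "y \<in> Z" for x y
    using that anti by (metis linorder_neqE_nat less_asym)
  have up: "f x \<in> Z" if "x < b" "b \<le> f x" for x
  proof -
    have "f x \<notin> B" using B(2) [of x] fB inv [of x] that(1) by (metis B(1) not_le)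
    then show ?thesis using cl [of x] that by auto
  qed
  \<comment> \<open>The arcs over the cut at \<open>b\<close> are exactly those ending in
    \<open>Z\<close>, which are nested.\<close>
  have "occ ?S f = occ {x \<in> ?S. x < b \<or> f x < b} f + occ {x \<in> ?S. b \<le> x \<or> b \<le> f x} f"
  proof (rule occ_nested_cut)
    fix x y assume "x < y" "y < b" "b \<le> f x" "b \<le> f y"
    then show "f y < f x" using anti' [of "f x" "f y"] up inv by simp
  qed (use fin f in auto)
  moreover have "{x \<in> ?S. x < b \<or> f x < b} = {..<b} \<union> Z"
    using Z B by fastforce
  moreover have "{x \<in> ?S. b \<le> x \<or> b \<le> f x} = B \<union> Z \<union> f ` Z"
  proof (intro set_eqI iffI)
    fix x assume "x \<in> {x \<in> ?S. b \<le> x \<or> b \<le> f x}"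
    then show "x \<in> B \<union> Z \<union> f ` Z" using up [of x] inv [of x] by (auto intro: rev_image_eqI)
  qed (use Z B inv in auto)
  moreover have "B \<union> K \<union> f ` K = (B \<union> Z \<union> f ` Z) - ((Z - K) \<union> f ` (Z - K))"
  proof -
    have nZ: "f z \<noteq> w" if "z \<in> Z" "w \<in> Z" for z w using Z that by (metis not_le)
    have nf: "f z \<noteq> f w" if "z \<in> K" "w \<in> Z - K" for z w
    proof
      assume "f z = f w"
      then have "z = w" using inv by metis
      then show False using that by simp
    qed
    show ?thesis
    proof (intro set_eqI iffI)
      fix x assume "x \<in> B \<union> K \<union> f ` K"
      then consider "x \<in> B" | "x \<in> K" | z where "z \<in> K" "x = f z" by auto
      then show "x \<in> B \<union> Z \<union> f ` Z - (Z - K \<union> f ` (Z - K))"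
      proof cases
        case 1 then show ?thesis using Z by auto
      next
        case 2 then show ?thesis using K(1) nZ by blast
      next
        case 3
        then have "z \<in> Z" using K(1) by auto
        then show ?thesis using 3 nZ nf by auto
      qed
    qed blast
  qed
  \<comment> \<open>An arc with right end in \<open>Z - K\<close> surrounds the block and is nested
    with the other arcs ending in \<open>Z\<close>, so its ends lie in no ascending pair of this
    set.\<close>
  moreover have "occ ((B \<union> Z \<union> f ` Z) - ((Z - K) \<union> f ` (Z - K))) f = occ (B \<union> Z \<union> f ` Z) f"
  proof (rule occ_remove)
    fix x y assume x: "x \<in> (Z - K) \<union> f ` (Z - K)" and y: "y \<in> B \<union> Z \<union> f ` Z"
    then obtain z where z: "z \<in> Z - K" "x = z \<and> f x = f z \<or> x = f z \<and> f x = z" using inv by auto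
    from y have "(x < y \<longrightarrow> f y \<le> f x) \<and> (y < x \<longrightarrow> f x \<le> f y)"
    proof (elim UnE imageE)
      assume "y \<in> B"
      then show ?thesis using z Z [of z] B [of y] K(2) [of z y] K(2) [of z "f y"] by auto
    next
      assume "y \<in> Z"
      then show ?thesis using z Z [of z] Z [of y] anti [of z y] anti [of y z] by auto
    next
      fix w assume "y = f w" "w \<in> Z"
      then show ?thesis using z Z [of z] Z [of w] anti' [of z w] anti' [of w z] inv [of w] by auto
    qed
    then show "x < y \<Longrightarrow> f y \<le> f x" "y < x \<Longrightarrow> f x \<le> f y" by auto
  qed
  ultimately show ?thesis by simp
qed

text \<open>By \<open>occ_glue\<close> the weight factors: the points of
  \<open>{..<b} \<union> Z\<close> sum to \<open>W b (card Z)\<close>, and \<open>H\<close> is the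
  number of occurrences inside the block and with the arcs ending in \<open>K\<close>.\<close>

lemma sum_weight_glue:
  assumes fin: "finite Z" "finite B" and ge: "\<And>y. y \<in> B \<union> Z \<Longrightarrow> b \<le> y" and disj: "B \<inter> Z = {}"
    and K: "K \<subseteq> Z" "\<And>z y. z \<in> Z - K \<Longrightarrow> y \<in> B \<Longrightarrow> y < z"
    and R: "\<R> \<subseteq> involutions_on B"
    and cost: "\<And>f. f \<in> glue b Z B \<R> \<Longrightarrow> occ (B \<union> K \<union> f ` K) f = H (restr B f)"
  shows "sum (weight 0 ({..<b} \<union> Z \<union> B)) (glue b Z B \<R>) = W b (card Z) * (\<Sum>g\<in>\<R>. fps_X ^ H g)"
proof -
  let ?A = "{..<b} \<union> Z"
  have disjA: "?A \<inter> B = {}" using ge disj by (force simp: not_le)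
  have eq: "glue b Z B \<R> =
      {f. f \<in> involutions_on (?A \<union> B) \<and> restr ?A f \<in> nested_end {..<b} Z \<and> restr B f \<in> \<R>}"
  proof (intro set_eqI iffI)
    fix f assume f: "f \<in> glue b Z B \<R>"
    then have "f ` ?A \<subseteq> ?A"
      using disjA glue_closed [OF f R] involutions_on_closed_Un [of f ?A B] by (auto simp: glue_def)
    then have "restr ?A f \<in> involutions_on ?A"
      using f by (intro involutions_on_restr) (auto simp: glue_def)
    then show "f \<in> {f. f \<in> involutions_on (?A \<union> B) \<and> restr ?A f \<in> nested_end {..<b} Z \<and> restr B f \<in> \<R>}"
      using f by (auto simp: glue_def nested_end_def restr_def)
  next
    fix f assume f: "f \<in> {f. f \<in> involutions_on (?A \<union> B) \<and> restr ?A f \<in> nested_end {..<b} Z \<and> restr B f \<in> \<R>}"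
    then have r: "restr ?A f \<in> nested_end {..<b} Z" by simp
    have "restr ?A f x = f x" if "x \<in> Z" for x using that by (simp add: restr_def)
    then show "f \<in> glue b Z B \<R>"
      using f r by (auto simp: glue_def nested_end_def image_subset_iff)
  qed
  have "weight 0 (?A \<union> B) f = weight 0 ?A (restr ?A f) * fps_X ^ H (restr B f)"
    if f: "f \<in> glue b Z B \<R>" for f
  proof -
    have "occ (?A \<union> B) f = occ ?A f + occ (B \<union> K \<union> f ` K) f"
    proof (rule occ_glue [OF fin _ _ _ glue_closed [OF f R] ge disj K])
      show "f ` Z \<subseteq> {..<b}" "f \<in> involutions_on (?A \<union> B)" using f by (auto simp: glue_def)
      show "\<And>x y. x \<in> Z \<Longrightarrow> y \<in> Z \<Longrightarrow> x < y \<Longrightarrow> f y < f x" using f by (simp add: glue_def)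
    qed auto
    then show ?thesis using cost [OF f] by (simp add: weight_def power_add)
  qed
  then have "sum (weight 0 (?A \<union> B)) (glue b Z B \<R>)
      = (\<Sum>f\<in>glue b Z B \<R>. weight 0 ?A (restr ?A f) * fps_X ^ H (restr B f))"
    by (intro sum.cong) auto
  also have "\<dots> = sum (weight 0 ?A) (nested_end {..<b} Z) * (\<Sum>g\<in>\<R>. fps_X ^ H g)"
    unfolding eq by (rule sum_glue [OF disjA _ R]) (auto simp: nested_end_def)
  also have "sum (weight 0 ?A) (nested_end {..<b} Z) = W b (card Z)"
    using total_weight_W [of "{..<b}" Z] fin ge by (force simp: total_weight_def)
  finally show ?thesis .
qed

text \<open>The arcs from \<open>a\<close> to \<open>n\<close> and from \<open>b\<close> to
  \<open>z\<close> cross and form one occurrence. An ascending pair of \<open>M\<close> can play 34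
  before the pair \<open>(n, z)\<close> and 12 after the pair \<open>(a, b)\<close>, which gives the
  factor 2.\<close>

lemma occ_crossed:
  assumes M: "M \<subseteq> {b<..<n}" "f ` M \<subseteq> M" and ord: "a < b" "b < n" "n < z"
    and f: "f a = n" "f b = z" "f n = a" "f z = b"
  shows "occ (M \<union> {a, b, n, z}) f = 1 + occ M f + 2 * asc M f"
proof -
  have fin: "finite M" using M(1) finite_subset by blast
  have m: "b < x" "x < n" "b < f x" "f x < n" "f x \<in> M" if "x \<in> M" for x
    using that M(1) subsetD [OF M(1), of "f x"] M(2) by auto
  let ?S = "M \<union> {a, b, n, z}"
  let ?p = "\<lambda>(i, j). (i, j, n, z)" and ?q = "\<lambda>(k, l). (a, b, k, l)"
  have "occ_tuples ?S f = {(a, b, n, z)} \<union> occ_tuples M f \<union> ?p ` asc_pairs M f \<union> ?q ` asc_pairs M f"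
    (is "_ = ?R")
  proof
    show "?R \<subseteq> occ_tuples ?S f"
    proof -
      have "?p (i, j) \<in> occ_tuples ?S f" "?q (i, j) \<in> occ_tuples ?S f" if "(i, j) \<in> asc_pairs M f" for i j
        using that m [of i] m [of j] ord f by (auto simp: occ_tuples_def asc_pairs_def)
      moreover have "(a, b, n, z) \<in> occ_tuples ?S f" using ord f by (simp add: occ_tuples_def)
      moreover have "occ_tuples M f \<subseteq> occ_tuples ?S f" by (rule occ_tuples_mono) auto
      ultimately show ?thesis by (intro Un_least image_subsetI) auto
    qed
    show "occ_tuples ?S f \<subseteq> ?R"
    proof
      fix t assume "t \<in> occ_tuples ?S f"
      then obtain i j k l where t: "t = (i, j, k, l)" "i \<in> ?S" "j \<in> ?S" "k \<in> ?S" "l \<in> ?S"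
        "i < j" "j < k" "k < l" "f k < f l" "f l < f i" "f i < f j"
        by (auto simp: occ_tuples_def)
      have cases: "x = a \<and> f x = n \<or> x = b \<and> f x = z \<or> x = n \<and> f x = a \<or> x = z \<and> f x = b \<or>
          x \<in> M \<and> b < x \<and> x < n \<and> b < f x \<and> f x < n" if "x \<in> ?S" for x
        using that m [of x] f by auto
      have "k \<le> z" using cases [OF t(4)] ord by auto
      then have "j < z" using t(7) by simp
      \<comment> \<open>A point of \<open>M\<close> and one of the four arc ends are always in
        descending order, so an ascending pair either lies in \<open>M\<close> or consists of arc
        ends.\<close>
      have ij: "i = a \<and> j = b \<or> i \<in> M \<and> j \<in> M"
        using cases [OF t(2)] cases [OF t(3)] \<open>j < z\<close> t(6,11) ord by (elim disjE conjE) linarith+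
      then have "b \<le> j" using m [of j] by auto
      then have kl: "k = n \<and> l = z \<or> k \<in> M \<and> l \<in> M"
        using cases [OF t(4)] cases [OF t(5)] t(7-9) ord by (elim disjE conjE) linarith+
      consider "i = a" "j = b" "k = n" "l = z" | "i = a" "j = b" "(k, l) \<in> asc_pairs M f"
        | "k = n" "l = z" "(i, j) \<in> asc_pairs M f" | "(i, j, k, l) \<in> occ_tuples M f"
        using ij kl t(6-) unfolding occ_tuples_def asc_pairs_def by blast
      then show "t \<in> ?R"
        unfolding t(1) by cases (blast, (simp add: image_iff, fastforce)+, blast)
    qed
  qed
  moreover have "occ_tuples M f \<inter> ?p ` asc_pairs M f = {}" "occ_tuples M f \<inter> ?q ` asc_pairs M f = {}"
    "?p ` asc_pairs M f \<inter> ?q ` asc_pairs M f = {}"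
    "(a, b, n, z) \<notin> occ_tuples M f \<union> ?p ` asc_pairs M f \<union> ?q ` asc_pairs M f"
    using m ord by (force simp: occ_tuples_def asc_pairs_def)+
  moreover have "card (?p ` asc_pairs M f) = asc M f" "card (?q ` asc_pairs M f) = asc M f"
    unfolding asc_def by (rule card_image; force simp: inj_on_def)+
  moreover have "card ({x} \<union> A \<union> B \<union> C) = 1 + card A + card B + card C"
    if "finite A" "finite B" "finite C" "A \<inter> B = {}" "A \<inter> C = {}" "B \<inter> C = {}" "x \<notin> A \<union> B \<union> C"
    for x and A B C :: "(nat \<times> nat \<times> nat \<times> nat) set"
    using that by (simp add: card_Un_disjoint Int_Un_distrib Un_assoc)
  ultimately have "card (occ_tuples ?S f) = 1 + card (occ_tuples M f) + asc M f + asc M f"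
    using fin by (metis finite_occ_tuples finite_asc_pairs finite_imageI)
  then show ?thesis unfolding occ_def by simp
qed

lemma restr_eqD: "restr B f = g \<Longrightarrow> x \<in> B \<Longrightarrow> f x = g x"
  by (auto simp: restr_def)

lemma glue_single_iff:
  assumes S: "{..<b} \<union> Z \<union> B = S" and "\<And>x. x \<notin> B \<Longrightarrow> \<beta> x = x"
  shows "f \<in> glue b Z B {\<beta>} \<longleftrightarrow> f \<in> involutions_on S \<and> (\<forall>x\<in>Z. f x < b) \<and>
    (\<forall>x\<in>Z. \<forall>y\<in>Z. x < y \<longrightarrow> f y < f x) \<and> (\<forall>x\<in>B. f x = \<beta> x)"
proof -
  have "restr B f = \<beta> \<longleftrightarrow> (\<forall>x\<in>B. f x = \<beta> x)"
    using assms(2) by (auto simp: restr_def fun_eq_iff)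
  then show ?thesis by (auto simp: glue_def S)
qed

lemma sum_weight_glue_single:
  assumes "finite Z" "finite B" "\<And>y. y \<in> B \<union> Z \<Longrightarrow> b \<le> y" "B \<inter> Z = {}"
    "K \<subseteq> Z" "\<And>z y. z \<in> Z - K \<Longrightarrow> y \<in> B \<Longrightarrow> y < z" "\<beta> \<in> involutions_on B"
    "\<And>f. f \<in> glue b Z B {\<beta>} \<Longrightarrow> occ (B \<union> K \<union> f ` K) f = c"
    and S: "S = {..<b} \<union> Z \<union> B"
  shows "sum (weight 0 S) (glue b Z B {\<beta>}) = W b (card Z) * fps_X ^ c"
  unfolding S by (subst sum_weight_glue [where K = K and H = "\<lambda>_. c"]) (use assms in auto)

subsection \<open>The last point is fixed, open, or closed without a crossing\<close>

text \<open>Here and below \<open>n\<close> is the point scanned last and \<open>h\<close> the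
  number of arcs open after it; these are closed by the points after \<open>n\<close>.\<close>

definition ends_fixed where
  "ends_fixed n h = glue n {n<..n + h} {n} {id}"

text \<open>The arc opened at \<open>n\<close> is the innermost open arc, so in nested order it is
  closed by \<open>n + 1\<close>; the other \<open>h - 1\<close> arcs surround it.\<close>

definition ends_open where
  "ends_open n h = glue n {n + 1<..n + h} {n, n + 1} {Transposition.transpose n (n + 1)}"

lemma sum_ends_fixed: "sum (weight 0 {..n + h}) (ends_fixed n h) = W n h"
proof -
  have "sum (weight 0 {..n + h}) (ends_fixed n h) = W n (card {n<..n + h}) * fps_X ^ 0"
    unfolding ends_fixed_def
    by (rule sum_weight_glue_single [where K = "{}"])
      (auto simp: involutions_on_def intro!: occ_antitone)
  then show ?thesis by simp
qed

lemma sum_ends_open: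
  assumes "h \<ge> 1"
  shows "sum (weight 0 {..n + h}) (ends_open n h) = W n (h - 1)"
proof -
  have "sum (weight 0 {..n + h}) (ends_open n h) = W n (card {n + 1<..n + h}) * fps_X ^ 0"
    unfolding ends_open_def
  proof (rule sum_weight_glue_single [where K = "{}"])
    let ?\<beta> = "Transposition.transpose n (n + 1)"
    show "?\<beta> \<in> involutions_on {n, n + 1}"
      by (auto simp: involutions_on_def Transposition.transpose_def)
    fix f assume f: "f \<in> glue n {n + 1<..n + h} {n, n + 1} {?\<beta>}"
    have "f n = ?\<beta> n" "f (n + 1) = ?\<beta> (n + 1)"
      by (rule restr_eqD [of "{n, n + 1}"]; use f in \<open>simp add: glue_def\<close>)+
    then show "occ ({n, n + 1} \<union> {} \<union> f ` {}) f = 0"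
      by (intro occ_antitone) auto
  qed (use assms in auto)
  then show ?thesis by simp
qed

text \<open>A point that closes an arc in nested order behaves like the closing points behind it and
  is simply counted among them, which gives \<open>h + 1\<close> of them.\<close>

definition ends_nested where
  "ends_nested n h = nested_end {..<n} {n..n + h}"

lemma sum_ends_nested: "sum (weight 0 {..n + h}) (ends_nested n h) = W n (h + 1)"
proof -
  have "{..<n} \<union> {n..n + h} = {..n + h}" by auto
  then show ?thesis
    unfolding ends_nested_def using total_weight_W [of "{..<n}" "{n..n + h}"]
    by (simp add: total_weight_def)
qed

subsection \<open>The last point closes an arc that crosses another arc\<close>

text \<open>The arc closed at \<open>n\<close> is crossed by a single arc around an arbitrary involution (\<open>ends_crossed\<close>), or
  by two nested arcs (\<open>right\<close>), or a single arc crosses it and the arc nested directly in it (\<open>left\<close>).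
  In the last two cases the points enclosed are reversed or form a single fixed point.\<close>

definition ends_crossed where
  "ends_crossed n h b = glue b (insert n {n + 1<..n + h}) ({b..<n} \<union> {n + 1})
     {g \<in> involutions_on ({b..<n} \<union> {n + 1}). g (n + 1) = b}"

lemma sum_involutions_with_arc:
  fixes G :: "(nat \<Rightarrow> nat) \<Rightarrow> 'a::comm_semiring_1"
  assumes uv: "u \<notin> M" "v \<notin> M"
  shows "(\<Sum>g | g \<in> involutions_on (M \<union> {u, v}) \<and> g u = v. G (restr M g)) = sum G (involutions_on M)"
proof -
  let ?P = "{u, v}" let ?s = "Transposition.transpose u v"
  have s: "?s \<in> involutions_on ?P"
    by (auto simp: involutions_on_def Transposition.transpose_def)
  have *: "g \<in> involutions_on (M \<union> ?P) \<and> g u = v \<longleftrightarrow>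
      g \<in> involutions_on (M \<union> ?P) \<and> restr M g \<in> involutions_on M \<and> restr ?P g \<in> {?s}" for g
  proof
    assume g: "g \<in> involutions_on (M \<union> ?P) \<and> g u = v"
    then have "g (g u) = u" unfolding involutions_on_def by blast
    then have gv: "g u = v" "g v = u" using g by auto
    have "g ` M \<subseteq> M"
      by (rule involutions_on_closed_Un [of g M ?P]) (use g gv uv in auto)
    then have "restr M g \<in> involutions_on M"
      using g by (intro involutions_on_restr) auto
    moreover have "restr ?P g = ?s"
      using gv by (auto simp: restr_def Transposition.transpose_def)
    ultimately show "g \<in> involutions_on (M \<union> ?P) \<and> restr M g \<in> involutions_on M \<and> restr ?P g \<in> {?s}"
      using g by simp
  next
    assume g: "g \<in> involutions_on (M \<union> ?P) \<and> restr M g \<in> involutions_on M \<and> restr ?P g \<in> {?s}"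
    then have "g u = ?s u" by (intro restr_eqD [of ?P]) auto
    then show "g \<in> involutions_on (M \<union> ?P) \<and> g u = v" using g by simp
  qed
  have "(\<Sum>g | g \<in> involutions_on (M \<union> ?P) \<and> g u = v. G (restr M g) * 1) =
      sum G (involutions_on M) * (\<Sum>g\<in>{?s}. 1)"
    unfolding * by (rule sum_glue) (use s uv in auto)
  then show ?thesis by simp
qed

text \<open>With the arc from \<open>b\<close> to \<open>n + 1\<close> prescribed, the block is an
  arbitrary involution of the \<open>n - 1 - b\<close> points under it; the exponent is that of
  \<open>occ_crossed\<close>.\<close>

lemma sum_fill:
  assumes "b < n"
  shows "(\<Sum>g \<in> {g \<in> involutions_on ({b..<n} \<union> {n + 1}). g (n + 1) = b}.
      fps_X ^ (1 + (occ {b<..<n} g + 2 * asc {b<..<n} g))) = (fps_X * D (n - 1 - b) :: real fps)"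
proof -
  let ?M = "{b<..<n}"
  have eq: "{b..<n} \<union> {n + 1} = ?M \<union> {n + 1, b}" using assms by auto
  have "(\<Sum>g \<in> {g \<in> involutions_on ({b..<n} \<union> {n + 1}). g (n + 1) = b}. fps_X ^ (1 + (occ ?M g + 2 * asc ?M g)))
    = (\<Sum>g | g \<in> involutions_on (?M \<union> {n + 1, b}) \<and> g (n + 1) = b. (\<lambda>g. fps_X * weight 2 ?M g) (restr ?M g))"
    unfolding eq by (simp add: weight_def)
  also have "\<dots> = (\<Sum>g\<in>involutions_on ?M. fps_X * weight 2 ?M g)"
    by (rule sum_involutions_with_arc) auto
  also have "\<dots> = fps_X * total_weight 2 ?M {}"
    by (simp add: total_weight_def nested_end_empty sum_distrib_left)
  also have "total_weight 2 ?M {} = D (n - 1 - b)"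
    by (simp add: total_weight_D)
  finally show ?thesis .
qed

text \<open>The point \<open>n\<close> takes the place of \<open>n + 1\<close>, which belongs to the
  block, so \<open>Z\<close> still has \<open>h\<close> points.\<close>

lemma sum_ends_crossed:
  assumes "b < n" "h \<ge> 1"
  shows "sum (weight 0 {..n + h}) (ends_crossed n h b) = W b h * (fps_X * D (n - 1 - b))"
proof -
  let ?M = "{b<..<n}" let ?B = "{b..<n} \<union> {n + 1}" let ?Z = "insert n {n + 1<..n + h}"
  let ?R = "{g \<in> involutions_on ?B. g (n + 1) = b}"
  have S: "{..n + h} = {..<b} \<union> ?Z \<union> ?B" using assms by auto
  have "sum (weight 0 {..n + h}) (ends_crossed n h b)
      = W b (card ?Z) * (\<Sum>g\<in>?R. fps_X ^ (1 + (occ ?M g + 2 * asc ?M g)))"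
    unfolding ends_crossed_def S
  proof (rule sum_weight_glue [where K = "{n}"])
    fix f assume f: "f \<in> glue b ?Z ?B ?R"
    have inv: "f (f x) = x" for x using f by (simp add: glue_def involutions_on_def)
    have "restr ?B f (n + 1) = b" "f n < b" using f by (auto simp: glue_def)
    then have fb: "f (n + 1) = b" "f b = n + 1" "f n < b" using inv by (auto simp: restr_def)
    have fB: "f ` ?B \<subseteq> ?B" by (rule glue_closed [OF f]) auto
    have fM: "f ` ?M \<subseteq> ?M"
    proof
      fix y assume "y \<in> f ` ?M"
      then obtain x where x: "x \<in> ?M" "y = f x" by auto
      then have "x \<in> ?B" by simp
      then have "y \<in> ?B" using fB x(2) by blast
      moreover have "y \<noteq> b" "y \<noteq> n + 1" using x fb inv [of x] by auto
      ultimately show "y \<in> ?M" by auto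
    qed
    have "?B \<union> {n} \<union> f ` {n} = ?M \<union> {f n, b, n, n + 1}" using assms by auto
    moreover have "occ (?M \<union> {f n, b, n, n + 1}) f = 1 + occ ?M f + 2 * asc ?M f"
      by (rule occ_crossed) (use fM fb inv assms in auto)
    moreover have "occ ?M (restr ?B f) = occ ?M f" "asc ?M (restr ?B f) = asc ?M f"
      by (rule occ_cong asc_cong; simp add: restr_def)+
    ultimately show "occ (?B \<union> {n} \<union> f ` {n}) f = 1 + (occ ?M (restr ?B f) + 2 * asc ?M (restr ?B f))"
      by simp
  qed (use assms in auto)
  then show ?thesis using assms(2) by (simp only: sum_fill [OF assms(1)]) simp
qed

text \<open>Two nested open arcs with adjacent left ends \<open>b\<close> and \<open>b + 1\<close>,
  around reversed points.\<close>

definition right_block :: "nat \<Rightarrow> nat \<Rightarrow> nat \<Rightarrow> nat" where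
  "right_block n b = (\<lambda>x. if x = b then n + 2 else if x = b + 1 then n + 1 else if x = n + 1 then b + 1
        else if x = n + 2 then b else if b + 1 < x \<and> x < n then n + b + 1 - x else x)"

definition ends_crossed_right where
  "ends_crossed_right n h b = glue b (insert n {n + 2<..n + h}) ({b..<n} \<union> {n + 1, n + 2})
     {right_block n b}"

lemma right_block: "b + 1 < n \<Longrightarrow> right_block n b \<in> involutions_on ({b..<n} \<union> {n + 1, n + 2})"
  by (auto simp: involutions_on_def right_block_def)

text \<open>The reversed points are in no ascending pair. The arc closed at \<open>n\<close> crosses
  both open arcs, which gives 2 ascending pairs of left ends and 2 of right ends, hence 2 * 2 = 4
  occurrences. Two closing points move to the block and \<open>n\<close> joins \<open>Z\<close>,
  which leaves \<open>h - 1\<close>.\<close>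

lemma sum_ends_crossed_right:
  assumes "b + 1 < n" "h \<ge> 2"
  shows "sum (weight 0 {..n + h}) (ends_crossed_right n h b) = W b (h - 1) * fps_X ^ 4"
proof -
  let ?B = "{b..<n} \<union> {n + 1, n + 2}" let ?Z = "insert n {n + 2<..n + h}"
  let ?\<beta> = "right_block n b"
  have "sum (weight 0 {..n + h}) (ends_crossed_right n h b) = W b (card ?Z) * fps_X ^ 4"
    unfolding ends_crossed_right_def
  proof (rule sum_weight_glue_single [where K = "{n}"])
    show "?\<beta> \<in> involutions_on ?B" using assms by (intro right_block)
    fix f assume f: "f \<in> glue b ?Z ?B {?\<beta>}"
    have inv: "f (f x) = x" for x using f by (simp add: glue_def involutions_on_def)
    have fB: "f x = ?\<beta> x" if "x \<in> ?B" for x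
      by (rule restr_eqD [OF _ that]) (use f in \<open>simp add: glue_def\<close>)
    have a: "f n < b" "f (f n) = n" using f inv by (auto simp: glue_def)
    have v: "f b = n + 2" "f (b + 1) = n + 1" "f (n + 1) = b + 1" "f (n + 2) = b"
      using assms fB [of b] fB [of "b + 1"] fB [of "n + 1"] fB [of "n + 2"] by (auto simp: right_block_def)
    have m: "f x = n + b + 1 - x" if "b + 1 < x" "x < n" for x
      using that fB [of x] by (auto simp: right_block_def)
    let ?xs = "[f n, b, b + 1, n, n + 1, n + 2]" and ?C = "?B \<union> {n} \<union> f ` {n}"
    have "set ?xs = ?C - {b + 1<..<n}" using assms a by auto
    moreover have "occ (?C - {b + 1<..<n}) f = occ ?C f"
    proof (rule occ_remove)
      fix x y assume x: "x \<in> {b + 1<..<n}" and y: "y \<in> ?C"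
      from y have "y = f n \<or> y = n \<or> y = n + 1 \<or> y = n + 2 \<or> b \<le> y \<and> y < n" by auto
      moreover have "b \<le> y \<and> y < n \<Longrightarrow> y = b \<or> y = b + 1 \<or> b + 1 < y \<and> y < n" by auto
      ultimately have "y = f n \<or> y = n \<or> y = n + 1 \<or> y = n + 2 \<or> y = b \<or> y = b + 1 \<or> b + 1 < y \<and> y < n"
        by blast
      then have "y < b \<and> f y = n \<or> y = n \<and> f y < b \<or> y = n + 1 \<and> f y = b + 1 \<or> y = n + 2 \<and> f y = b \<or>
          y = b \<and> f y = n + 2 \<or> y = b + 1 \<and> f y = n + 1 \<or> b + 1 < y \<and> y < n \<and> f y = n + b + 1 - y"
        using a v m [of y] by (elim disjE) auto
      moreover have "f x = n + b + 1 - x" using x m by simp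
      ultimately show "x < y \<Longrightarrow> f y \<le> f x" "y < x \<Longrightarrow> f x \<le> f y"
        using x by (simp_all; linarith)+
    qed
    moreover have "occ (set ?xs) f = occ_list [3, 5, 4, 0, 2, 1]"
      by (rule occ_pattern [where ys = ?xs]) (use assms a v in auto)
    moreover have "occ_list [3, 5, 4, 0, 2, 1] = 4" by code_simp
    ultimately show "occ ?C f = 4" by simp
  qed (use assms in auto)
  moreover have "card ?Z = h - 1" using assms(2) by (simp add: Suc_diff_le)
  ultimately show ?thesis by simp
qed

text \<open>In the remaining classes the last point before \<open>Z\<close> is \<open>m + 1\<close> or \<open>m + 3\<close>.\<close>

definition left_block :: "nat \<Rightarrow> nat \<Rightarrow> nat \<Rightarrow> nat" where
  "left_block m b = (\<lambda>x. if x = b then m + 2 else if x = m + 2 then b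
        else if b < x \<and> x < m then m + b - x else x)"

definition ends_crossed_left where
  "ends_crossed_left m h b = glue b (insert m (insert (m + 1) {m + 2<..m + 1 + h})) ({b..<m} \<union> {m + 2})
     {left_block m b}"

lemma left_block: "b < m \<Longrightarrow> left_block m b \<in> involutions_on ({b..<m} \<union> {m + 2})"
  by (auto simp: involutions_on_def left_block_def)

text \<open>Again 2 * 2 = 4 occurrences, now from one open arc across two nested closed arcs. The
  right ends \<open>m\<close> and \<open>m + 1\<close> of the latter both lie in \<open>K\<close>,
  and \<open>m + 2\<close> moves to the block, so \<open>Z\<close> has \<open>h + 1\<close>
  points.\<close>

lemma sum_ends_crossed_left:
  assumes "b < m" "h \<ge> 1"
  shows "sum (weight 0 {..m + 1 + h}) (ends_crossed_left m h b) = W b (h + 1) * fps_X ^ 4"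
proof -
  let ?B = "{b..<m} \<union> {m + 2}" let ?Z = "insert m (insert (m + 1) {m + 2<..m + 1 + h})"
  let ?\<beta> = "left_block m b"
  have "sum (weight 0 {..m + 1 + h}) (ends_crossed_left m h b) = W b (card ?Z) * fps_X ^ 4"
    unfolding ends_crossed_left_def
  proof (rule sum_weight_glue_single [where K = "{m, m + 1}"])
    show "?\<beta> \<in> involutions_on ?B" using assms by (intro left_block)
    fix f assume f: "f \<in> glue b ?Z ?B {?\<beta>}"
    have inv: "f (f x) = x" for x using f by (simp add: glue_def involutions_on_def)
    have fB: "f x = ?\<beta> x" if "x \<in> ?B" for x
      by (rule restr_eqD [OF _ that]) (use f in \<open>simp add: glue_def\<close>)
    have a: "f (m + 1) < f m" "f m < b" "f (f (m + 1)) = m + 1" "f (f m) = m"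
      using f inv by (auto simp: glue_def)
    have v: "f b = m + 2" "f (m + 2) = b"
      using assms fB [of b] fB [of "m + 2"] by (auto simp: left_block_def)
    have m: "f x = m + b - x" if "b < x" "x < m" for x
      using that fB [of x] by (auto simp: left_block_def)
    let ?xs = "[f (m + 1), f m, b, m, m + 1, m + 2]" and ?C = "?B \<union> {m, m + 1} \<union> f ` {m, m + 1}"
    have "set ?xs = ?C - {b<..<m}" using assms a by auto
    moreover have "occ (?C - {b<..<m}) f = occ ?C f"
    proof (rule occ_remove)
      fix x y assume x: "x \<in> {b<..<m}" and y: "y \<in> ?C"
      from y have "y = f (m + 1) \<or> y = f m \<or> y = m \<or> y = m + 1 \<or> y = m + 2 \<or> b \<le> y \<and> y < m" by auto
      then have "y < b \<and> m \<le> f y \<or> m \<le> y \<and> f y \<le> b \<or>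
          y = b \<and> f y = m + 2 \<or> b < y \<and> y < m \<and> f y = m + b - y"
        using a v m [of y] by (elim disjE) (auto simp: le_less)
      moreover have "f x = m + b - x" using x m by simp
      ultimately show "x < y \<Longrightarrow> f y \<le> f x" "y < x \<Longrightarrow> f x \<le> f y"
        using x by (simp_all; linarith)+
    qed
    moreover have "occ (set ?xs) f = occ_list [4, 3, 5, 1, 0, 2]"
      by (rule occ_pattern [where ys = ?xs]) (use assms a v in auto)
    moreover have "occ_list [4, 3, 5, 1, 0, 2] = 4" by code_simp
    ultimately show "occ ?C f = 4" by simp
  qed (use assms in auto)
  moreover have "card ?Z = h + 1" using assms by (simp add: card_insert_if)
  ultimately show ?thesis by simp
qed

definition right_fixed_block :: "nat \<Rightarrow> nat \<Rightarrow> nat" where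
  "right_fixed_block m = (\<lambda>x. if x = m then m + 5 else if x = m + 2 then m + 4 else if x = m + 4 then m + 2
        else if x = m + 5 then m else x)"

definition ends_crossed_right_fixed where
  "ends_crossed_right_fixed m h = glue m (insert (m + 3) {m + 5<..m + 3 + h}) {m, m + 1, m + 2, m + 4, m + 5}
     {right_fixed_block m}"

lemma right_fixed_block: "right_fixed_block m \<in> involutions_on {m, m + 1, m + 2, m + 4, m + 5}"
  by (auto simp: involutions_on_def right_fixed_block_def)

text \<open>The fixed point \<open>m + 1\<close> lies between the left ends of the two open arcs. It
  adds two occurrences to the four of the three arcs: once as the 3, once as the 1.\<close>

lemma sum_ends_crossed_right_fixed:
  assumes "h \<ge> 2"
  shows "sum (weight 0 {..m + 3 + h}) (ends_crossed_right_fixed m h) = W m (h - 1) * fps_X ^ 6"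
proof -
  let ?B = "{m, m + 1, m + 2, m + 4, m + 5}" let ?Z = "insert (m + 3) {m + 5<..m + 3 + h}"
  let ?\<beta> = "right_fixed_block m"
  have "sum (weight 0 {..m + 3 + h}) (ends_crossed_right_fixed m h) = W m (card ?Z) * fps_X ^ 6"
    unfolding ends_crossed_right_fixed_def
  proof (rule sum_weight_glue_single [where K = "{m + 3}"])
    show "?\<beta> \<in> involutions_on ?B" by (rule right_fixed_block)
    fix f assume f: "f \<in> glue m ?Z ?B {?\<beta>}"
    have inv: "f (f x) = x" for x using f by (simp add: glue_def involutions_on_def)
    have fB: "f x = ?\<beta> x" if "x \<in> ?B" for x
      by (rule restr_eqD [OF _ that]) (use f in \<open>simp add: glue_def\<close>)
    have a: "f (m + 3) < m" "f (f (m + 3)) = m + 3" using f inv by (auto simp: glue_def)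
    have v: "f m = m + 5" "f (m + 1) = m + 1" "f (m + 2) = m + 4" "f (m + 4) = m + 2" "f (m + 5) = m"
      using fB [of m] fB [of "m + 1"] fB [of "m + 2"] fB [of "m + 4"] fB [of "m + 5"] by (auto simp: right_fixed_block_def)
    let ?xs = "[f (m + 3), m, m + 1, m + 2, m + 3, m + 4, m + 5]"
    have "?B \<union> {m + 3} \<union> f ` {m + 3} = set ?xs" by auto
    moreover have "occ (set ?xs) f = occ_list [4, 6, 2, 5, 0, 3, 1]"
      by (rule occ_pattern [where ys = ?xs]) (use a v in auto)
    moreover have "occ_list [4, 6, 2, 5, 0, 3, 1] = 6" by code_simp
    ultimately show "occ (?B \<union> {m + 3} \<union> f ` {m + 3}) f = 6" by simp
  next
    show "{..m + 3 + h} = {..<m} \<union> ?Z \<union> ?B"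
    proof (rule set_eqI)
      fix x
      show "x \<in> {..m + 3 + h} \<longleftrightarrow> x \<in> {..<m} \<union> ?Z \<union> ?B"
        unfolding Un_iff insert_iff empty_iff atMost_iff lessThan_iff greaterThanAtMost_iff
        using assms by presburger
    qed
  qed (use assms in auto)
  moreover have "card ?Z = h - 1" using assms by (simp add: Suc_diff_le)
  ultimately show ?thesis by simp
qed

definition ends_crossed_left_fixed where
  "ends_crossed_left_fixed m h = glue m (insert (m + 1) (insert (m + 3) {m + 4<..m + 3 + h})) {m, m + 2, m + 4}
     {Transposition.transpose m (m + 4)}"

lemma left_fixed_block: "Transposition.transpose m (m + 4) \<in> involutions_on {m, m + 2, m + 4}"
  by (auto simp: involutions_on_def Transposition.transpose_def)

text \<open>The fixed point \<open>m + 2\<close> lies between the right ends of the two closed arcs.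
  It adds two occurrences to the four of the three arcs: once as the 4, once as the 2.\<close>

lemma sum_ends_crossed_left_fixed:
  assumes "h \<ge> 1"
  shows "sum (weight 0 {..m + 3 + h}) (ends_crossed_left_fixed m h) = W m (h + 1) * fps_X ^ 6"
proof -
  let ?B = "{m, m + 2, m + 4}" let ?Z = "insert (m + 1) (insert (m + 3) {m + 4<..m + 3 + h})"
  let ?\<beta> = "Transposition.transpose m (m + 4)"
  have "sum (weight 0 {..m + 3 + h}) (ends_crossed_left_fixed m h) = W m (card ?Z) * fps_X ^ 6"
    unfolding ends_crossed_left_fixed_def
  proof (rule sum_weight_glue_single [where K = "{m + 1, m + 3}"])
    show "?\<beta> \<in> involutions_on ?B" by (rule left_fixed_block)
    fix f assume f: "f \<in> glue m ?Z ?B {?\<beta>}"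
    have inv: "f (f x) = x" for x using f by (simp add: glue_def involutions_on_def)
    have fB: "f x = ?\<beta> x" if "x \<in> ?B" for x
      by (rule restr_eqD [OF _ that]) (use f in \<open>simp add: glue_def\<close>)
    have a: "f (m + 3) < f (m + 1)" "f (m + 1) < m" "f (f (m + 3)) = m + 3" "f (f (m + 1)) = m + 1"
      using f inv by (auto simp: glue_def)
    have v: "f m = m + 4" "f (m + 2) = m + 2" "f (m + 4) = m"
      using fB [of m] fB [of "m + 2"] fB [of "m + 4"]
      by (auto simp: Transposition.transpose_def)
    let ?xs = "[f (m + 3), f (m + 1), m, m + 1, m + 2, m + 3, m + 4]"
    have "?B \<union> {m + 1, m + 3} \<union> f ` {m + 1, m + 3} = set ?xs" by auto
    moreover have "occ (set ?xs) f = occ_list [5, 3, 6, 1, 4, 0, 2]"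
      by (rule occ_pattern [where ys = ?xs]) (use a v in auto)
    moreover have "occ_list [5, 3, 6, 1, 4, 0, 2] = 6" by code_simp
    ultimately show "occ (?B \<union> {m + 1, m + 3} \<union> f ` {m + 1, m + 3}) f = 6" by simp
  next
    show "{..m + 3 + h} = {..<m} \<union> ?Z \<union> ?B"
    proof (rule set_eqI)
      fix x
      show "x \<in> {..m + 3 + h} \<longleftrightarrow> x \<in> {..<m} \<union> ?Z \<union> ?B"
        unfolding Un_iff insert_iff empty_iff atMost_iff lessThan_iff greaterThanAtMost_iff
        using assms by presburger
    qed
  qed (use assms in auto)
  moreover have "card ?Z = h + 1" using assms by (simp add: card_insert_if)
  ultimately show ?thesis by simp
qed

section \<open>The classes as conditions on the values near the last point\<close>

lemma nested_end_iff:
  assumes "T \<union> Z = S"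
  shows "f \<in> nested_end T Z \<longleftrightarrow> f \<in> involutions_on S \<and> (\<forall>x\<in>Z. f x \<in> T) \<and>
    (\<forall>x\<in>Z. \<forall>y\<in>Z. x < y \<longrightarrow> f y < f x)"
  using assms by (auto simp: nested_end_def)

lemma atMost_Un_greaterThanAtMost: "{..n} \<union> {n<..n + h} = {..n + h}" for n h :: nat
  by auto

lemmas end_iff = nested_end_iff [OF atMost_Un_greaterThanAtMost]

text \<open>As subsets of the one set \<open>nested_end {..n} {n<..n + h}\<close> the classes can be
  compared: these equivalences serve to show that they are disjoint and exhaustive.\<close>

lemma ends_fixed_iff: "f \<in> ends_fixed n h \<longleftrightarrow> f \<in> nested_end {..n} {n<..n + h} \<and> f n = n"
proof -
  have S: "{..<n} \<union> {n<..n + h} \<union> {n} = {..n + h}" by auto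
  have iff: "f \<in> ends_fixed n h \<longleftrightarrow> f \<in> involutions_on {..n + h} \<and> (\<forall>x\<in>{n<..n + h}. f x < n) \<and>
    (\<forall>x\<in>{n<..n + h}. \<forall>y\<in>{n<..n + h}. x < y \<longrightarrow> f y < f x) \<and> f n = n"
    unfolding ends_fixed_def by (subst glue_single_iff [OF S]) auto
  have ne: "f x < n" if "f x \<le> n" "f n = n" "x \<noteq> n" "f \<in> involutions_on {..n + h}" for x
  proof -
    have "f (f x) = x" using that(4) by (simp add: involutions_on_def)
    then have "f x \<noteq> n" using that by auto
    then show ?thesis using that by simp
  qed
  then show ?thesis
    unfolding iff end_iff by (fastforce simp: less_imp_le)
qed

lemma ends_open_iff:
  assumes "h \<ge> 1"
  shows "f \<in> ends_open n h \<longleftrightarrow> f \<in> nested_end {..n} {n<..n + h} \<and> f n = n + 1"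
proof -
  have S: "{..<n} \<union> {n + 1<..n + h} \<union> {n, n + 1} = {..n + h}" using assms by auto
  have iff: "f \<in> ends_open n h \<longleftrightarrow> f \<in> involutions_on {..n + h} \<and> (\<forall>x\<in>{n + 1<..n + h}. f x < n) \<and>
    (\<forall>x\<in>{n + 1<..n + h}. \<forall>y\<in>{n + 1<..n + h}. x < y \<longrightarrow> f y < f x) \<and> f n = n + 1 \<and> f (n + 1) = n"
    unfolding ends_open_def by (subst glue_single_iff [OF S]) (auto simp: Transposition.transpose_def)
  show ?thesis
  proof
    assume f: "f \<in> ends_open n h"
    have "f y < f x" if "x \<in> {n<..n + h}" "y \<in> {n<..n + h}" "x < y" for x y
      using f that unfolding iff by (cases "x = n + 1") auto
    moreover have "f x \<le> n" if "x \<in> {n<..n + h}" for x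
      using f that unfolding iff by (cases "x = n + 1") (auto simp: less_imp_le)
    ultimately show "f \<in> nested_end {..n} {n<..n + h} \<and> f n = n + 1"
      unfolding end_iff using f unfolding iff by auto
  next
    assume f: "f \<in> nested_end {..n} {n<..n + h} \<and> f n = n + 1"
    then have "f (f n) = n" unfolding end_iff involutions_on_def by blast
    then have n1: "f (n + 1) = n" using f by simp
    have "f x < n" if "x \<in> {n + 1<..n + h}" for x
    proof -
      have "f x < f (n + 1)" using f that unfolding end_iff by auto
      then show ?thesis using n1 by simp
    qed
    then show "f \<in> ends_open n h" using f n1 unfolding iff end_iff by auto
  qed
qed

lemma ends_nested_iff:
  "f \<in> ends_nested n h \<longleftrightarrow> f \<in> nested_end {..n} {n<..n + h} \<and> f n < n \<and> (h \<ge> 1 \<longrightarrow> f (n + 1) < f n)"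
proof -
  have S: "{..<n} \<union> {n..n + h} = {..n + h}" by auto
  show ?thesis
  proof
    assume "f \<in> ends_nested n h"
    then have f: "f \<in> involutions_on {..n + h}" "\<forall>x\<in>{n..n + h}. f x < n"
      "\<forall>x\<in>{n..n + h}. \<forall>y\<in>{n..n + h}. x < y \<longrightarrow> f y < f x"
      unfolding ends_nested_def nested_end_iff [OF S] by auto
    then show "f \<in> nested_end {..n} {n<..n + h} \<and> f n < n \<and> (h \<ge> 1 \<longrightarrow> f (n + 1) < f n)"
      unfolding end_iff by (auto simp: less_imp_le)
  next
    assume f: "f \<in> nested_end {..n} {n<..n + h} \<and> f n < n \<and> (h \<ge> 1 \<longrightarrow> f (n + 1) < f n)"
    then have f': "f \<in> involutions_on {..n + h}" "\<forall>x\<in>{n<..n + h}. f x \<le> n"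
      "\<forall>x\<in>{n<..n + h}. \<forall>y\<in>{n<..n + h}. x < y \<longrightarrow> f y < f x"
      unfolding end_iff by auto
    have lt: "f z < f n" if "z \<in> {n<..n + h}" for z
      using f f'(3) that by (cases "z = n + 1") (auto intro: less_trans [of _ "f (n + 1)"])
    have "f x < n" if "x \<in> {n..n + h}" for x
      using f lt [of x] that by (cases "x = n") auto
    moreover have "f y < f x" if "x \<in> {n..n + h}" "y \<in> {n..n + h}" "x < y" for x y
      using f'(3) lt [of y] that by (cases "x = n") auto
    ultimately show "f \<in> ends_nested n h"
      unfolding ends_nested_def nested_end_iff [OF S] using f'(1) by auto
  qed
qed

text \<open>All remaining classes are of this form, where \<open>k\<close> arcs cross the arc closed at \<open>n\<close>.\<close>

lemma glue_end_iff:
  assumes S: "{..<b} \<union> Z \<union> B = {..n + h}" and Z: "Z = P \<union> {n + k<..n + h}"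
    and P: "P \<subseteq> {..n}" "n \<in> P" and b: "b \<le> n" and kh: "1 \<le> k" "k \<le> h" and R: "\<R> \<subseteq> involutions_on B"
    and B: "{n<..n + k} \<subseteq> B"
  shows "f \<in> glue b Z B \<R> \<and> (\<forall>x\<in>{n<..n + k}. f n < f x \<and> f x \<le> n \<and> (\<forall>y\<in>{n<..n + k}. x < y \<longrightarrow> f y < f x)) \<longleftrightarrow>
    f \<in> nested_end {..n} {n<..n + h} \<and> restr B f \<in> \<R> \<and> (\<forall>x\<in>P. f x < b \<and> (\<forall>y\<in>P. x < y \<longrightarrow> f y < f x)) \<and>
    (\<forall>x\<in>{n<..n + k}. f n < f x) \<and> (k < h \<longrightarrow> f (n + k + 1) < f n)"
proof
  assume L: "f \<in> glue b Z B \<R> \<and> (\<forall>x\<in>{n<..n + k}. f n < f x \<and> f x \<le> n \<and> (\<forall>y\<in>{n<..n + k}. x < y \<longrightarrow> f y < f x))"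
  then have g: "f \<in> involutions_on {..n + h}" "\<And>x. x \<in> Z \<Longrightarrow> f x < b"
    "\<And>x y. x \<in> Z \<Longrightarrow> y \<in> Z \<Longrightarrow> x < y \<Longrightarrow> f y < f x" "restr B f \<in> \<R>"
    unfolding glue_def S by auto
  have nZ: "n \<in> Z" "f n < b" using P Z g by auto
  have "f x \<le> n" if "x \<in> {n<..n + h}" for x
  proof (cases "x \<le> n + k")
    case False
    then have "x \<in> Z" using that Z by auto
    then show ?thesis using g(2) b by fastforce
  qed (use L that in auto)
  moreover have "f y < f x" if "x \<in> {n<..n + h}" "y \<in> {n<..n + h}" "x < y" for x y
  proof (cases "n + k < y")
    case True
    then have y: "y \<in> Z" using that Z by auto
    show ?thesis
    proof (cases "n + k < x")
      case True then show ?thesis using g(3) y that Z by auto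
    next
      case False
      then have "f n < f x" using L that by auto
      moreover have "f y < f n" using g(3) [OF nZ(1) y] that by auto
      ultimately show ?thesis by simp
    qed
  qed (use L that in auto)
  moreover have "f (n + k + 1) < f n" if "k < h" using g(3) [OF nZ(1), of "n + k + 1"] that Z by auto
  moreover have "\<forall>x\<in>P. f x < b \<and> (\<forall>y\<in>P. x < y \<longrightarrow> f y < f x)" using g Z by auto
  ultimately show "f \<in> nested_end {..n} {n<..n + h} \<and> restr B f \<in> \<R> \<and> (\<forall>x\<in>P. f x < b \<and> (\<forall>y\<in>P. x < y \<longrightarrow> f y < f x)) \<and>
    (\<forall>x\<in>{n<..n + k}. f n < f x) \<and> (k < h \<longrightarrow> f (n + k + 1) < f n)"
    unfolding end_iff using g L by auto
next
  assume Rt: "f \<in> nested_end {..n} {n<..n + h} \<and> restr B f \<in> \<R> \<and> (\<forall>x\<in>P. f x < b \<and> (\<forall>y\<in>P. x < y \<longrightarrow> f y < f x)) \<and>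
    (\<forall>x\<in>{n<..n + k}. f n < f x) \<and> (k < h \<longrightarrow> f (n + k + 1) < f n)"
  then have f: "f \<in> involutions_on {..n + h}" "\<forall>x\<in>{n<..n + h}. f x \<le> n"
    "\<forall>x\<in>{n<..n + h}. \<forall>y\<in>{n<..n + h}. x < y \<longrightarrow> f y < f x"
    unfolding end_iff by auto
  \<comment> \<open>The remaining open arcs close in nested order, so the condition on the first of
    them carries over to all.\<close>
  have lt: "f z < f n" if z: "z \<in> {n + k<..n + h}" for z
  proof -
    have "f (n + k + 1) < f n" using Rt z by auto
    moreover have "f z \<le> f (n + k + 1)" using f(3) z by (cases "z = n + k + 1") (auto simp: less_imp_le)
    ultimately show ?thesis by simp
  qed
  have Pn: "f n \<le> f x" if "x \<in> P" for x
    using that P Rt by (metis atMost_iff le_neq_implies_less less_imp_le order_refl subsetD)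
  have "f x < b" if "x \<in> Z" for x
    using that Rt lt [of x] P(2) unfolding Z by fastforce
  moreover have "f y < f x" if "x \<in> Z" "y \<in> Z" "x < y" for x y
  proof (cases "y \<in> P")
    case True
    then have "x \<in> P" using that P(1) unfolding Z by auto
    then show ?thesis using True Rt that by auto
  next
    case False
    then have y: "y \<in> {n + k<..n + h}" using that Z by auto
    show ?thesis
    proof (cases "x \<in> P")
      case True then show ?thesis using Pn [OF True] lt [OF y] by simp
    next
      case False
      then have "x \<in> {n<..n + h}" "y \<in> {n<..n + h}" using that y Z by auto
      then show ?thesis using f(3) that by blast
    qed
  qed
  ultimately have "f \<in> glue b Z B \<R>"
    unfolding glue_def S using f(1) Rt by auto
  then show "f \<in> glue b Z B \<R> \<and> (\<forall>x\<in>{n<..n + k}. f n < f x \<and> f x \<le> n \<and> (\<forall>y\<in>{n<..n + k}. x < y \<longrightarrow> f y < f x))"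
    using f Rt kh by auto
qed

lemma ends_crossed_iff:
  assumes "b < n" "h \<ge> 1"
  shows "f \<in> ends_crossed n h b \<longleftrightarrow> f \<in> nested_end {..n} {n<..n + h} \<and> f (n + 1) = b \<and> f n < b \<and>
    (1 < h \<longrightarrow> f (n + 2) < f n) \<and> f ` {b<..<n} \<subseteq> {b<..<n}"
proof -
  let ?Z = "insert n {n + 1<..n + h}" let ?B = "{b..<n} \<union> {n + 1}"
  let ?R = "{g \<in> involutions_on ?B. g (n + 1) = b}"
  have iff: "f \<in> glue b ?Z ?B ?R \<and> (\<forall>x\<in>{n<..n + 1}. f n < f x \<and> f x \<le> n \<and> (\<forall>y\<in>{n<..n + 1}. x < y \<longrightarrow> f y < f x)) \<longleftrightarrow>
    f \<in> nested_end {..n} {n<..n + h} \<and> restr ?B f \<in> ?R \<and> (\<forall>x\<in>{n}. f x < b \<and> (\<forall>y\<in>{n}. x < y \<longrightarrow> f y < f x)) \<and>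
    (\<forall>x\<in>{n<..n + 1}. f n < f x) \<and> (1 < h \<longrightarrow> f (n + 1 + 1) < f n)"
    by (rule glue_end_iff) (use assms in auto)
  have one: "{n<..n + 1} = {n + 1}" by auto
  show ?thesis
  proof
    assume f: "f \<in> ends_crossed n h b"
    then have f': "f \<in> glue b ?Z ?B ?R" by (simp add: ends_crossed_def)
    then have fb: "restr ?B f \<in> ?R" "f n < b" by (auto simp: glue_def)
    then have n1: "f (n + 1) = b" by (simp add: restr_def)
    have inv: "f (f x) = x" for x using f' by (simp add: glue_def involutions_on_def)
    have closed: "f ` ?B \<subseteq> ?B" by (rule glue_closed [OF f']) auto
    have "f ` {b<..<n} \<subseteq> {b<..<n}"
    proof
      fix y assume "y \<in> f ` {b<..<n}"
      then obtain x where x: "x \<in> {b<..<n}" "y = f x" by auto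
      then have "x \<in> ?B" by simp
      then have "y \<in> ?B" using closed x(2) by blast
      moreover have "y \<noteq> b" "y \<noteq> n + 1" using x n1 inv [of x] inv [of "n + 1"] by auto
      ultimately show "y \<in> {b<..<n}" by auto
    qed
    then show "f \<in> nested_end {..n} {n<..n + h} \<and> f (n + 1) = b \<and> f n < b \<and>
      (1 < h \<longrightarrow> f (n + 2) < f n) \<and> f ` {b<..<n} \<subseteq> {b<..<n}"
      using iff f' fb n1 assms unfolding one by auto
  next
    assume f: "f \<in> nested_end {..n} {n<..n + h} \<and> f (n + 1) = b \<and> f n < b \<and>
      (1 < h \<longrightarrow> f (n + 2) < f n) \<and> f ` {b<..<n} \<subseteq> {b<..<n}"
    then have f': "f \<in> involutions_on {..n + h}" unfolding end_iff by blast
    then have "f (f (n + 1)) = n + 1" by (simp add: involutions_on_def)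
    then have fb: "f b = n + 1" "f (n + 1) = b" using f by auto
    have "f x \<in> ?B" if "x \<in> ?B" for x
    proof -
      from that assms have "x = b \<or> x = n + 1 \<or> x \<in> {b<..<n}" by auto
      then show ?thesis using f fb assms by fastforce
    qed
    then have "f ` ?B \<subseteq> ?B" by blast
    moreover have "?B \<subseteq> {..n + h}" using assms by auto
    ultimately have "restr ?B f \<in> involutions_on ?B" by (intro involutions_on_restr [OF f'])
    then have "restr ?B f \<in> ?R" using fb by (simp add: restr_def)
    then show "f \<in> ends_crossed n h b"
      using iff f fb unfolding ends_crossed_def one by auto
  qed
qed

text \<open>A block with prescribed values turns the condition on the restriction into pointwise
  equations, and \<open>last\<close> makes these values nested in the way
  \<open>glue_end_iff\<close> asks for.\<close>

lemma glue_end_single_iff: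
  assumes S: "{..<b} \<union> Z \<union> B = {..n + h}" and Z: "Z = P \<union> {n + k<..n + h}"
    and P: "P \<subseteq> {..n}" "n \<in> P" and b: "b \<le> n" and kh: "1 \<le> k" "k \<le> h" and \<beta>: "\<beta> \<in> involutions_on B"
    and B: "{n<..n + k} \<subseteq> B"
    and last: "\<And>x. x \<in> {n<..n + k} \<Longrightarrow> b \<le> \<beta> x \<and> \<beta> x \<le> n"
    "\<And>x y. x \<in> {n<..n + k} \<Longrightarrow> y \<in> {n<..n + k} \<Longrightarrow> x < y \<Longrightarrow> \<beta> y < \<beta> x"
  shows "f \<in> glue b Z B {\<beta>} \<longleftrightarrow> f \<in> nested_end {..n} {n<..n + h} \<and> (\<forall>x\<in>B. f x = \<beta> x) \<and>
    (\<forall>x\<in>P. f x < b \<and> (\<forall>y\<in>P. x < y \<longrightarrow> f y < f x)) \<and> (k < h \<longrightarrow> f (n + k + 1) < f n)"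
proof -
  have "\<beta> x = x" if "x \<notin> B" for x using \<beta> that by (simp add: involutions_on_def)
  then have r: "restr B f = \<beta> \<longleftrightarrow> (\<forall>x\<in>B. f x = \<beta> x)"
    by (auto simp: restr_def fun_eq_iff)
  have "f n < f x \<and> f x \<le> n \<and> (\<forall>y\<in>{n<..n + k}. x < y \<longrightarrow> f y < f x)"
    if "\<forall>x\<in>B. f x = \<beta> x" "f n < b" "x \<in> {n<..n + k}" for x
  proof -
    have "f z = \<beta> z" if "z \<in> {n<..n + k}" for z using \<open>\<forall>x\<in>B. f x = \<beta> x\<close> B that by blast
    then show ?thesis using that last(1) [of x] last(2) [of x] by auto
  qed
  moreover have "f n < b \<and> (\<forall>x\<in>B. f x = \<beta> x)" if "f \<in> glue b Z B {\<beta>}"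
    using that P(2) r Z by (auto simp: glue_def)
  ultimately show ?thesis
    using glue_end_iff [OF S Z P b kh _ B, of "{\<beta>}" f] \<beta> P(2) r by auto
qed

lemma ends_crossed_right_iff:
  assumes "b + 1 < n" "h \<ge> 2"
  shows "f \<in> ends_crossed_right n h b \<longleftrightarrow> f \<in> nested_end {..n} {n<..n + h} \<and>
    (\<forall>x\<in>{b..<n} \<union> {n + 1, n + 2}. f x = right_block n b x) \<and> f n < b \<and> (2 < h \<longrightarrow> f (n + 3) < f n)"
proof -
  have two: "{n<..n + 2} = {n + 1, n + 2}" by auto
  show ?thesis
    unfolding ends_crossed_right_def
    by (subst glue_end_single_iff [where P = "{n}" and k = 2, OF _ _ _ _ _ _ _ right_block])
      (use assms in \<open>auto simp: two right_block_def numeral_3_eq_3\<close>)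
qed

lemma ends_crossed_left_iff:
  assumes "b < m" "h \<ge> 1"
  shows "f \<in> ends_crossed_left m h b \<longleftrightarrow> f \<in> nested_end {..m + 1} {m + 1<..m + 1 + h} \<and>
    (\<forall>x\<in>{b..<m} \<union> {m + 2}. f x = left_block m b x) \<and> f (m + 1) < f m \<and> f m < b \<and>
    (1 < h \<longrightarrow> f (m + 3) < f (m + 1))"
proof -
  have one: "{m + 1<..m + 1 + 1} = {m + 2}" by auto
  show ?thesis
    unfolding ends_crossed_left_def
    by (subst glue_end_single_iff [where P = "{m, m + 1}" and k = 1 and n = "m + 1", OF _ _ _ _ _ _ _ left_block];
        use assms in \<open>(auto simp: numeral_3_eq_3; fail) | (auto simp: one left_block_def; fail)\<close>)
qed

lemma ends_crossed_right_fixed_iff: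
  assumes "h \<ge> 2"
  shows "f \<in> ends_crossed_right_fixed m h \<longleftrightarrow> f \<in> nested_end {..m + 3} {m + 3<..m + 3 + h} \<and>
    (\<forall>x\<in>{m, m + 1, m + 2, m + 4, m + 5}. f x = right_fixed_block m x) \<and> f (m + 3) < m \<and>
    (2 < h \<longrightarrow> f (m + 6) < f (m + 3))"
proof -
  have two: "{m + 3<..m + 3 + 2} = {m + 4, m + 5}" by auto
  have S: "{..<m} \<union> insert (m + 3) {m + 5<..m + 3 + h} \<union> {m, m + 1, m + 2, m + 4, m + 5} = {..m + 3 + h}"
  proof (rule set_eqI)
    show "x \<in> {..<m} \<union> insert (m + 3) {m + 5<..m + 3 + h} \<union> {m, m + 1, m + 2, m + 4, m + 5} \<longleftrightarrow> x \<in> {..m + 3 + h}" for x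
      unfolding Un_iff insert_iff empty_iff atMost_iff lessThan_iff greaterThanAtMost_iff
      using assms by presburger
  qed
  show ?thesis
    unfolding ends_crossed_right_fixed_def
    by (subst glue_end_single_iff [where P = "{m + 3}" and k = 2, OF S _ _ _ _ _ _ right_fixed_block])
      (use assms in \<open>auto simp: two right_fixed_block_def add.commute\<close>)
qed

lemma ends_crossed_left_fixed_iff:
  assumes "h \<ge> 1"
  shows "f \<in> ends_crossed_left_fixed m h \<longleftrightarrow> f \<in> nested_end {..m + 3} {m + 3<..m + 3 + h} \<and>
    f m = m + 4 \<and> f (m + 2) = m + 2 \<and> f (m + 4) = m \<and> f (m + 3) < f (m + 1) \<and> f (m + 1) < m \<and>
    (1 < h \<longrightarrow> f (m + 5) < f (m + 3))"
proof -
  have one: "{m + 3<..m + 3 + 1} = {m + 4}" by auto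
  have S: "{..<m} \<union> insert (m + 1) (insert (m + 3) {m + 4<..m + 3 + h}) \<union> {m, m + 2, m + 4} = {..m + 3 + h}"
  proof (rule set_eqI)
    show "x \<in> {..<m} \<union> insert (m + 1) (insert (m + 3) {m + 4<..m + 3 + h}) \<union> {m, m + 2, m + 4} \<longleftrightarrow> x \<in> {..m + 3 + h}" for x
      unfolding Un_iff insert_iff empty_iff atMost_iff lessThan_iff greaterThanAtMost_iff
      using assms by presburger
  qed
  show ?thesis
    unfolding ends_crossed_left_fixed_def
    by (subst glue_end_single_iff [where P = "{m + 1, m + 3}" and k = 1, OF S _ _ _ _ _ _ left_fixed_block])
      (use assms in \<open>auto simp: one Transposition.transpose_def add.commute\<close>)
qed

section \<open>Few occurrences allow only the listed crossings\<close>

lemma nested_end_inv: "f \<in> nested_end {..n} {n<..n + h} \<Longrightarrow> f (f x) = x"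
  by (simp add: end_iff involutions_on_def)

text \<open>A decreasing map of an interval into itself drops by at least 1 at each point; starting
  below \<open>m\<close> and staying above \<open>b\<close>, it has no room to drop by more.\<close>

lemma antitone_interval:
  fixes f :: "nat \<Rightarrow> nat"
  assumes "f ` {b<..<m} \<subseteq> {b<..<m}"
    and anti: "\<And>x y. b < x \<Longrightarrow> x < y \<Longrightarrow> y < m \<Longrightarrow> f y < f x"
    and x: "b < x" "x < m"
  shows "f x = m + b - x"
proof -
  have bd: "b < f x" "f x < m" if "b < x" "x < m" for x
    using assms(1) that by (auto simp: image_subset_iff)
  have upper: "b < x \<Longrightarrow> x < m \<Longrightarrow> f x + x \<le> m + b" for x
  proof (induction x)
    case (Suc x)
    then show ?case
      using bd [of "Suc x"] anti [of x "Suc x"] by (cases "b < x") (auto simp: less_Suc_eq)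
  qed simp
  have lower: "x < m \<Longrightarrow> b < x \<Longrightarrow> m + b \<le> f x + x" for x
  proof (induction "m - x" arbitrary: x)
    case (Suc k)
    have "k = m - Suc x" using Suc(2) by simp
    then show ?case
      using Suc(3,4) bd [of x] anti [of x "Suc x"] Suc(1) [of "Suc x"] by (cases "Suc x < m") auto
  qed simp
  show ?thesis using upper lower x by (metis add_diff_cancel_right' antisym)
qed

lemma occ_ge_8I:
  assumes "finite S" "set xs \<subseteq> S" "sorted_wrt (<) xs" "sorted_wrt (<) ys"
    "map f xs = map ((!) ys) p" "\<forall>i\<in>set p. i < length ys" "8 \<le> occ_list p"
  shows "8 \<le> occ S f"
  using occ_ge_pattern [OF assms(1-6)] assms(7) by linarith

text \<open>The first three are three nested arcs across one arc, three pairwise crossing arcs, and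
  one arc across three nested arcs. Patterns 4 to 8 serve when one open arc crosses two nested
  closed arcs, patterns 9 to 15 when two open arcs cross the arc closed at \<open>n\<close>.\<close>

lemma bad_patterns:
  "8 \<le> occ_list [4,7,6,5,0,3,2,1]" "8 \<le> occ_list [3,4,5,0,1,2]" "8 \<le> occ_list [6,5,4,7,2,1,0,3]"
  "8 \<le> occ_list [6,4,7,5,1,3,0,2]" "8 \<le> occ_list [6,5,7,3,4,1,0,2]" "8 \<le> occ_list [6,4,7,3,1,5,0,2]"
  "8 \<le> occ_list [6,3,7,1,4,5,0,2]" "8 \<le> occ_list [6,3,7,1,5,4,0,2]" "8 \<le> occ_list [5,3,7,1,6,0,4,2]"
  "8 \<le> occ_list [5,4,7,6,1,0,3,2]" "8 \<le> occ_list [5,7,4,6,2,0,3,1]" "8 \<le> occ_list [5,7,6,3,4,0,2,1]"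
  "8 \<le> occ_list [5,7,2,6,4,0,3,1]" "8 \<le> occ_list [5,7,2,3,6,0,4,1]" "8 \<le> occ_list [5,7,3,2,6,0,4,1]"
  by code_simp+

text \<open>The open arcs that cross the arc closed at \<open>n\<close> are the first to be closed
  after \<open>n\<close>, and three of them form a bad pattern. If there is one, at most one further
  arc leaves the interval under it. If there are two, no further arc leaves. In the situations other
  than \<open>ends_crossed\<close>, the points enclosed lie in two gaps, and the bad patterns leave
  either reversed points in one gap or a single fixed point in the other.\<close>

lemma crossed_end_cases:
  assumes f: "f \<in> nested_end {..n} {n<..n + h}" and h: "h \<ge> 1" and fn: "f n < n" "f n < f (n + 1)"
    and occ: "occ {..n + h} f < 8"
  shows "(\<exists>b<n. f \<in> ends_crossed n h b) \<or>
    h \<ge> 2 \<and> ((\<exists>b. b + 1 < n \<and> f \<in> ends_crossed_right n h b) \<or>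
      (\<exists>m. n = m + 3 \<and> f \<in> ends_crossed_right_fixed m h)) \<or>
    (\<exists>m. n = m + 1 \<and> (\<exists>b<m. f \<in> ends_crossed_left m h b)) \<or>
    (\<exists>m. n = m + 3 \<and> f \<in> ends_crossed_left_fixed m h)"
proof -
  have inv: "f (f x) = x" for x by (rule nested_end_inv [OF f])
  have inj: "f x = f y \<longleftrightarrow> x = y" for x y using inv by metis
  have closed: "f x \<le> n + h" if "x \<le> n + h" for x
    using f that unfolding end_iff involutions_on_def by auto
  have end_le: "f x \<le> n" if "n < x" "x \<le> n + h" for x
    using f that unfolding end_iff by auto
  have anti: "f y < f x" if "n < x" "x < y" "y \<le> n + h" for x y
    using f that unfolding end_iff by auto
  have bad: False if "set xs \<subseteq> {..n + h}" "sorted_wrt (<) xs" "sorted_wrt (<) ys"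
    "map f xs = map ((!) ys) p" "\<forall>i\<in>set p. i < length ys" "8 \<le> occ_list p" for xs ys p
    using occ_ge_8I [OF finite_atMost that] occ by simp
  define a where "a = f n"
  have a: "f n = a" "f a = n" "a < n" using fn inv by (simp_all add: a_def)
  show ?thesis
  proof (cases "h \<ge> 2 \<and> a < f (n + 2)")
    case False
    define b where "b = f (n + 1)"
    have "b \<noteq> n" using a inv [of "n + 1"] by (auto simp: b_def)
    then have b: "f (n + 1) = b" "f b = n + 1" "a < b" "b < n"
      using fn end_le [of "n + 1"] h inv by (auto simp: b_def a_def)
    have f2: "f (n + 2) < f n" if "1 < h"
      using False that inj [of "n + 2" n] a by auto
    \<comment> \<open>An arc leaving the interval is not open, since nested closing would force its
      left end to lie at or before \<open>b\<close>. If it started before \<open>a\<close>, it would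
      form three pairwise crossing arcs with those at \<open>a\<close> and \<open>b\<close>.\<close>
    have out: "a < f x \<and> f x < b" if x: "b < x" "x < n" "f x \<notin> {b<..<n}" for x
    proof -
      have "f x \<le> n"
      proof (rule ccontr)
        assume "\<not> f x \<le> n"
        then have "f (f x) \<le> f (n + 1)" using anti [of "n + 1" "f x"] closed [of x] x
          by (cases "f x = n + 1") auto
        then show False using inv [of x] b x by simp
      qed
      moreover have "f x \<noteq> n" "f x \<noteq> b" "f x \<noteq> a" using inv [of x] a b x by auto
      moreover have "\<not> f x < a"
      proof
        assume "f x < a"
        then show False
          by (intro bad [OF _ _ _ _ _ bad_patterns(2), of "[f x, a, b, x, n, n + 1]" "[f x, a, b, x, n, n + 1]"])
            (use x a b h inv [of x] in auto)
      qed
      ultimately show ?thesis using x by auto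
    qed
    show ?thesis
    proof (cases "f ` {b<..<n} \<subseteq> {b<..<n}")
      case True
      then have "f \<in> ends_crossed n h b"
        using f h a b f2 by (subst ends_crossed_iff) auto
      then show ?thesis using b by blast
    next
      case False
      then obtain p where p: "b < p" "p < n" "f p \<notin> {b<..<n}"
        unfolding image_subset_iff by (metis greaterThanLessThan_iff)
      define e where "e = f p"
      have e: "f p = e" "f e = p" "a < e" "e < b" using out [OF p] inv by (simp_all add: e_def)
      \<comment> \<open>Two leaving arcs cross, and give three pairwise crossing arcs with the one
        at \<open>b\<close>, or are nested, and then the arc at \<open>b\<close> crosses three
        nested arcs.\<close>
      have two_out: False if "b < x" "x < y" "y < n" "f x \<notin> {b<..<n}" "f y \<notin> {b<..<n}" for x y
      proof -
        have xy: "a < f x" "f x < b" "a < f y" "f y < b" using out [of x] out [of y] that by auto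
        consider "f x < f y" | "f y < f x" using inj [of x y] \<open>x < y\<close>
          by (metis less_irrefl linorder_neqE_nat)
        then show False
        proof cases
          case 1
          then show False
            by (intro bad [OF _ _ _ _ _ bad_patterns(2), of "[f x, f y, b, x, y, n + 1]" "[f x, f y, b, x, y, n + 1]"])
              (use xy that a b h inv [of x] inv [of y] in auto)
        next
          case 2
          then show False
            by (intro bad [OF _ _ _ _ _ bad_patterns(3),
                  of "[a, f y, f x, b, x, y, n, n + 1]" "[a, f y, f x, b, x, y, n, n + 1]"])
              (use xy that a b h inv [of x] inv [of y] in auto)
        qed
      qed
      have rest: "f y \<in> {b<..<n} - {p}" if "b < y" "y < n" "y \<noteq> p" for y
      proof -
        have "f y \<in> {b<..<n}"
          using two_out [of y p] two_out [of p y] that p by (metis linorder_neqE_nat)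
        moreover have "f y \<noteq> p" using e that(1) inv [of y] by auto
        ultimately show ?thesis by simp
      qed
      have no_cross: False if "b < y" "y < p" "p < f y" "f y < n" for y
        by (rule bad [OF _ _ _ _ _ bad_patterns(4),
              of "[a, e, b, y, p, f y, n, n + 1]" "[a, e, b, y, p, f y, n, n + 1]"])
          (use that a b e h inv [of y] in auto)
      have left: "f y \<in> {b<..<p}" if "b < y" "y < p" for y
        using rest [of y] no_cross [of y] that p by (auto simp: linorder_neq_iff)
      have right: "f y \<in> {p<..<n}" if "p < y" "y < n" for y
        using rest [of y] no_cross [of "f y"] inv [of y] that p by (auto simp: linorder_neq_iff)
      have desc: "f v < f u" if "b < u" "u < v" "v < p" for u v
      proof (rule ccontr)
        assume "\<not> f v < f u"
        then have "f u < f v" using inj [of u v] that by (metis less_irrefl linorder_neqE_nat)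
        then show False
          by (intro bad [OF _ _ _ _ _ bad_patterns(5),
                of "[a, e, b, u, v, p, n, n + 1]" "[a, e, b, f u, f v, p, n, n + 1]"])
            (use that a b e h left [of u] left [of v] p in auto)
      qed
      have mixed: False if "b < x" "x < p" "p < y" "y < n" for x y
        by (rule bad [OF _ _ _ _ _ bad_patterns(6),
              of "[a, e, b, x, p, y, n, n + 1]" "[a, e, b, f x, p, f y, n, n + 1]"])
          (use that a b e h left [of x] right [of y] in auto)
      have two_right: False if "p < x" "x < y" "y < n" for x y
      proof -
        consider "f x < f y" | "f y < f x" using inj [of x y] \<open>x < y\<close>
          by (metis less_irrefl linorder_neqE_nat)
        then show False
        proof cases
          case 1
          then show False
            by (intro bad [OF _ _ _ _ _ bad_patterns(7),
                  of "[a, e, b, p, x, y, n, n + 1]" "[a, e, b, p, f x, f y, n, n + 1]"])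
              (use that a b e h right [of x] right [of y] p in auto)
        next
          case 2
          then show False
            by (intro bad [OF _ _ _ _ _ bad_patterns(8),
                  of "[a, e, b, p, x, y, n, n + 1]" "[a, e, b, p, f y, f x, n, n + 1]"])
              (use that a b e h right [of x] right [of y] p in auto)
        qed
      qed
      show ?thesis
      \<comment> \<open>If the gap after \<open>p\<close> is empty, the points before
        \<open>p\<close> are reversed. Otherwise \<open>two_right\<close> leaves a single point
        there and \<open>mixed\<close> empties the gap before \<open>p\<close>.\<close>
      proof (cases "n = p + 1")
        case True
        have mid: "f x = p + b - x" if "b < x" "x < p" for x
          using antitone_interval [of f b p x] left desc that by (auto simp: image_subset_iff)
        have "f x = left_block p b x" if "x \<in> {b..<p} \<union> {p + 2}" for x
        proof -
          from that consider "x = b" | "x = p + 2" | "b < x" "x < p" by fastforce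
          then show ?thesis using mid [of x] b p unfolding True by cases (auto simp: left_block_def)
        qed
        then have "f \<in> ends_crossed_left p h b"
          using f h a b e f2 p unfolding True
          by (subst ends_crossed_left_iff) (auto simp: numeral_3_eq_3)
        then show ?thesis using True p by blast
      next
        case False
        then have "n = p + 2" using two_right [of "p + 1" "p + 2"] p by force
        moreover have "p = b + 1" using mixed [of "b + 1" "p + 1"] p False by force
        ultimately have n: "n = b + 3" "p = b + 1" by auto
        have "f (b + 2) = b + 2" using right [of "b + 2"] n by auto
        then have "f \<in> ends_crossed_left_fixed b h"
          using f h a b e f2 p unfolding n
          by (subst ends_crossed_left_fixed_iff) (auto simp: add.commute)
        then show ?thesis using n by blast
      qed
    qed
  next
    case True
    define b where "b = f (n + 2)"
    define c where "c = f (n + 1)"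
    have "c \<noteq> n" using a inv [of "n + 1"] by (auto simp: c_def)
    then have b: "f (n + 1) = c" "f c = n + 1" "f (n + 2) = b" "f b = n + 2" "a < b" "b < c" "c < n"
      using True anti [of "n + 1" "n + 2"] end_le [of "n + 1"] h inv by (auto simp: b_def c_def a_def)
    \<comment> \<open>Otherwise a third open arc would cross the arc closed at
      \<open>n\<close>.\<close>
    have f3: "f (n + 3) < f n" if "2 < h"
    proof (rule ccontr)
      assume "\<not> f (n + 3) < f n"
      then have "a < f (n + 3)" using inj [of "n + 3" n] a by (simp add: not_less le_less)
      moreover have "f (n + 3) < b" using anti [of "n + 2" "n + 3"] that b by simp
      ultimately show False
        by (intro bad [OF _ _ _ _ _ bad_patterns(1),
              of "[a, f (n + 3), b, c, n, n + 1, n + 2, n + 3]" "[a, f (n + 3), b, c, n, n + 1, n + 2, n + 3]"])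
          (use that a b inv [of "n + 3"] in auto)
    qed
    \<comment> \<open>Unlike in the case of one open arc, a closed arc from between \<open>a\<close>
      and \<open>b\<close> is excluded as well: it would cross the arc at \<open>b\<close>, and
      either outcome for the arc at \<open>c\<close> is a bad pattern.\<close>
    have rest: "f x \<in> {b<..<n} - {c}" if x: "b < x" "x < n" "x \<noteq> c" for x
    proof -
      have "f x \<le> n"
      proof (rule ccontr)
        assume "\<not> f x \<le> n"
        then have "f x = n + 1 \<or> f (f x) \<le> f (n + 2)" using anti [of "n + 2" "f x"] closed [of x] x
          by (cases "f x = n + 1"; cases "f x = n + 2") auto
        then show False using inv [of x] b x by auto
      qed
      moreover have "f x \<noteq> n" "f x \<noteq> b" "f x \<noteq> a" "f x \<noteq> c" using inv [of x] a b x by auto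
      moreover have "\<not> f x < a"
      proof
        assume "f x < a"
        then show False
          by (intro bad [OF _ _ _ _ _ bad_patterns(2), of "[f x, a, b, x, n, n + 2]" "[f x, a, b, x, n, n + 2]"])
            (use x a b True inv [of x] in auto)
      qed
      moreover have "\<not> (a < f x \<and> f x < b)"
      proof
        assume fx: "a < f x \<and> f x < b"
        consider "x < c" | "c < x" using x by linarith
        then show False
        proof cases
          case 1
          then show False
            by (intro bad [OF _ _ _ _ _ bad_patterns(9),
                  of "[a, f x, b, x, c, n, n + 1, n + 2]" "[a, f x, b, x, c, n, n + 1, n + 2]"])
              (use fx x a b True inv [of x] in auto)
        next
          case 2
          then show False
            by (intro bad [OF _ _ _ _ _ bad_patterns(10),
                  of "[a, f x, b, c, x, n, n + 1, n + 2]" "[a, f x, b, c, x, n, n + 1, n + 2]"])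
              (use fx x a b True inv [of x] in auto)
        qed
      qed
      ultimately show ?thesis using x by auto
    qed
    have no_cross: False if "b < y" "y < c" "c < f y" "f y < n" for y
      by (rule bad [OF _ _ _ _ _ bad_patterns(11),
            of "[a, b, y, c, f y, n, n + 1, n + 2]" "[a, b, y, c, f y, n, n + 1, n + 2]"])
        (use that a b True inv [of y] in auto)
    have left: "f y \<in> {b<..<c}" if "b < y" "y < c" for y
      using rest [of y] no_cross [of y] that b by (auto simp: linorder_neq_iff)
    have right: "f y \<in> {c<..<n}" if "c < y" "y < n" for y
      using rest [of y] no_cross [of "f y"] inv [of y] that b by (auto simp: linorder_neq_iff)
    have desc: "f v < f u" if "c < u" "u < v" "v < n" for u v
    proof (rule ccontr)
      assume "\<not> f v < f u"
      then have "f u < f v" using inj [of u v] that by (metis less_irrefl linorder_neqE_nat)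
      then show False
        by (intro bad [OF _ _ _ _ _ bad_patterns(12),
              of "[a, b, c, u, v, n, n + 1, n + 2]" "[a, b, c, f u, f v, n, n + 1, n + 2]"])
          (use that a b True right [of u] right [of v] in auto)
    qed
    have mixed: False if "b < x" "x < c" "c < y" "y < n" for x y
      by (rule bad [OF _ _ _ _ _ bad_patterns(13),
            of "[a, b, x, c, y, n, n + 1, n + 2]" "[a, b, f x, c, f y, n, n + 1, n + 2]"])
        (use that a b True left [of x] right [of y] in auto)
    have two_left: False if "b < x" "x < y" "y < c" for x y
    proof -
      consider "f x < f y" | "f y < f x" using inj [of x y] \<open>x < y\<close>
          by (metis less_irrefl linorder_neqE_nat)
      then show False
      proof cases
        case 1
        then show False
          by (intro bad [OF _ _ _ _ _ bad_patterns(14),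
                of "[a, b, x, y, c, n, n + 1, n + 2]" "[a, b, f x, f y, c, n, n + 1, n + 2]"])
            (use that a b True left [of x] left [of y] in auto)
      next
        case 2
        then show False
          by (intro bad [OF _ _ _ _ _ bad_patterns(15),
                of "[a, b, x, y, c, n, n + 1, n + 2]" "[a, b, f y, f x, c, n, n + 1, n + 2]"])
            (use that a b True left [of x] left [of y] in auto)
      qed
    qed
    show ?thesis
    \<comment> \<open>Now the gap that may hold reversed points is the one after \<open>c\<close>,
      and the gap between \<open>b\<close> and \<open>c\<close> is the one that may hold a fixed
      point.\<close>
    proof (cases "c = b + 1")
      case c: True
      have mid: "f x = n + (b + 1) - x" if "b + 1 < x" "x < n" for x
        using antitone_interval [of f "b + 1" n x] right desc that c by (auto simp: image_subset_iff)
      have "f x = right_block n b x" if x: "x \<in> {b..<n} \<union> {n + 1, n + 2}" for x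
      proof -
        have "b \<le> x \<Longrightarrow> x = b \<or> x = b + 1 \<or> b + 1 < x" by linarith
        then consider "x = b" | "x = b + 1" | "x = n + 1" | "x = n + 2" | "b + 1 < x" "x < n"
          using x by auto
        then show ?thesis using mid [of x] b c by cases (auto simp: right_block_def)
      qed
      then have "f \<in> ends_crossed_right n h b"
        using f True a b c f3 by (subst ends_crossed_right_iff) auto
      moreover have "b + 1 < n" using b c by simp
      ultimately show ?thesis using True by blast
    next
      case False
      then have "c = b + 2" using two_left [of "b + 1" "b + 2"] b by force
      moreover have "n = c + 1" using mixed [of "b + 1" "c + 1"] b False by force
      ultimately have n: "n = b + 3" "c = b + 2" by auto
      have "f (b + 1) = b + 1" using left [of "b + 1"] n by auto
      then have "f \<in> ends_crossed_right_fixed b h"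
        using f True a b f3 unfolding n
        by (subst ends_crossed_right_fixed_iff) (auto simp: right_fixed_block_def add.commute)
      then show ?thesis using n True by blast
    qed
  qed
qed

section \<open>The recursion for partial involutions\<close>

lemma finite_glue [simp]: "finite Z \<Longrightarrow> finite B \<Longrightarrow> finite (glue b Z B \<R>)"
  by (rule finite_subset [of _ "involutions_on ({..<b} \<union> Z \<union> B)"]) (auto simp: glue_def)

text \<open>The subtractions undo the shifts \<open>n = m + 1\<close> and \<open>n = m + 3\<close>;
  the guard keeps truncated subtraction from producing a spurious class.\<close>

definition last_left :: "nat \<Rightarrow> nat \<Rightarrow> (nat \<Rightarrow> nat) set" where
  "last_left n h = (\<Union>b<n - 1. ends_crossed_left (n - 1) h b) \<union>
     (if n \<ge> 3 then ends_crossed_left_fixed (n - 3) h else {})"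

definition last_right :: "nat \<Rightarrow> nat \<Rightarrow> (nat \<Rightarrow> nat) set" where
  "last_right n h = (\<Union>b<n - 1. ends_crossed_right n h b) \<union>
     (if n \<ge> 3 then ends_crossed_right_fixed (n - 3) h else {})"

lemma nested_end_cases:
  assumes f: "f \<in> nested_end {..n} {n<..n + h}" and occ: "occ {..n + h} f < 8"
  shows "f \<in> ends_fixed n h \<union> ends_nested n h \<union> (if h \<ge> 1 then ends_open n h else {}) \<union>
    (if h \<ge> 1 then \<Union>b<n. ends_crossed n h b else {}) \<union> (if h \<ge> 1 then last_left n h else {}) \<union>
    (if h \<ge> 2 then last_right n h else {})"
proof -
  have inv: "f (f x) = x" for x by (rule nested_end_inv [OF f])
  consider "f n = n" | "n < f n" | "f n < n" "h \<ge> 1 \<longrightarrow> f (n + 1) < f n"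
    | "f n < n" "h \<ge> 1" "f n < f (n + 1)"
  proof -
    have "f (n + 1) \<noteq> f n" using inv [of n] inv [of "n + 1"] by auto
    then show ?thesis using that by (meson linorder_neqE_nat)
  qed
  then show ?thesis
  proof cases
    case 1
    then show ?thesis using f by (simp add: ends_fixed_iff)
  next
    case 2
    have mem: "f n \<in> {n<..n + h}" 
      using 2 f unfolding end_iff involutions_on_def by auto
    \<comment> \<open>Otherwise \<open>n + 1\<close> closes an arc from before \<open>n\<close>,
      although it precedes the point that closes the arc of \<open>n\<close>; this violates the
      nested order.\<close>
    have "f n = n + 1"
    proof (rule ccontr)
      assume "f n \<noteq> n + 1"
      then have "n + 1 < f n" "n + 1 \<in> {n<..n + h}" using 2 mem by auto
      then have "f (f n) < f (n + 1)" "f (n + 1) \<le> n"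
        using f mem unfolding end_iff by (blast, auto)
      then show False using inv [of n] by simp
    qed
    moreover have "h \<ge> 1" using mem by auto
    ultimately show ?thesis using f by (simp add: ends_open_iff)
  next
    case 3
    then show ?thesis using f by (simp add: ends_nested_iff)
  next
    case 4
    from crossed_end_cases [OF f 4(2,1,3) occ] consider
      b where "b < n" "f \<in> ends_crossed n h b"
      | b where "h \<ge> 2" "b + 1 < n" "f \<in> ends_crossed_right n h b"
      | m where "h \<ge> 2" "n = m + 3" "f \<in> ends_crossed_right_fixed m h"
      | m b where "n = m + 1" "b < m" "f \<in> ends_crossed_left m h b"
      | m where "n = m + 3" "f \<in> ends_crossed_left_fixed m h" by blast
    then show ?thesis
    proof cases
      case (2 b)
      then have "b < n - 1" by simp
      then show ?thesis using 2 by (auto simp: last_right_def)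
    qed (use 4 in \<open>auto simp: last_left_def last_right_def\<close>)
  qed
qed

lemma last_left_iff:
  assumes "h \<ge> 1"
  shows "f \<in> last_left n h \<longleftrightarrow> (\<exists>m. n = m + 1 \<and> (\<exists>b<m. f \<in> ends_crossed_left m h b)) \<or>
    (\<exists>m. n = m + 3 \<and> f \<in> ends_crossed_left_fixed m h)"
proof -
  have "(\<exists>m. n = m + 3 \<and> f \<in> ends_crossed_left_fixed m h) \<longleftrightarrow>
      n \<ge> 3 \<and> f \<in> ends_crossed_left_fixed (n - 3) h"
    by (auto intro: exI [of _ "n - 3"])
  moreover have "(\<exists>m. n = m + 1 \<and> (\<exists>b<m. f \<in> ends_crossed_left m h b)) \<longleftrightarrow>
      (\<exists>b<n - 1. f \<in> ends_crossed_left (n - 1) h b)"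
    by (cases n) auto
  ultimately show ?thesis by (auto simp: last_left_def)
qed

lemma last_right_iff:
  "f \<in> last_right n h \<longleftrightarrow> (\<exists>b. b + 1 < n \<and> f \<in> ends_crossed_right n h b) \<or>
    (\<exists>m. n = m + 3 \<and> f \<in> ends_crossed_right_fixed m h)"
proof -
  have "(\<exists>m. n = m + 3 \<and> f \<in> ends_crossed_right_fixed m h) \<longleftrightarrow>
      n \<ge> 3 \<and> f \<in> ends_crossed_right_fixed (n - 3) h"
    by (auto intro: exI [of _ "n - 3"])
  moreover have "b < n - 1 \<longleftrightarrow> b + 1 < n" for b by auto
  ultimately show ?thesis by (auto simp: last_right_def)
qed

text \<open>The condition on \<open>f (n + 2)\<close> separates this class from
  \<open>last_right\<close>, and the failure of closedness separates it from
  \<open>ends_crossed\<close>.\<close>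

lemma last_leftD:
  assumes "f \<in> last_left n h" "h \<ge> 1"
  shows "f \<in> nested_end {..n} {n<..n + h}" "f n < n" "f n < f (n + 1)" "1 < h \<longrightarrow> f (n + 2) < f n"
    "\<not> f ` {f (n + 1)<..<n} \<subseteq> {f (n + 1)<..<n}"
proof -
  from assms consider m b where "n = m + 1" "b < m" "f \<in> ends_crossed_left m h b"
    | m where "n = m + 3" "f \<in> ends_crossed_left_fixed m h" unfolding last_left_iff [OF assms(2)] by blast
  then have "f \<in> nested_end {..n} {n<..n + h} \<and> f n < n \<and> f n < f (n + 1) \<and> (1 < h \<longrightarrow> f (n + 2) < f n) \<and>
    \<not> f ` {f (n + 1)<..<n} \<subseteq> {f (n + 1)<..<n}"
  proof cases
    case 1
    have c: "f \<in> nested_end {..n} {n<..n + h}" "f (n + 1) = b" "f n < f m" "f m < b" "1 < h \<longrightarrow> f (n + 2) < f n"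
      using 1(2,3) unfolding ends_crossed_left_iff [OF 1(2) assms(2)] 1(1)
      by (auto simp: left_block_def numeral_3_eq_3)
    have "m \<in> {f (n + 1)<..<n}" "f m \<notin> {f (n + 1)<..<n}" using c 1 by auto
    then have "\<not> f ` {f (n + 1)<..<n} \<subseteq> {f (n + 1)<..<n}" by blast
    moreover have "f n < n" "f n < f (n + 1)" using c 1(1,2) by auto
    ultimately show ?thesis using c by blast
  next
    case 2
    have c: "f \<in> nested_end {..n} {n<..n + h}" "f (n + 1) = m" "f n < f (m + 1)" "f (m + 1) < m" "1 < h \<longrightarrow> f (n + 2) < f n"
      using 2(2) unfolding ends_crossed_left_fixed_iff [OF assms(2)] 2(1) by (auto simp: add.commute)
    have "m + 1 \<in> {f (n + 1)<..<n}" "f (m + 1) \<notin> {f (n + 1)<..<n}" using c 2 by auto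
    then have "\<not> f ` {f (n + 1)<..<n} \<subseteq> {f (n + 1)<..<n}" by blast
    moreover have "f n < n" "f n < f (n + 1)" using c 2(1) by auto
    ultimately show ?thesis using c by blast
  qed
  then show "f \<in> nested_end {..n} {n<..n + h}" "f n < n" "f n < f (n + 1)" "1 < h \<longrightarrow> f (n + 2) < f n"
    "\<not> f ` {f (n + 1)<..<n} \<subseteq> {f (n + 1)<..<n}" by blast+
qed

lemma last_rightD:
  assumes "f \<in> last_right n h" "h \<ge> 2"
  shows "f \<in> nested_end {..n} {n<..n + h}" "f n < n" "f n < f (n + 1)" "f n < f (n + 2)"
proof -
  from assms consider b where "b + 1 < n" "f \<in> ends_crossed_right n h b"
    | m where "n = m + 3" "f \<in> ends_crossed_right_fixed m h" unfolding last_right_iff by blast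
  then have "f \<in> nested_end {..n} {n<..n + h} \<and> f n < n \<and> f n < f (n + 1) \<and> f n < f (n + 2)"
  proof cases
    case 1
    then show ?thesis unfolding ends_crossed_right_iff [OF 1(1) assms(2)] by (auto simp: right_block_def)
  next
    case 2
    then show ?thesis unfolding ends_crossed_right_fixed_iff [OF assms(2)] 2(1)
      by (auto simp: right_fixed_block_def add.commute)
  qed
  then show "f \<in> nested_end {..n} {n<..n + h}" "f n < n" "f n < f (n + 1)" "f n < f (n + 2)" by blast+
qed

lemma finite_classes [simp]:
  "finite (ends_fixed n h)" "finite (ends_open n h)" "finite (ends_nested n h)" "finite (ends_crossed n h b)"
  "finite (ends_crossed_left n h b)" "finite (ends_crossed_right n h b)"
  "finite (ends_crossed_left_fixed n h)" "finite (ends_crossed_right_fixed n h)"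
  "finite (last_left n h)" "finite (last_right n h)"
  by (simp_all add: ends_fixed_def ends_open_def ends_nested_def ends_crossed_def ends_crossed_left_def
      ends_crossed_right_def ends_crossed_left_fixed_def ends_crossed_right_fixed_def
      last_left_def last_right_def)

lemma sum_last_left:
  assumes h: "h \<ge> 1"
  shows "sum (weight 0 {..n + h}) (last_left n h) =
    (\<Sum>b<n - 1. W b (h + 1)) * fps_X ^ 4 + (if n \<ge> 3 then W (n - 3) (h + 1) * fps_X ^ 6 else 0)"
proof -
  let ?w = "weight 0 {..n + h}"
  have A: "sum ?w (\<Union>b<n - 1. ends_crossed_left (n - 1) h b) = (\<Sum>b<n - 1. W b (h + 1)) * fps_X ^ 4"
  proof (cases n)
    case (Suc m)
    have "sum ?w (\<Union>b<m. ends_crossed_left m h b) = (\<Sum>b<m. sum ?w (ends_crossed_left m h b))"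
    proof (rule sum.UNION_disjoint)
      show "\<forall>b\<in>{..<m}. \<forall>c\<in>{..<m}. b \<noteq> c \<longrightarrow> ends_crossed_left m h b \<inter> ends_crossed_left m h c = {}"
        using h by (auto simp: ends_crossed_left_iff left_block_def)
    qed auto
    also have "\<dots> = (\<Sum>b<m. W b (h + 1) * fps_X ^ 4)"
      using h sum_ends_crossed_left [of _ m h] Suc by (intro sum.cong) auto
    finally show ?thesis using Suc by (simp add: sum_distrib_right)
  qed simp
  have B: "sum ?w (if n \<ge> 3 then ends_crossed_left_fixed (n - 3) h else {}) =
      (if n \<ge> 3 then W (n - 3) (h + 1) * fps_X ^ 6 else 0)"
    using sum_ends_crossed_left_fixed [OF h, of "n - 3"] by auto
  have "f \<notin> ends_crossed_left_fixed (n - 3) h" if "b < n - 1" "f \<in> ends_crossed_left (n - 1) h b" "n \<ge> 3" for f b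
  proof
    assume f: "f \<in> ends_crossed_left_fixed (n - 3) h"
    have "f (n - 1) = n - 1"
      using f \<open>n \<ge> 3\<close> unfolding ends_crossed_left_fixed_iff [OF h] by (auto simp: numeral_eq_Suc Suc_diff_Suc)
    moreover have "f (n - 1) < n - 1"
      using that(1,2) unfolding ends_crossed_left_iff [OF that(1) h] by (auto simp: left_block_def)
    ultimately show False by simp
  qed
  then have "(\<Union>b<n - 1. ends_crossed_left (n - 1) h b) \<inter>
      (if n \<ge> 3 then ends_crossed_left_fixed (n - 3) h else {}) = {}" by auto
  then show ?thesis
    unfolding last_left_def by (subst sum.union_disjoint) (use A B in auto)
qed

lemma sum_last_right:
  assumes h: "h \<ge> 2"
  shows "sum (weight 0 {..n + h}) (last_right n h) =
    (\<Sum>b<n - 1. W b (h - 1)) * fps_X ^ 4 + (if n \<ge> 3 then W (n - 3) (h - 1) * fps_X ^ 6 else 0)"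
proof -
  let ?w = "weight 0 {..n + h}"
  have v: "f (n + 2) = b" if "f \<in> ends_crossed_right n h b" "b < n - 1" for f b
    using that h by (simp add: ends_crossed_right_iff right_block_def)
  have "sum ?w (\<Union>b<n - 1. ends_crossed_right n h b) = (\<Sum>b<n - 1. sum ?w (ends_crossed_right n h b))"
  proof (rule sum.UNION_disjoint)
    show "\<forall>b\<in>{..<n - 1}. \<forall>c\<in>{..<n - 1}. b \<noteq> c \<longrightarrow> ends_crossed_right n h b \<inter> ends_crossed_right n h c = {}"
      by (intro ballI impI equals0I) (metis v IntD1 IntD2 lessThan_iff)
  qed auto
  also have "\<dots> = (\<Sum>b<n - 1. W b (h - 1) * fps_X ^ 4)"
    using h by (intro sum.cong sum_ends_crossed_right) auto
  finally have A: "sum ?w (\<Union>b<n - 1. ends_crossed_right n h b) = (\<Sum>b<n - 1. W b (h - 1)) * fps_X ^ 4"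
    by (simp add: sum_distrib_right)
  have B: "sum ?w (if n \<ge> 3 then ends_crossed_right_fixed (n - 3) h else {}) =
      (if n \<ge> 3 then W (n - 3) (h - 1) * fps_X ^ 6 else 0)"
    using sum_ends_crossed_right_fixed [OF h, of "n - 3"] by auto
  have "f \<notin> ends_crossed_right_fixed (n - 3) h" if "b < n - 1" "f \<in> ends_crossed_right n h b" "n \<ge> 3" for f b
  proof
    assume f: "f \<in> ends_crossed_right_fixed (n - 3) h"
    define m where "m = n - 3"
    have n: "n = m + 3" using \<open>n \<ge> 3\<close> by (simp add: m_def)
    have "f (m + 4) = m + 2" "f (m + 5) = m"
      using f n unfolding ends_crossed_right_fixed_iff [OF h] by (auto simp: right_fixed_block_def)
    then have "f (n + 1) = f (n + 2) + 2" by (simp add: n add.commute)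
    moreover have "b + 1 < n" using that by simp
    then have "f (n + 1) = f (n + 2) + 1"
      using that(2) h by (simp add: ends_crossed_right_iff right_block_def)
    ultimately show False by simp
  qed
  then have "(\<Union>b<n - 1. ends_crossed_right n h b) \<inter>
      (if n \<ge> 3 then ends_crossed_right_fixed (n - 3) h else {}) = {}" by auto
  then show ?thesis
    unfolding last_right_def by (subst sum.union_disjoint) (use A B in auto)
qed

lemma sum_crossed:
  assumes h: "h \<ge> 1"
  shows "sum (weight 0 {..n + h}) (\<Union>b<n. ends_crossed n h b) = (\<Sum>b<n. W b h * (fps_X * D (n - 1 - b)))"
proof -
  have "sum (weight 0 {..n + h}) (\<Union>b<n. ends_crossed n h b) =
      (\<Sum>b<n. sum (weight 0 {..n + h}) (ends_crossed n h b))"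
  proof (rule sum.UNION_disjoint)
    show "\<forall>b\<in>{..<n}. \<forall>c\<in>{..<n}. b \<noteq> c \<longrightarrow> ends_crossed n h b \<inter> ends_crossed n h c = {}"
      using h by (auto simp: ends_crossed_iff)
  qed auto
  then show ?thesis using h sum_ends_crossed by simp
qed

text \<open>The summands belong, in this order, to a last point that is fixed, closed in nested
  order or opened, to \<open>ends_crossed\<close>, to \<open>last_left\<close> and to
  \<open>last_right\<close>. A \<open>last_left\<close> block starts with one open arc more than
  remain in the end, a \<open>last_right\<close> block with one less.\<close>

lemma W_Suc:
  "eq8 (W (Suc n) h) (W n h + W n (h + 1) + (if h \<ge> 1 then W n (h - 1) else 0) +
    (if h \<ge> 1 then (\<Sum>b<n. W b h * (fps_X * D (n - 1 - b))) +
      ((\<Sum>b<n - 1. W b (h + 1)) * fps_X ^ 4 + (if n \<ge> 3 then W (n - 3) (h + 1) * fps_X ^ 6 else 0)) else 0) +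
    (if h \<ge> 2 then (\<Sum>b<n - 1. W b (h - 1)) * fps_X ^ 4 +
      (if n \<ge> 3 then W (n - 3) (h - 1) * fps_X ^ 6 else 0) else 0))"
proof -
  let ?S = "{..n + h}" let ?w = "weight 0 ?S"
  let ?O = "if h \<ge> 1 then ends_open n h else {}"
  let ?C = "if h \<ge> 1 then \<Union>b<n. ends_crossed n h b else {}"
  let ?L = "if h \<ge> 1 then last_left n h else {}"
  let ?R = "if h \<ge> 2 then last_right n h else {}"
  let ?U = "ends_fixed n h \<union> (ends_nested n h \<union> (?O \<union> (?C \<union> (?L \<union> ?R))))"
  have "W (Suc n) h = total_weight 0 {..n} {n<..n + h}"
    using total_weight_W [of "{..n}" "{n<..n + h}"] by simp
  also have "\<dots> = sum ?w (nested_end {..n} {n<..n + h})"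
    by (simp add: total_weight_def atMost_Un_greaterThanAtMost)
  also have "eq8 \<dots> (sum ?w ?U)"
  proof (rule eq8_sum_weight)
    fix f assume "occ ?S f < 8"
    have "f \<in> nested_end {..n} {n<..n + h}" if "f \<in> ends_crossed n h b" "h \<ge> 1" "b < n" for b
      using that by (simp add: ends_crossed_iff)
    then have "f \<in> nested_end {..n} {n<..n + h}" if "f \<in> ?U"
      using that by (auto simp: ends_fixed_iff ends_nested_iff ends_open_iff
          dest: last_leftD(1) last_rightD(1) split: if_splits)
    then show "f \<in> nested_end {..n} {n<..n + h} \<longleftrightarrow> f \<in> ?U"
      using nested_end_cases [OF _ \<open>occ ?S f < 8\<close>] by blast
  qed auto
  also have "sum ?w ?U = sum ?w (ends_fixed n h) + (sum ?w (ends_nested n h) + (sum ?w ?O +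
      (sum ?w ?C + (sum ?w ?L + sum ?w ?R))))"
  proof -
    \<comment> \<open>The classes are told apart by \<open>f n\<close> against \<open>n\<close>, by
      \<open>f (n + 1)\<close> and \<open>f (n + 2)\<close> against \<open>f n\<close>, and by
      whether \<open>{f (n + 1)<..<n}\<close> is closed under \<open>f\<close>.\<close>
    have L: "f n < n \<and> f n < f (n + 1) \<and> (1 < h \<longrightarrow> f (n + 2) < f n) \<and>
        \<not> f ` {f (n + 1)<..<n} \<subseteq> {f (n + 1)<..<n} \<and> h \<ge> 1" if "f \<in> ?L" for f
      using that last_leftD [of f n h] by (auto split: if_splits)
    have R: "f n < n \<and> f n < f (n + 1) \<and> f n < f (n + 2) \<and> h \<ge> 2" if "f \<in> ?R" for f
      using that last_rightD [of f n h] by (auto split: if_splits)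
    have C: "f n < n \<and> f n < f (n + 1) \<and> (1 < h \<longrightarrow> f (n + 2) < f n) \<and>
        f ` {f (n + 1)<..<n} \<subseteq> {f (n + 1)<..<n} \<and> h \<ge> 1" if "f \<in> ?C" for f
      using that by (auto simp: ends_crossed_iff split: if_splits)
    have O: "f n = n + 1" if "f \<in> ?O" for f
      using that by (auto simp: ends_open_iff split: if_splits)
    have N: "f n < n \<and> (h \<ge> 1 \<longrightarrow> f (n + 1) < f n)" if "f \<in> ends_nested n h" for f
      using that by (simp add: ends_nested_iff)
    have F: "f n = n" if "f \<in> ends_fixed n h" for f using that by (simp add: ends_fixed_iff)
    have "?L \<inter> ?R = {}"
    proof (rule equals0I)
      fix f assume "f \<in> ?L \<inter> ?R"
      then have "f \<in> ?L" "f \<in> ?R" by blast+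
      then show False using L [of f] R [of f] by auto
    qed
    moreover have "?C \<inter> (?L \<union> ?R) = {}"
    proof (rule equals0I)
      fix f assume f: "f \<in> ?C \<inter> (?L \<union> ?R)"
      then have "f \<in> ?C" "f \<in> ?L \<or> f \<in> ?R" by blast+
      then show False using C [of f] L [of f] R [of f] by auto
    qed
    moreover have "?O \<inter> (?C \<union> (?L \<union> ?R)) = {}"
    proof (rule equals0I)
      fix f assume f: "f \<in> ?O \<inter> (?C \<union> (?L \<union> ?R))"
      then have "f n < n" using C L R by blast
      then show False using O [of f] f by simp
    qed
    moreover have "ends_nested n h \<inter> (?O \<union> (?C \<union> (?L \<union> ?R))) = {}"
    proof (rule equals0I)
      fix f assume f: "f \<in> ends_nested n h \<inter> (?O \<union> (?C \<union> (?L \<union> ?R)))"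
      then have "f \<in> ends_nested n h" "f \<in> ?O \<or> f \<in> ?C \<or> f \<in> ?L \<or> f \<in> ?R" by blast+
      then show False using N [of f] O [of f] C [of f] L [of f] R [of f] by auto
    qed
    moreover have "ends_fixed n h \<inter> (ends_nested n h \<union> (?O \<union> (?C \<union> (?L \<union> ?R)))) = {}"
    proof (rule equals0I)
      fix f assume f: "f \<in> ends_fixed n h \<inter> (ends_nested n h \<union> (?O \<union> (?C \<union> (?L \<union> ?R))))"
      then have "f n = n + 1 \<or> f n < n" using N O C L R by blast
      then show False using F [of f] f by auto
    qed
    moreover have "finite ?O" "finite ?C" "finite ?L" "finite ?R" by auto
    ultimately show ?thesis by (simp only: sum.union_disjoint finite_UnI finite_classes)
  qed
  finally show ?thesis
    using sum_ends_fixed [of n h] sum_ends_nested [of n h] sum_ends_open [of h n]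
      sum_crossed [of h n] sum_last_left [of h n] sum_last_right [of h n]
    by (auto simp: add_ac split: if_splits)
qed

lemma W_0: "W 0 h = (if h = 0 then 1 else 0)"
proof (cases "h = 0")
  case True
  have "involutions_on {} = {\<lambda>x. x}" by (auto simp: involutions_on_def)
  moreover have "occ {} f = 0" for f by (rule occ_antitone) simp
  ultimately show ?thesis
    using True by (simp add: W_def total_weight_def nested_end_empty weight_def)
next
  case False
  then have "nested_end {..<0} {0..<0 + h} = {}" by (auto simp: nested_end_def)
  then show ?thesis using False by (simp add: W_def total_weight_def)
qed

subsection \<open>Involutions with few ascending pairs\<close>

definition asc_list :: "nat list \<Rightarrow> nat" where
  "asc_list p = (\<Sum>i\<leftarrow>[0..<length p]. length (filter (\<lambda>j. p ! i < p ! j) [Suc i..<length p]))"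

lemma asc_list_eq: "asc_list p = asc {..<length p} ((!) p)"
proof -
  let ?n = "length p"
  have "asc_pairs {..<?n} ((!) p) = (SIGMA i : {0..<?n}. {j \<in> {Suc i..<?n}. p ! i < p ! j})"
    by (auto simp: asc_pairs_def)
  then show ?thesis
    unfolding asc_def asc_list_def by (simp add: interv_sum_list_conv_sum_set_nat length_filter_upt)
qed

definition involution_lists :: "nat \<Rightarrow> nat list list" where
  "involution_lists n = filter (\<lambda>p. list_all (\<lambda>i. p ! (p ! i) = i) [0..<n]) (List.n_lists n [0..<n])"

lemma D_involution_lists:
  "D n = (\<Sum>p\<leftarrow>involution_lists n. fps_X ^ (occ_list p + 2 * asc_list p))"
proof -
  have mem: "p \<in> set (involution_lists n) \<longleftrightarrow> length p = n \<and> (\<forall>i<n. p ! i < n \<and> p ! (p ! i) = i)" for p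
    unfolding involution_lists_def set_filter set_n_lists list_all_iff
    by (auto simp: subset_iff in_set_conv_nth)
  have "D n = (\<Sum>f\<in>involutions_on {..<n}. fps_X ^ (occ {..<n} f + 2 * asc {..<n} f))"
    by (simp add: D_def total_weight_def nested_end_empty weight_def)
  also have "\<dots> = (\<Sum>p\<in>set (involution_lists n). fps_X ^ (occ_list p + 2 * asc_list p))"
  proof (rule sum.reindex_bij_witness [where i = "\<lambda>p i. if i < n then p ! i else i"
        and j = "\<lambda>f. map f [0..<n]"])
    fix f assume f: "f \<in> involutions_on {..<n}"
    then show "(\<lambda>i. if i < n then map f [0..<n] ! i else i) = f"
      by (auto simp: involutions_on_def)
    have lt: "f i < n" if "i < n" for i using f that by (auto simp: involutions_on_def)
    then show "map f [0..<n] \<in> set (involution_lists n)"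
      using f unfolding mem by (auto simp: involutions_on_def)
    have "occ {..<n} ((!) (map f [0..<n])) = occ {..<n} f" "asc {..<n} ((!) (map f [0..<n])) = asc {..<n} f"
      by (rule occ_cong asc_cong; simp)+
    then show "fps_X ^ (occ_list (map f [0..<n]) + 2 * asc_list (map f [0..<n])) =
        (fps_X ^ (occ {..<n} f + 2 * asc {..<n} f) :: real fps)"
      by (simp add: occ_list_eq asc_list_eq)
  next
    fix p assume p: "p \<in> set (involution_lists n)"
    then show "map (\<lambda>i. if i < n then p ! i else i) [0..<n] = p"
      unfolding mem by (intro nth_equalityI) auto
    show "(\<lambda>i. if i < n then p ! i else i) \<in> involutions_on {..<n}"
      using p unfolding mem involutions_on_def by auto
  qed
  also have "\<dots> = (\<Sum>p\<leftarrow>involution_lists n. fps_X ^ (occ_list p + 2 * asc_list p))"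
    by (rule sum_list_distinct_conv_sum_set [symmetric])
      (simp add: involution_lists_def distinct_n_lists)
  finally show ?thesis .
qed

definition involution_costs :: "nat \<Rightarrow> nat list" where
  "involution_costs n = map (\<lambda>p. occ_list p + 2 * asc_list p) (involution_lists n)"

lemma D_involution_costs: "D n = (\<Sum>c\<leftarrow>involution_costs n. fps_X ^ c)"
  by (simp add: D_involution_lists involution_costs_def o_def)

text \<open>Exhaustive enumeration of the sizes below 5, where the recursion \<open>D_step\<close>
  begins to hold.\<close>

lemma involution_costs_small:
  "involution_costs 0 = [0]" "involution_costs (Suc 0) = [0]" "sort (involution_costs 2) = [0, 2]"
  "sort (involution_costs 3) = [0, 4, 4, 6]" "sort (involution_costs 4) = [0, 2, 5, 6, 6, 8, 10, 10, 10, 12]"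
  by code_simp+

lemma sum_list_sort: "sum_list (map f (sort xs)) = (sum_list (map f xs) :: 'a::comm_monoid_add)"
  by (metis mset_map mset_sort sum_mset_sum_list)

text \<open>\<open>D\<close> enters the recursion for \<open>W\<close> with a factor
  \<open>fps_X\<close>, so for 4 points the costs from 7 on are dropped.\<close>

lemma D_small:
  "D 0 = 1" "D (Suc 0) = 1" "D 2 = 1 + fps_X ^ 2" "D 3 = 1 + 2 * fps_X ^ 4 + fps_X ^ 6"
  "eq8 (fps_X * D 4) (fps_X * (1 + fps_X ^ 2 + fps_X ^ 5 + 2 * fps_X ^ 6))"
proof -
  have s: "D n = (\<Sum>c\<leftarrow>sort (involution_costs n). fps_X ^ c)" for n
    by (simp add: D_involution_costs sum_list_sort)
  show "D 0 = 1" "D (Suc 0) = 1"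
    by (simp_all add: D_involution_costs involution_costs_small)
  show "D 2 = 1 + fps_X ^ 2" "D 3 = 1 + 2 * fps_X ^ 4 + fps_X ^ 6"
    unfolding s involution_costs_small by simp_all
  show "eq8 (fps_X * D 4) (fps_X * (1 + fps_X ^ 2 + fps_X ^ 5 + 2 * fps_X ^ 6))"
    unfolding s involution_costs_small by (auto simp: eq8_def algebra_simps numeral_fps_const)
qed

lemma occ_asc_drop_outer:
  assumes f: "f \<in> involutions_on {..<n}" and n: "2 \<le> n" and f0: "f 0 = n - 1"
  shows "occ {0<..<n - 1} f = occ {..<n} f" "asc {0<..<n - 1} f = asc {..<n} f"
proof -
  have inv: "f (f x) = x" and lt: "x < n \<Longrightarrow> f x < n" for x using f by (auto simp: involutions_on_def)
  have fn: "f (n - 1) = 0" using f0 inv [of 0] by simp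
  have S: "{0<..<n - 1} = {..<n} - {0, n - 1}" by auto
  have le: "f y \<le> n - 1" if "y < n" for y using lt [OF that] by simp
  show "occ {0<..<n - 1} f = occ {..<n} f"
    unfolding S using f0 fn le by (intro occ_remove) auto
  have "asc_pairs {..<n} f = asc_pairs {0<..<n - 1} f"
  proof (rule set_eqI, clarify)
    fix i j
    have "0 < i \<and> j < n - 1" if "i < j" "j < n" "f i < f j"
      using that f0 fn le [of j] by (metis One_nat_def Suc_pred bot_nat_0.not_eq_extremum less_SucE not_le
          less_nat_zero_code)
    then show "(i, j) \<in> asc_pairs {..<n} f \<longleftrightarrow> (i, j) \<in> asc_pairs {0<..<n - 1} f"
      by (auto simp: asc_pairs_def)
  qed
  then show "asc {0<..<n - 1} f = asc {..<n} f" by (simp add: asc_def)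
qed

lemma sum_outer_nested:
  assumes n: "2 \<le> n"
  shows "(\<Sum>f | f \<in> involutions_on {..<n} \<and> f 0 = n - 1. weight 2 {..<n} f) = D (n - 2)"
proof -
  let ?A = "{0<..<n - 1}"
  have S: "{..<n} = ?A \<union> {0, n - 1}" using n by auto
  have "(\<Sum>f | f \<in> involutions_on {..<n} \<and> f 0 = n - 1. weight 2 {..<n} f) =
      (\<Sum>f | f \<in> involutions_on {..<n} \<and> f 0 = n - 1. weight 2 ?A (restr ?A f))"
    using occ_asc_drop_outer [OF _ n] by (intro sum.cong) (auto simp: weight_def)
  also have "\<dots> = sum (weight 2 ?A) (involutions_on ?A)"
    unfolding S by (rule sum_involutions_with_arc) auto
  also have "\<dots> = D (n - 2)"
    using total_weight_D [of ?A] by (simp add: total_weight_def nested_end_empty numeral_2_eq_2)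
  finally show ?thesis .
qed

lemma asc_ge_card:
  assumes "finite S" "P \<subseteq> asc_pairs S f"
  shows "card P \<le> asc S f"
  unfolding asc_def by (rule card_mono) (use assms in auto)

definition reverse_with_swapped_ends :: "nat \<Rightarrow> nat \<Rightarrow> nat" where
  "reverse_with_swapped_ends n x = (if x = 0 then n - 2 else if x = 1 then n - 1 else if x = n - 2 then 0
     else if x = n - 1 then 1 else if x < n then n - 1 - x else x)"

text \<open>If 0 is not matched with the last point, both are in ascending pairs, and for 5 or more
  points few of these are affordable. The only cheap way is two crossing arcs at the ends around
  reversed points: 2 ascending pairs and 1 occurrence, hence cost 5.\<close>

lemma outer_not_nested:
  assumes f: "f \<in> involutions_on {..<n}" and n: "5 \<le> n" and f0: "f 0 \<noteq> n - 1"
    and cost: "occ {..<n} f + 2 * asc {..<n} f < 7"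
  shows "f = reverse_with_swapped_ends n"
proof -
  have inv: "f (f x) = x" and lt: "x < n \<Longrightarrow> f x < n" and out: "n \<le> x \<Longrightarrow> f x = x" for x
    using f by (auto simp: involutions_on_def)
  have inj: "f x = f y \<longleftrightarrow> x = y" for x y using inv by metis
  define j m where "j = f 0" and "m = f (n - 1)"
  have j: "f 0 = j" "f j = 0" "j < n" "j \<noteq> n - 1" and m: "f (n - 1) = m" "f m = n - 1" "m < n" "m \<noteq> 0"
  proof -
    have "f (n - 1) \<noteq> 0" using f0 inv by metis
    then show "f 0 = j" "f j = 0" "j < n" "j \<noteq> n - 1" "f (n - 1) = m" "f m = n - 1" "m < n" "m \<noteq> 0"
      using n inv lt f0 by (simp_all add: j_def m_def)
  qed
  \<comment> \<open>The ascending pairs that begin with the point 0, whose value is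
    \<open>j\<close>, and those that end with \<open>n - 1\<close>, whose value is
    \<open>m\<close>.\<close>
  let ?P = "(\<lambda>v. (0 :: nat, f v)) ` {j<..<n}" and ?Q = "(\<lambda>v. (f v, n - 1)) ` {..<m}"
  have fpos: "0 < f v" if "v \<noteq> j" for v using inj [of v j] j that by auto
  have flast: "f v < n - 1" if "v \<noteq> m" "v < n" for v
    using inj [of v m] m that lt [of v] by auto
  have P: "?P \<subseteq> asc_pairs {..<n} f"
    using j n lt fpos inv by (auto simp: asc_pairs_def)
  have Q: "?Q \<subseteq> asc_pairs {..<n} f"
  proof
    fix t assume "t \<in> ?Q"
    then obtain v where v: "t = (f v, n - 1)" "v < m" by auto
    then have "v < n" "v \<noteq> m" using m by auto
    then have "f v < n - 1" using flast by blast
    then show "t \<in> asc_pairs {..<n} f" using v m(1) inv n by (simp add: asc_pairs_def)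
  qed
  have cP: "card ?P = n - 1 - j" and cQ: "card ?Q = m"
    by (subst card_image; auto simp: inj_on_def inj)+
  have PQ: "?P \<inter> ?Q \<subseteq> {(0, n - 1)}" by auto
  have cPQ: "card (?P \<union> ?Q) + card (?P \<inter> ?Q) = n - 1 - j + m"
  proof -
    have "card ?P + card ?Q = card (?P \<union> ?Q) + card (?P \<inter> ?Q)" by (rule card_Un_Int) auto
    then show ?thesis using cP cQ by linarith
  qed
  have U: "card (?P \<union> ?Q) \<le> asc {..<n} f" using P Q by (intro asc_ge_card) auto
  have asc3: "asc {..<n} f \<le> 3" using cost by simp
  \<comment> \<open>Otherwise \<open>?P\<close> and \<open>?Q\<close> share at most one pair and
    provide at least \<open>n - 1\<close> ascending pairs, that is at least 4, while the cost allows
    3.\<close>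
  have "m < j"
  proof (rule ccontr)
    assume "\<not> m < j"
    moreover have "m \<noteq> j" using inj [of 0 "n - 1"] j m n by auto
    ultimately have "j < m" by simp
    moreover have "card (?P \<inter> ?Q) \<le> 1" using card_mono [OF _ PQ] by simp
    ultimately show False using cPQ U asc3 n j by linarith
  qed
  have "occ_list [2, 3, 0, 1] \<le> occ {..<n} f"
    by (rule occ_ge_pattern [where xs = "[0, m, j, n - 1]" and ys = "[0, m, j, n - 1]"])
      (use j m \<open>m < j\<close> in auto)
  moreover have "occ_list [2, 3, 0, 1] = 1" by code_simp
  ultimately have asc2: "asc {..<n} f \<le> 2" using cost by simp
  have "?P \<inter> ?Q = {}" using \<open>m < j\<close> by (auto simp: inj) (metis inv j(1) lessI m(1) not_less_iff_gr_or_eq order_less_trans)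
  then have card: "card (?P \<union> ?Q) = n - 1 - j + m" using cPQ by simp
  then have jm: "j = n - 2" "m = 1" using U asc2 j m n by auto
  have "finite (asc_pairs {..<n} f)" by simp
  \<comment> \<open>One pair from each side exhausts the bound, so there are no further ascending
    pairs and the points in between are reversed.\<close>
  then have all: "asc_pairs {..<n} f = ?P \<union> ?Q"
    using card jm n asc2 P Q by (intro card_seteq [symmetric]) (auto simp: asc_def)
  have desc: "f y < f x" if "1 < x" "x < y" "y < n - 2" for x y
  proof (rule ccontr)
    assume "\<not> f y < f x"
    then have "(x, y) \<in> asc_pairs {..<n} f"
      using that inj [of x y] by (auto simp: asc_pairs_def le_less not_less)
    then show False unfolding all using that by auto
  qed
  have closed: "f ` {1<..<n - 2} \<subseteq> {1<..<n - 2}"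
  proof (clarsimp)
    fix x assume x: "Suc 0 < x" "x < n - 2"
    have "f x \<noteq> w" if "f w \<noteq> x" for w using inv [of x] that by metis
    then have "f x \<noteq> 0" "f x \<noteq> 1" "f x \<noteq> n - 1" "f x \<noteq> n - 2" 
      using j m jm x by auto
    moreover have "f x < n" using x lt [of x] by simp
    ultimately have "f x \<noteq> 0" "f x \<noteq> 1" "f x \<noteq> n - 1" "f x \<noteq> n - 2" "f x < n" by blast+
    then show "Suc 0 < f x \<and> f x < n - 2" by auto
  qed
  have mid: "f x = n - 1 - x" if "1 < x" "x < n - 2" for x
    using antitone_interval [OF closed desc that] n by simp
  show ?thesis
  proof
    fix x
    consider "x = 0" | "x = 1" | "x = n - 2" | "x = n - 1" | "1 < x" "x < n - 2" | "n \<le> x" by linarith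
    then show "f x = reverse_with_swapped_ends n x"
      using j m jm n mid [of x] out [of x] by cases (auto simp: reverse_with_swapped_ends_def)
  qed
qed

lemma reverse_with_swapped_ends:
  assumes n: "5 \<le> n"
  shows "reverse_with_swapped_ends n \<in> involutions_on {..<n}"
    and "occ {..<n} (reverse_with_swapped_ends n) + 2 * asc {..<n} (reverse_with_swapped_ends n) = 5"
proof -
  let ?f = "reverse_with_swapped_ends n"
  have v: "?f 0 = n - 2" "?f 1 = n - 1" "?f (n - 2) = 0" "?f (n - 1) = 1"
    using n by (auto simp: reverse_with_swapped_ends_def)
  have mid: "?f x = n - 1 - x" if "1 < x" "x < n - 2" for x
    using that by (auto simp: reverse_with_swapped_ends_def)
  have cases: "x = 0 \<or> x = 1 \<or> x = n - 2 \<or> x = n - 1 \<or> 1 < x \<and> x < n - 2 \<and> ?f x = n - 1 - x" if "x < n" for x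
    using that mid [of x] by linarith
  have out: "?f x = x" if "n \<le> x" for x using that n by (auto simp: reverse_with_swapped_ends_def)
  have inv: "?f x < n \<and> ?f (?f x) = x" if "x < n" for x
    using cases [OF that]
  proof (elim disjE)
    assume x: "1 < x \<and> x < n - 2 \<and> ?f x = n - 1 - x"
    then have "1 < n - 1 - x" "n - 1 - x < n - 2" by auto
    then show ?thesis using x mid [of "n - 1 - x"] by auto
  qed (use v n in auto)
  then show "?f \<in> involutions_on {..<n}"
    using out unfolding involutions_on_def by (auto simp: not_less) (metis not_less)
  have val: "x = 0 \<and> ?f x = n - 2 \<or> x = 1 \<and> ?f x = n - 1 \<or> x = n - 2 \<and> ?f x = 0 \<or>
        x = n - 1 \<and> ?f x = 1 \<or> 1 < x \<and> x < n - 2 \<and> ?f x = n - 1 - x" if "x < n" for x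
      using cases [OF that] v by metis
  have "asc_pairs {..<n} ?f = {(0, 1), (n - 2, n - 1)}"
  proof (rule set_eqI, clarify)
    fix i j
    show "(i, j) \<in> asc_pairs {..<n} ?f \<longleftrightarrow> (i, j) \<in> {(0, 1), (n - 2, n - 1)}"
    proof
      assume "(i, j) \<in> asc_pairs {..<n} ?f"
      then have ij: "i < n" "j < n" "i < j" "?f i < ?f j" by (auto simp: asc_pairs_def)
      have "i = 0 \<and> j = 1 \<or> i = n - 2 \<and> j = n - 1"
        using val [OF ij(1)] val [OF ij(2)] ij n by (elim disjE conjE) linarith+
      then show "(i, j) \<in> {(0, 1), (n - 2, n - 1)}" by auto
    qed (use n v in \<open>auto simp: asc_pairs_def\<close>)
  qed
  then have "asc {..<n} ?f = 2" using n by (simp add: asc_def)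
  moreover have "occ {..<n} ?f = 1"
  proof -
    have "occ ({..<n} - {1<..<n - 2}) ?f = occ {..<n} ?f"
    proof (rule occ_remove)
      fix x y assume x: "x \<in> {1<..<n - 2}" and y: "y \<in> {..<n}"
      then have fx: "?f x = n - 1 - x" using mid by simp
      have "y < n" using y by simp
      from val [OF this] have "(x < y \<longrightarrow> ?f y \<le> ?f x) \<and> (y < x \<longrightarrow> ?f x \<le> ?f y)"
        using x fx n by (elim disjE conjE) auto
      then show "x < y \<Longrightarrow> ?f y \<le> ?f x" "y < x \<Longrightarrow> ?f x \<le> ?f y" by auto
    qed
    moreover have "{..<n} - {1<..<n - 2} = set [0, 1, n - 2, n - 1]" using n by auto
    moreover have "occ (set [0, 1, n - 2, n - 1]) ?f = occ_list [2, 3, 0, 1]"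
      by (rule occ_pattern [where ys = "[0, 1, n - 2, n - 1]"]) (use n v in auto)
    moreover have "occ_list [2, 3, 0, 1] = 1" by code_simp
    ultimately show ?thesis by simp
  qed
  ultimately show "occ {..<n} ?f + 2 * asc {..<n} ?f = 5" by simp
qed

text \<open>An outermost arc is in no ascending pair and can be stripped off, which gives
  \<open>D (n - 2)\<close>. Of the other involutions only one costs less than 7, and cost 7 becomes
  exponent 8 through the factor \<open>fps_X\<close>.\<close>

lemma D_step:
  assumes n: "5 \<le> n"
  shows "eq8 (fps_X * D n) (fps_X * (D (n - 2) + fps_X ^ 5))"
proof -
  let ?I = "involutions_on {..<n}" let ?r = "reverse_with_swapped_ends n"
  let ?w = "weight 2 {..<n}"
  have "D n = sum ?w ?I" by (simp add: D_def total_weight_def nested_end_empty)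
  also have "?I = {f \<in> ?I. f 0 = n - 1} \<union> {f \<in> ?I. f 0 \<noteq> n - 1}" by auto
  also have "sum ?w \<dots> = D (n - 2) + sum ?w {f \<in> ?I. f 0 \<noteq> n - 1}"
    using n sum_outer_nested [of n] by (subst sum.union_disjoint) auto
  finally have D: "D n = D (n - 2) + sum ?w {f \<in> ?I. f 0 \<noteq> n - 1}" .
  have r: "?r \<in> {f \<in> ?I. f 0 \<noteq> n - 1}" 
    using n reverse_with_swapped_ends(1) [OF n] by (auto simp: reverse_with_swapped_ends_def)
  have rest: "sum ?w {f \<in> ?I. f 0 \<noteq> n - 1} = fps_X ^ 5 + sum ?w ({f \<in> ?I. f 0 \<noteq> n - 1} - {?r})"
    by (subst sum.remove [OF _ r]) (simp_all add: weight_def reverse_with_swapped_ends(2) [OF n])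
  have "eq8 (fps_X * sum ?w ({f \<in> ?I. f 0 \<noteq> n - 1} - {?r})) (\<Sum>f\<in>{f \<in> ?I. f 0 \<noteq> n - 1} - {?r}. 0)"
    unfolding sum_distrib_left
  proof (rule eq8_sum)
    fix f assume "f \<in> {f \<in> ?I. f 0 \<noteq> n - 1} - {?r}"
    then have "7 \<le> occ {..<n} f + 2 * asc {..<n} f"
      using outer_not_nested [OF _ n] by force
    then show "eq8 (fps_X * ?w f) 0" by (auto simp: eq8_def weight_def)
  qed
  then show ?thesis
    unfolding D rest by (simp add: eq8_def algebra_simps)
qed

subsection \<open>Generating functions\<close>

text \<open>A representative of \<open>fps_X * D n\<close> up to the seventh coefficient that
  satisfies the recursion exactly; the corrections belong to sizes 2, 3, 4 and all sizes from 5
  on.\<close>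

fun crossed_weight :: "nat \<Rightarrow> real fps" where
  "crossed_weight 0 = fps_X"
| "crossed_weight (Suc 0) = fps_X"
| "crossed_weight (Suc (Suc n)) = crossed_weight n + (if n = 0 then fps_X ^ 3 else if n = 1 then 2 * fps_X ^ 5 + fps_X ^ 7
     else if n = 2 then fps_X ^ 6 + 2 * fps_X ^ 7 else fps_X ^ 6)"

lemma D_crossed_weight: "eq8 (fps_X * D n) (crossed_weight n)"
proof (induction n rule: less_induct)
  case (less n)
  consider "n = 0" | "n = 1" | "n = 2" | "n = 3" | "n = 4" | "n \<ge> 5" by linarith
  then show ?case
  proof cases
    case 3
    have "crossed_weight 2 = fps_X * (1 + fps_X ^ 2)" by (simp add: numeral_eq_Suc algebra_simps)
    then show ?thesis using 3 D_small(3) by simp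
  next
    case 4
    have "crossed_weight 3 = fps_X * (1 + 2 * fps_X ^ 4 + fps_X ^ 6)"
      by (simp add: numeral_eq_Suc algebra_simps)
    then show ?thesis using 4 D_small(4) by simp
  next
    case 5
    have "crossed_weight 4 = fps_X * (1 + fps_X ^ 2 + fps_X ^ 5 + 2 * fps_X ^ 6)"
      by (simp add: numeral_eq_Suc algebra_simps)
    then show ?thesis using 5 D_small(5) by simp
  next
    case 6
    define m where "m = n - 2"
    have n: "n = Suc (Suc m)" "m \<ge> 3" using 6 by (auto simp: m_def)
    have "eq8 (fps_X * D n) (fps_X * D m + fps_X ^ 6)"
      using D_step [OF 6] n by (simp add: algebra_simps power_Suc [symmetric] del: power_Suc)
    also have "eq8 \<dots> (crossed_weight m + fps_X ^ 6)"
      using less [of m] n by (intro eq8_add) auto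
    also have "crossed_weight m + fps_X ^ 6 = crossed_weight n" using n by simp
    finally show ?thesis .
  qed (simp_all add: D_small)
qed

text \<open>The outer variable \<open>x\<close> marks points and the inner variable \<open>q\<close> marks occurrences.\<close>

abbreviation x :: "'a::comm_ring_1 fps fps" where "x \<equiv> fps_X"
abbreviation q :: "real fps fps" where "q \<equiv> fps_const fps_X"

definition S_hat :: "real fps fps" where
  "S_hat = Abs_fps crossed_weight"

text \<open>The weights of \<open>last_left\<close> and \<open>last_right\<close> by the number of
  enclosed points: \<open>fps_X ^ 4\<close> for reversed points, and \<open>fps_X ^ 6\<close> for
  one fixed point.\<close>

definition T_hat :: "real fps fps" where
  "T_hat = Abs_fps (\<lambda>n. fps_X ^ 4 + (if n = 1 then fps_X ^ 6 else 0))"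

lemma fps_nth_1_minus_X_mult:
  fixes F :: "'a::comm_ring_1 fps"
  shows "((1 - fps_X) * F) $ n = F $ n - (if n = 0 then 0 else F $ (n - 1))"
  by (simp add: left_diff_distrib)

lemma fps_nth_q_power_mult_x_power: "(q ^ k * x ^ j) $ n = (if n = j then fps_X ^ k else 0)"
  by (simp add: fps_const_power fps_X_power_nth)

lemma fps_nth_2_mult: "(2 * F) $ n = 2 * F $ n" for F :: "'a::comm_ring_1 fps"
  by (simp only: mult_2 fps_add_nth)

lemmas q_nth = fps_nth_q_power_mult_x_power fps_nth_q_power_mult_x_power [of 1, simplified]
  fps_nth_q_power_mult_x_power [of _ 1, simplified] fps_nth_q_power_mult_x_power [of _ 0, simplified]
  fps_nth_q_power_mult_x_power [of 1 0, simplified]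

lemma T_hat: "(1 - x) * T_hat = q ^ 4 + q ^ 6 * x - q ^ 6 * x ^ 2"
proof (rule fps_ext)
  fix n
  show "((1 - x) * T_hat) $ n = (q ^ 4 + q ^ 6 * x - q ^ 6 * x ^ 2) $ n"
    unfolding fps_nth_1_minus_X_mult fps_add_nth fps_sub_nth q_nth T_hat_def fps_nth_Abs_fps
    by (cases "n = 0"; cases "n = 1"; cases "n = 2") auto
qed

text \<open>The factor \<open>1 - x ^ 2\<close> undoes the recursion with step 2. The result
  \<open>?g\<close> is constant from index 5 on, so the factor \<open>1 - x\<close> makes it a
  polynomial.\<close>

lemma S_hat: "(1 - x) * (1 - x ^ 2) * S_hat =
  q - q * x ^ 2 + q ^ 3 * x ^ 2 - q ^ 3 * x ^ 3 + 2 * (q ^ 5 * x ^ 3) - 2 * (q ^ 5 * x ^ 4) + q ^ 6 * x ^ 4 +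
  q ^ 7 * x ^ 3 + q ^ 7 * x ^ 4 - 2 * (q ^ 7 * x ^ 5)"
proof -
  let ?g = "\<lambda>n. if n = 0 then fps_X else if n = 1 then fps_X else if n = 2 then fps_X ^ 3
      else if n = 3 then 2 * fps_X ^ 5 + fps_X ^ 7 else if n = 4 then fps_X ^ 6 + 2 * fps_X ^ 7 else fps_X ^ 6"
  have "(1 - x ^ 2) * S_hat = Abs_fps ?g"
  proof (rule fps_ext)
    fix n
    have "((1 - x ^ 2) * S_hat) $ n = crossed_weight n - (if n < 2 then 0 else crossed_weight (n - 2))"
      by (simp add: left_diff_distrib S_hat_def fps_X_power_mult_nth)
    also have "\<dots> = ?g n"
      by (cases n rule: crossed_weight.cases) auto
    finally show "((1 - x ^ 2) * S_hat) $ n = Abs_fps ?g $ n" by simp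
  qed
  then have "(1 - x) * (1 - x ^ 2) * S_hat = (1 - x) * Abs_fps ?g" by (simp add: mult.assoc)
  also have "\<dots> = q - q * x ^ 2 + q ^ 3 * x ^ 2 - q ^ 3 * x ^ 3 + 2 * (q ^ 5 * x ^ 3) - 2 * (q ^ 5 * x ^ 4) + q ^ 6 * x ^ 4 +
    q ^ 7 * x ^ 3 + q ^ 7 * x ^ 4 - 2 * (q ^ 7 * x ^ 5)" (is "_ = ?r")
  proof (rule fps_ext)
    fix n :: nat
    consider "n = 0" | "n = 1" | "n = 2" | "n = 3" | "n = 4" | "n = 5" | m where "n = 6 + m"
    proof (cases "n < 6")
      case True
      then have "n = 0 \<or> n = 1 \<or> n = 2 \<or> n = 3 \<or> n = 4 \<or> n = 5" by linarith
      then show ?thesis using that(1-6) by blast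
    next
      case False
      then show ?thesis using that(7) le_Suc_ex [of 6 n] by auto
    qed
    then show "((1 - x) * Abs_fps ?g) $ n = ?r $ n"
      unfolding fps_nth_1_minus_X_mult fps_add_nth fps_sub_nth fps_nth_2_mult q_nth fps_nth_Abs_fps
      by cases simp_all
  qed
  finally show ?thesis .
qed

section \<open>The linear system for the generating functions and its solution\<close>

definition eqx :: "real fps fps \<Rightarrow> real fps fps \<Rightarrow> bool" where
  "eqx F G \<longleftrightarrow> (\<forall>n. eq8 (F $ n) (G $ n))"

lemma eq8_mult_nth:
  assumes "c $ 0 = 0" "\<And>k. k < n \<Longrightarrow> eq8 (F $ k) (G $ k)"
  shows "eq8 ((c * F) $ n) ((c * G) $ n)"
  unfolding fps_mult_nth
proof (rule eq8_sum)
  fix i assume "i \<in> {0..n}"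
  then show "eq8 (c $ i * F $ (n - i)) (c $ i * G $ (n - i))"
    using assms by (cases "i = 0") (auto intro!: eq8_mult)
qed

text \<open>All step weights have constant coefficient 0, so the n-th coefficients are determined by
  the earlier ones, at all heights simultaneously.\<close>

lemma path_system_unique:
  fixes Q V :: "nat \<Rightarrow> real fps fps" and a u d :: "nat \<Rightarrow> real fps fps"
  assumes zero: "\<And>h. a h $ 0 = 0" "\<And>h. u h $ 0 = 0" "\<And>h. d h $ 0 = 0"
    and Q: "\<And>h. eqx (Q h) ((if h = 0 then 1 else d h * Q (h - 1)) + a h * Q h + u h * Q (h + 1))"
    and V: "\<And>h. eqx (V h) ((if h = 0 then 1 else d h * V (h - 1)) + a h * V h + u h * V (h + 1))"
  shows "eqx (Q h) (V h)"
proof -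
  have "eq8 (Q h $ n) (V h $ n)" for n
  proof (induction n arbitrary: h rule: less_induct)
    case (less n)
    have "eq8 (Q h $ n) (((if h = 0 then 1 else d h * Q (h - 1)) + a h * Q h + u h * Q (h + 1)) $ n)"
      using Q by (simp add: eqx_def)
    also have "eq8 \<dots> (((if h = 0 then 1 else d h * V (h - 1)) + a h * V h + u h * V (h + 1)) $ n)"
      using less zero by (auto intro!: eq8_add eq8_mult_nth)
    also have "eq8 \<dots> (V h $ n)" using V eq8_sym unfolding eqx_def by blast
    finally show ?case .
  qed
  then show ?thesis by (simp add: eqx_def)
qed

text \<open>Iteration from 0: the n-th coefficient of \<open>step L\<close> depends only on the
  coefficients of \<open>L\<close> below n, so the k-th coefficient is stable from the iterate
  \<open>Suc k\<close> on.\<close>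

lemma fps_quadratic_fixpoint:
  fixes c g :: "'a::comm_ring_1 fps"
  assumes "c $ 0 = 0" "g $ 0 = 0"
  obtains L where "L = 1 + c * L + g * L ^ 2"
proof -
  define step where "step L = 1 + c * L + g * L ^ 2" for L
  define s where "s m = (step ^^ m) 0" for m
  have agree: "step L $ n = step M $ n" if "\<forall>k<n. L $ k = M $ k" for L M n
  proof -
    have mult: "(e * L) $ n = (e * M) $ n" if "e $ 0 = 0" "\<forall>k<n. L $ k = M $ k" for e L M :: "'a fps"
      unfolding fps_mult_nth
    proof (rule sum.cong)
      fix i assume "i \<in> {0..n}"
      then show "e $ i * L $ (n - i) = e $ i * M $ (n - i)" using that by (cases "i = 0") auto
    qed simp
    have "\<forall>k<n. (L ^ 2) $ k = (M ^ 2) $ k"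
      using that by (auto simp: power2_eq_square fps_mult_nth intro!: sum.cong)
    then show ?thesis unfolding step_def using mult [OF assms(1) that] mult [OF assms(2), of "L ^ 2" "M ^ 2"] by simp
  qed
  have stable: "s m $ k = s (Suc m) $ k" if "k < m" for m k
    using that
  proof (induction m arbitrary: k)
    case (Suc m)
    have "step (s m) $ k = step (s (Suc m)) $ k" using Suc by (intro agree) auto
    then show ?case by (simp add: s_def)
  qed simp
  have stable': "s m $ k = s (Suc k) $ k" if "Suc k \<le> m" for m k
    using that
  proof (induction m rule: dec_induct)
    case (step m)
    then show ?case using stable [of k m] by simp
  qed simp
  define L where "L = Abs_fps (\<lambda>k. s (Suc k) $ k)"
  have "L $ n = step L $ n" for n
  proof -
    have "L $ n = step (s n) $ n" by (simp add: L_def s_def)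
    also have "\<dots> = step L $ n" by (rule agree) (simp add: L_def stable' [of _ n] Suc_leI)
    finally show ?thesis .
  qed
  then have "L = step L" by (rule fps_ext)
  then show ?thesis using that by (simp add: step_def)
qed

definition W_gf :: "nat \<Rightarrow> real fps fps" where
  "W_gf h = Abs_fps (\<lambda>n. W n h)"

text \<open>The factor \<open>x ^ 2\<close> stands for the arc ends \<open>b\<close> and
  \<open>n\<close>; the points between them are counted by \<open>S_hat\<close>.\<close>

lemma S_hat_mult_nth:
  "eq8 ((x ^ 2 * S_hat * W_gf h) $ Suc n) (\<Sum>b<n. W b h * (fps_X * D (n - 1 - b)))"
proof (cases n)
  case 0
  then show ?thesis by (simp add: mult.assoc fps_X_power_mult_nth)
next
  case (Suc m)
  have "(x ^ 2 * S_hat * W_gf h) $ Suc n = (S_hat * W_gf h) $ m"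
    using Suc by (simp add: mult.assoc fps_X_power_mult_nth)
  also have "\<dots> = (\<Sum>b = 0..m. W b h * crossed_weight (m - b))"
    by (subst mult.commute [of S_hat]) (simp only: fps_mult_nth S_hat_def W_gf_def fps_nth_Abs_fps)
  also have "eq8 \<dots> (\<Sum>b = 0..m. W b h * (fps_X * D (m - b)))"
    by (intro eq8_sum eq8_mult eq8_refl eq8_sym [OF D_crossed_weight])
  also have "(\<Sum>b = 0..m. W b h * (fps_X * D (m - b))) = (\<Sum>b<n. W b h * (fps_X * D (n - 1 - b)))"
    using Suc by (simp add: atLeast0AtMost lessThan_Suc_atMost)
  finally show ?thesis .
qed

text \<open>The factor \<open>x ^ 3\<close> stands for three arc ends among the scanned points: one
  left and two right ends in \<open>last_left\<close>, two left ends and one right end in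
  \<open>last_right\<close>.\<close>

lemma T_hat_mult_nth:
  "(x ^ 3 * T_hat * W_gf h) $ Suc n =
    (\<Sum>b<n - 1. W b h) * fps_X ^ 4 + (if n \<ge> 3 then W (n - 3) h * fps_X ^ 6 else 0)"
proof (cases "n < 2")
  case True
  then have "n = 0 \<or> n = 1" by auto
  then show ?thesis by (auto simp: mult.assoc fps_X_power_mult_nth)
next
  case False
  define m where "m = n - 2"
  have n: "n = Suc (Suc m)" using False by (simp add: m_def)
  have "(x ^ 3 * T_hat * W_gf h) $ Suc n = (T_hat * W_gf h) $ m"
    using n by (simp add: mult.assoc fps_X_power_mult_nth)
  also have "\<dots> = (\<Sum>b = 0..m. W b h * (fps_X ^ 4 + (if m - b = 1 then fps_X ^ 6 else 0)))"
    by (subst mult.commute [of T_hat]) (simp only: fps_mult_nth T_hat_def W_gf_def fps_nth_Abs_fps)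
  also have "\<dots> = (\<Sum>b = 0..m. W b h) * fps_X ^ 4 + (\<Sum>b = 0..m. if m - b = 1 then W b h * fps_X ^ 6 else 0)"
    unfolding distrib_left sum.distrib sum_distrib_right by (intro arg_cong2 [where f = "(+)"] sum.cong) auto
  also have "(\<Sum>b = 0..m. if m - b = 1 then W b h * fps_X ^ 6 else 0) = (if n \<ge> 3 then W (n - 3) h * fps_X ^ 6 else 0)"
  proof (cases m)
    case (Suc k)
    have "m - b = 1 \<longleftrightarrow> b = k" for b using Suc by auto
    then show ?thesis using n Suc by simp
  qed (use n in simp)
  also have "(\<Sum>b = 0..m. W b h) = (\<Sum>b<n - 1. W b h)"
    using n by (simp add: atLeast0AtMost lessThan_Suc_atMost)
  finally show ?thesis .
qed

text \<open>The height \<open>h\<close> counts open arcs. A crossing leaves an arc open, so at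
  height 0 all weights are \<open>x\<close>; the crossings of \<open>last_right\<close> leave two,
  so height 1 is reached from height 0 with weight \<open>x\<close> only.\<close>

lemma W_gf_system:
  "eqx (W_gf h) ((if h = 0 then 1 else (if h = 1 then x else x + x ^ 3 * T_hat) * W_gf (h - 1)) +
    (if h = 0 then x else x + x ^ 2 * S_hat) * W_gf h + (if h = 0 then x else x + x ^ 3 * T_hat) * W_gf (h + 1))"
    (is "eqx _ ?R")
  unfolding eqx_def
proof
  fix n
  show "eq8 (W_gf h $ n) (?R $ n)"
  proof (cases n)
    case 0
    then show ?thesis by (simp add: W_gf_def W_0)
  next
    case (Suc m)
    have 1: "W_gf k $ m = W m k" for k by (simp add: W_gf_def)
    have S: "eq8 (\<Sum>b<m. W b h * (fps_X * D (m - Suc b))) ((x ^ 2 * S_hat * W_gf h) $ Suc m)"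
      using eq8_sym [OF S_hat_mult_nth [of h m]] by simp
    have "eq8 (W (Suc m) h) (W m h + W m (h + 1) + (if h \<ge> 1 then W m (h - 1) else 0) +
      (if h \<ge> 1 then (x ^ 2 * S_hat * W_gf h) $ Suc m + (x ^ 3 * T_hat * W_gf (h + 1)) $ Suc m else 0) +
      (if h \<ge> 2 then (x ^ 3 * T_hat * W_gf (h - 1)) $ Suc m else 0))"
      unfolding T_hat_mult_nth
      by (rule eq8_trans [OF W_Suc]) (auto intro!: eq8_add S)
    also have "W m h + W m (h + 1) + (if h \<ge> 1 then W m (h - 1) else 0) +
      (if h \<ge> 1 then (x ^ 2 * S_hat * W_gf h) $ Suc m + (x ^ 3 * T_hat * W_gf (h + 1)) $ Suc m else 0) +
      (if h \<ge> 2 then (x ^ 3 * T_hat * W_gf (h - 1)) $ Suc m else 0) = ?R $ Suc m"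
    proof -
      consider "h = 0" | "h = 1" | "h \<ge> 2" by linarith
      then show ?thesis
        by cases (simp_all add: distrib_right 1 add_ac)
    qed
    finally show ?thesis using Suc by (simp add: W_gf_def)
  qed
qed

lemma W_gf_quadratic:
  obtains I :: "real fps fps" where "eqx (W_gf 0) I" 
    "(1 + x ^ 2 * T_hat) ^ 2 * ((1 - x) * I - 1) ^ 2 - (1 - x - x ^ 2 * S_hat) * I * ((1 - x) * I - 1) + x ^ 2 * I ^ 2 = 0"
proof -
  define s t where "s = x ^ 2 * S_hat" and "t = x ^ 3 * T_hat"
  have "(x + s) $ 0 = 0" "((x + t) ^ 2) $ 0 = 0" by (simp_all add: s_def t_def)
  then obtain L where L: \<comment> \<open>the paths that start and end at height 1 and stay above height 0\<close>
    "L = 1 + (x + s) * L + (x + t) ^ 2 * L ^ 2"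
    by (rule fps_quadratic_fixpoint)
  have "(x + x ^ 2 * L) $ 0 = 0" "(0 :: real fps fps) $ 0 = 0" by simp_all
  then obtain I where "I = 1 + (x + x ^ 2 * L) * I + 0 * I ^ 2"
    by (rule fps_quadratic_fixpoint)
  then have I: "I = 1 + (x + x ^ 2 * L) * I" by simp
  \<comment> \<open>Decomposition at the last visit of each height: \<open>I\<close> for the part up
    to the last visit of height 0, then a step up and a factor \<open>L\<close> for every height up
    to \<open>h\<close>.\<close>
  define V where "V h = (if h = 0 then I else I * x * L * ((x + t) * L) ^ (h - 1))" for h
  have "eqx (W_gf 0) (V 0)"
  proof (rule path_system_unique [where Q = W_gf and V = V and
        a = "\<lambda>h. if h = 0 then x else x + s" and u = "\<lambda>h. if h = 0 then x else x + t" and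
        d = "\<lambda>h. if h = 1 then x else x + t"])
    fix h
    show "eqx (W_gf h) ((if h = 0 then 1 else (if h = 1 then x else x + t) * W_gf (h - 1)) +
      (if h = 0 then x else x + s) * W_gf h + (if h = 0 then x else x + t) * W_gf (h + 1))"
      unfolding s_def t_def by (rule W_gf_system)
    have "V h = (if h = 0 then 1 else (if h = 1 then x else x + t) * V (h - 1)) +
      (if h = 0 then x else x + s) * V h + (if h = 0 then x else x + t) * V (h + 1)"
    proof -
      consider "h = 0" | "h = 1" | k where "h = Suc (Suc k)" by (metis One_nat_def not0_implies_Suc)
      then show ?thesis
      proof cases
        case 1
        then show ?thesis using I by (simp add: V_def algebra_simps power2_eq_square)
      next
        case 2
        have "I * x * L = I * x * (1 + (x + s) * L + (x + t) ^ 2 * L ^ 2)" using L by simp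
        then show ?thesis using 2 by (simp add: V_def algebra_simps power2_eq_square)
      next
        case (3 k)
        define M l where "M = I * x * L * ((x + t) * L) ^ k" and "l = (x + t) * L"
        have "l = (x + t) * (1 + (x + s) * L + (x + t) ^ 2 * L ^ 2)" using L unfolding l_def by simp
        also have "\<dots> = (x + t) + (x + s) * l + (x + t) * l ^ 2"
          unfolding l_def by (simp add: algebra_simps power2_eq_square)
        finally have "M * l = M * ((x + t) + (x + s) * l + (x + t) * l ^ 2)" by simp
        then have "M * l = (x + t) * M + (x + s) * (M * l) + (x + t) * (M * l * l)"
          by (simp only: algebra_simps power2_eq_square)
        moreover have "V h = M * l" "V (h - 1) = M" "V (h + 1) = M * l * l" "h \<noteq> 0" "h \<noteq> 1"
          using 3 by (simp_all add: V_def M_def l_def mult_ac)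
        ultimately show ?thesis by simp
      qed
    qed
    then show "eqx (V h) ((if h = 0 then 1 else (if h = 1 then x else x + t) * V (h - 1)) +
      (if h = 0 then x else x + s) * V h + (if h = 0 then x else x + t) * V (h + 1))"
      by (metis eqx_def eq8_refl)
  qed (auto simp: s_def t_def)
  then have "eqx (W_gf 0) I" by (simp add: V_def)
  moreover have "(1 + x ^ 2 * T_hat) ^ 2 * ((1 - x) * I - 1) ^ 2 - (1 - x - x ^ 2 * S_hat) * I * ((1 - x) * I - 1) + x ^ 2 * I ^ 2 = 0"
  proof -
    define Y where "Y = (1 - x) * I - 1"
    have Y: "Y = x ^ 2 * L * I" using I unfolding Y_def by (simp add: algebra_simps)
    \<comment> \<open>Multiplied by this factor, the equation for \<open>L\<close> contains
      \<open>L\<close> only within \<open>Y = x ^ 2 * L * I\<close>. Since \<open>x + t\<close> is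
      \<open>x\<close> times \<open>1 + x ^ 2 * T_hat\<close>, a factor \<open>x ^ 2\<close> cancels
      afterwards.\<close>
    have "x ^ 4 * I ^ 2 * L = x ^ 4 * I ^ 2 * (1 + (x + s) * L + (x + t) ^ 2 * L ^ 2)" using L by simp
    then have "x ^ 2 * I * Y = x ^ 4 * I ^ 2 + (x + s) * (x ^ 2 * I * Y) + (x + t) ^ 2 * Y ^ 2"
      unfolding Y by (simp add: algebra_simps power2_eq_square power4_eq_xxxx)
    then have "x ^ 2 * ((1 + x ^ 2 * T_hat) ^ 2 * Y ^ 2 - (1 - x - s) * I * Y + x ^ 2 * I ^ 2) = 0"
      unfolding t_def by (simp add: algebra_simps power2_eq_square power3_eq_cube power4_eq_xxxx)
    then show ?thesis unfolding Y_def s_def by simp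
  qed
  ultimately show ?thesis by (rule that)
qed

hide_const (open) x q

subsection \<open>Rational functions with powers of $1 - x$ and $1 + x$ as denominators\<close>

text \<open>A triple \<open>(p, a, b)\<close> represents $p(x) / ((1 - x)^a (1 + x)^b)$, where \<open>p\<close> lists the coefficients
  in ascending order. Identities between concrete such functions are decided by evaluation.\<close>

type_synonym ratfun = "int list \<times> nat \<times> nat"

fun poly_val :: "int list \<Rightarrow> real fls" where
  "poly_val [] = 0"
| "poly_val (c # cs) = of_int c + fls_X * poly_val cs"

fun poly_add :: "int list \<Rightarrow> int list \<Rightarrow> int list" where
  "poly_add [] q = q"
| "poly_add p [] = p"
| "poly_add (c # p) (d # q) = (c + d) # poly_add p q"

fun poly_mult :: "int list \<Rightarrow> int list \<Rightarrow> int list" where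
  "poly_mult [] q = []"
| "poly_mult (c # p) q = poly_add (map ((*) c) q) (0 # poly_mult p q)"

fun poly_power :: "int list \<Rightarrow> nat \<Rightarrow> int list" where
  "poly_power p 0 = [1]"
| "poly_power p (Suc n) = poly_mult p (poly_power p n)"

definition ratfun_val :: "ratfun \<Rightarrow> real fls" where
  "ratfun_val = (\<lambda>(p, a, b). poly_val p / ((1 - fls_X) ^ a * (1 + fls_X) ^ b))"

definition ratfun_add :: "ratfun \<Rightarrow> ratfun \<Rightarrow> ratfun" where
  "ratfun_add = (\<lambda>(p, a, b) (q, c, d).
     let e = max a c; f = max b d in
     (poly_add (poly_mult (poly_mult (poly_power [1, -1] (e - a)) (poly_power [1, 1] (f - b))) p)
        (poly_mult (poly_mult (poly_power [1, -1] (e - c)) (poly_power [1, 1] (f - d))) q), e, f))"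

definition ratfun_mult :: "ratfun \<Rightarrow> ratfun \<Rightarrow> ratfun" where
  "ratfun_mult = (\<lambda>(p, a, b) (q, c, d). (poly_mult p q, a + c, b + d))"

text \<open>Different triples may represent the same function, so the numerator of the difference is
  tested for zero.\<close>

definition ratfun_eq :: "ratfun \<Rightarrow> ratfun \<Rightarrow> bool" where
  "ratfun_eq r s = list_all (\<lambda>c. c = 0) (fst (ratfun_add r (ratfun_mult ([-1], 0, 0) s)))"

lemma poly_val_add: "poly_val (poly_add p q) = poly_val p + poly_val q"
  by (induction p q rule: poly_add.induct) (simp_all add: algebra_simps)

lemma poly_val_map_mult: "poly_val (map ((*) c) q) = of_int c * poly_val q"
  by (induction q) (simp_all add: algebra_simps)

lemma poly_val_mult: "poly_val (poly_mult p q) = poly_val p * poly_val q"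
  by (induction p) (simp_all add: poly_val_add poly_val_map_mult algebra_simps)

lemma poly_val_power: "poly_val (poly_power p n) = poly_val p ^ n"
  by (induction n) (simp_all add: poly_val_mult)

lemma poly_val_zero: "list_all (\<lambda>c. c = 0) p \<Longrightarrow> poly_val p = 0"
  by (induction p) simp_all

lemma fls_X_neq_1 [simp]: "fls_X \<noteq> (1 :: real fls)"
proof
  assume "fls_X = (1 :: real fls)"
  then have "fls_nth fls_X 0 = fls_nth (1 :: real fls) 0" by simp
  then show False by simp
qed

lemma one_plus_fls_X_nonzero [simp]: "1 + fls_X \<noteq> (0 :: real fls)"
proof
  assume "1 + fls_X = (0 :: real fls)"
  then have "fls_nth (1 + fls_X) 0 = fls_nth (0 :: real fls) 0" by simp
  then show False by simp
qed

lemma ratfun_val_mult: "ratfun_val (ratfun_mult r s) = ratfun_val r * ratfun_val s"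
  by (cases r; cases s) (simp add: ratfun_val_def ratfun_mult_def poly_val_mult power_add)

lemma ratfun_val_lift:
  assumes "a \<le> e" "b \<le> f"
  shows "poly_val (poly_mult (poly_mult (poly_power [1, -1] (e - a)) (poly_power [1, 1] (f - b))) p) /
    ((1 - fls_X) ^ e * (1 + fls_X) ^ f) = ratfun_val (p, a, b)"
proof -
  have "(1 - fls_X) ^ e = (1 - fls_X) ^ (e - a) * (1 - fls_X :: real fls) ^ a"
    "(1 + fls_X) ^ f = (1 + fls_X) ^ (f - b) * (1 + fls_X :: real fls) ^ b"
    using assms by (simp_all flip: power_add)
  then show ?thesis
    by (simp add: ratfun_val_def poly_val_mult poly_val_power)
qed

lemma ratfun_val_add: "ratfun_val (ratfun_add r s) = ratfun_val r + ratfun_val s"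
proof -
  obtain p a b q c d where rs: "r = (p, a, b)" "s = (q, c, d)" by (cases r; cases s) auto
  have "ratfun_val (ratfun_add r s) =
    poly_val (poly_mult (poly_mult (poly_power [1, -1] (max a c - a)) (poly_power [1, 1] (max b d - b))) p) /
      ((1 - fls_X) ^ max a c * (1 + fls_X) ^ max b d) +
    poly_val (poly_mult (poly_mult (poly_power [1, -1] (max a c - c)) (poly_power [1, 1] (max b d - d))) q) /
      ((1 - fls_X) ^ max a c * (1 + fls_X) ^ max b d)"
    unfolding rs ratfun_add_def Let_def ratfun_val_def prod.case poly_val_add by (rule add_divide_distrib)
  also have "\<dots> = ratfun_val r + ratfun_val s"
    unfolding rs by (subst (1 2) ratfun_val_lift) auto
  finally show ?thesis .
qed

lemma ratfun_eqD:
  assumes "ratfun_eq r s"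
  shows "ratfun_val r = ratfun_val s"
proof -
  let ?t = "ratfun_add r (ratfun_mult ([-1], 0, 0) s)"
  have "poly_val (fst ?t) = 0" using assms by (simp add: ratfun_eq_def poly_val_zero)
  then have "ratfun_val ?t = 0" by (cases ?t) (simp add: ratfun_val_def)
  moreover have "ratfun_val ([-1], 0, 0) = -1" by (simp add: ratfun_val_def)
  ultimately show ?thesis by (simp add: ratfun_val_add ratfun_val_mult)
qed

section \<open>Series in q with rational functions in x as coefficients\<close>

definition series_add :: "ratfun list \<Rightarrow> ratfun list \<Rightarrow> ratfun list" where
  "series_add = map2 ratfun_add"

definition series_coeff :: "nat \<Rightarrow> ratfun list \<Rightarrow> ratfun list \<Rightarrow> ratfun" where
  "series_coeff k r s = foldr ratfun_add (map (\<lambda>i. ratfun_mult (r ! i) (s ! (k - i))) [0..<Suc k]) ([], 0, 0)"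

definition series_mult :: "ratfun list \<Rightarrow> ratfun list \<Rightarrow> ratfun list" where
  "series_mult r s = map (\<lambda>k. series_coeff k r s) [0..<8]"

definition series_const :: "ratfun \<Rightarrow> ratfun list" where
  "series_const c = c # replicate 7 ([], 0, 0)"

text \<open>Coefficientwise multiplication by powers of \<open>1 - 2x - 3x\<^sup>2\<close>, the square of \<open>sqrt_disc\<close>.\<close>

definition series_scale :: "ratfun list \<Rightarrow> ratfun list" where
  "series_scale r = map (\<lambda>k. ratfun_mult (poly_power [1, -2, -3] k, 0, 0) (r ! k)) [0..<8]"

definition represents :: "ratfun list \<Rightarrow> real fls fps \<Rightarrow> bool" where
  "represents r F \<longleftrightarrow> length r = 8 \<and> (\<forall>k<8. F $ k = ratfun_val (r ! k))"

lemma represents_add: "represents r F \<Longrightarrow> represents s G \<Longrightarrow> represents (series_add r s) (F + G)"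
  by (auto simp: represents_def series_add_def ratfun_val_add)

lemma ratfun_val_series_coeff:
  "ratfun_val (series_coeff k r s) = (\<Sum>i = 0..k. ratfun_val (r ! i) * ratfun_val (s ! (k - i)))"
proof -
  have "ratfun_val (foldr ratfun_add rs ([], 0, 0)) = sum_list (map ratfun_val rs)" for rs
    by (induction rs) (simp_all add: ratfun_val_add, simp add: ratfun_val_def)
  then show ?thesis
    unfolding series_coeff_def
    by (simp add: o_def ratfun_val_mult interv_sum_list_conv_sum_set_nat atLeast0AtMost
        lessThan_Suc_atMost atLeast0LessThan del: upt_Suc)
qed

lemma represents_mult:
  assumes "represents r F" "represents s G"
  shows "represents (series_mult r s) (F * G)"
  unfolding represents_def
proof (intro conjI allI impI)
  show "length (series_mult r s) = 8" by (simp add: series_mult_def)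
  fix k :: nat assume k: "k < 8"
  have "(F * G) $ k = (\<Sum>i = 0..k. ratfun_val (r ! i) * ratfun_val (s ! (k - i)))"
    unfolding fps_mult_nth using assms k by (intro sum.cong) (auto simp: represents_def)
  then show "(F * G) $ k = ratfun_val (series_mult r s ! k)"
    using k by (simp add: series_mult_def ratfun_val_series_coeff)
qed

lemma represents_const: "represents (series_const c) (fps_const (ratfun_val c))"
  by (auto simp: represents_def series_const_def nth_Cons ratfun_val_def split: nat.splits)

lemma represents_eq:
  assumes "represents r F" "list_all2 ratfun_eq r s"
  shows "represents s F"
proof -
  have "length r = length s" "\<And>k. k < length r \<Longrightarrow> ratfun_val (r ! k) = ratfun_val (s ! k)"
    using assms(2) ratfun_eqD by (auto simp: list_all2_conv_all_nth)
  then show ?thesis using assms(1) by (simp add: represents_def)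
qed

text \<open>The coefficients in \<open>S_hat\<close> of the powers of q, after division by (1 - x)(1
  - x^2) = (1 - x)^2 (1 + x).\<close>

definition S_list :: "ratfun list" where
  "S_list = [([], 0, 0), ([1], 1, 0), ([], 0, 0), ([0, 0, 1], 1, 1), ([], 0, 0), ([0, 0, 0, 2], 1, 1),
     ([0, 0, 0, 0, 1], 2, 1), ([0, 0, 0, 1, 2], 1, 1)]"

definition T_list :: "ratfun list" where
  "T_list = [([], 0, 0), ([], 0, 0), ([], 0, 0), ([], 0, 0), ([1], 1, 0), ([], 0, 0), ([0, 1], 0, 0), ([], 0, 0)]"

abbreviation (input) "one_list \<equiv> series_const ([1], 0, 0)"
abbreviation (input) "x2_list \<equiv> series_const ([0, 0, 1], 0, 0)"
abbreviation (input) "ox_list \<equiv> series_const ([1, -1], 0, 0)"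

definition g_list :: "ratfun list" where
  "g_list = (let h = series_add one_list (series_mult x2_list T_list) in series_mult h h)"

definition w_list :: "ratfun list" where
  "w_list = series_add ox_list (series_mult (series_const ([0, 0, -1], 0, 0)) S_list)"

text \<open>The coefficients in reduced form; the products computed from \<open>g_list\<close> and
  \<open>w_list\<close> carry larger denominators, and \<open>alpha_check\<close> confirms the
  equality.\<close>

definition alpha_list :: "ratfun list" where
  "alpha_list = [([0, 0, 1], 0, 0),
   ([0, 0, 1], 0, 0),
   ([], 0, 0),
   ([0, 0, 0, 0, 1], 0, 1),
   ([0, 0, 2, -2], 0, 0),
   ([0, 0, 0, 0, 0, 2], 0, 1),
   ([0, 0, 0, 2, -4, 0, 5, -2], 1, 1),
   ([0, 0, 0, 0, 0, 1, 2], 0, 1)]"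

definition beta_list :: "ratfun list" where
  "beta_list = [([-1, 1], 0, 0),
   ([0, 0, -1], 1, 0),
   ([], 0, 0),
   ([0, 0, 0, 0, -1], 1, 1),
   ([0, 0, -4], 0, 0),
   ([0, 0, 0, 0, 0, -2], 1, 1),
   ([0, 0, 0, -4, 8, 0, -9, 4], 2, 1),
   ([0, 0, 0, 0, 0, -1, -2], 1, 1)]"

text \<open>The discriminant w^2 - 4 x^2 g of the quadratic equation; its constant coefficient is
  the square of \<open>sqrt_disc\<close>.\<close>

definition delta_list :: "ratfun list" where
  "delta_list = [([1, -2, -3], 0, 0),
   ([0, 0, -2], 0, 0),
   ([0, 0, 0, 0, 1], 2, 0),
   ([0, 0, 0, 0, -2], 0, 1),
   ([0, 0, 0, 0, -8, 0, 10], 2, 1),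
   ([0, 0, 0, 0, 0, -4], 0, 1),
   ([0, 0, 0, 0, 0, -8, -2, 20, 7, -8], 2, 2),
   ([0, 0, 0, 0, 0, -2, 2, 6, -8, 4], 3, 1)]"

text \<open>The quotient of - x^2 \<beta> by \<alpha>, verified in \<open>F_check\<close> by
  multiplying back. Entries 3 to 7 are the claimed rational parts.\<close>

definition F_list :: "ratfun list" where
  "F_list = [([1, -1], 0, 0),
   ([-1, 2], 1, 0),
   ([1, -2], 1, 0),
   ([-1, 1, 1, 2], 1, 1),
   ([-1, 3, 4, -8, -2], 1, 1),
   ([3, -7, -7, 12, 6], 1, 1),
   ([-5, 9, 21, -25, -34, 16, 24, -2, -2], 2, 2),
   ([7, -11, -28, 20, 54, -2, -46, 0, 2], 2, 2)]"

definition G_list :: "ratfun list" where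
  "G_list = [([-1], 0, 0),
   ([1, -2, -2], 0, 0),
   ([-1, 6, -8, -8, 15, 2, -4], 2, 0),
   ([1, -8, 18, 1, -29, -12, 14, 41, 2, -18], 2, 0),
   ([1, -14, 71, -124, -166, 874, -624, -1332, 1909, 426, -1585, 292, 400, -126], 4, 0),
   ([-3, 46, -267, 627, 134, -3321, 3954, 5214, -11775, -2186, 14525, -1701, -8824, 1537, 2594, -216, -324], 4, 0),
   ([5, -94, 712, -2582, 3124, 8364, -31620, 15464, 77508, -107098, -76814, 214160, 5782, -231050, 62700, 146176, -65653, -50328, 29646, 6462, -5346, 486], 6, 0),
   ([-7, 144, -1210, 5020, -8206, -12180, 69464, -54210, -181468, 315366, 239852, -779338, -124766, 1226006, -168810, -1272344, 418555, 813368, -373802, -279554, 153648, 37188, -23166, 486], 6, 0)]"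

text \<open>The coefficients of the square root of \<open>delta_list\<close>, scaled by odd powers of \<open>sqrt_disc\<close>.\<close>

definition R_list :: "ratfun list" where
  "R_list = [([1], 0, 0),
   ([0, 0, -1], 0, 0),
   ([0, 0, 0, 0, 0, 0, -2], 2, 0),
   ([0, 0, 0, 0, -1, 7, -14, 2, 13, -9], 2, 0),
   ([0, 0, 0, 0, -4, 36, -96, 0, 308, -188, -378, 300, 164, -144], 4, 0),
   ([0, 0, 0, 0, 0, -2, 22, -90, 150, 12, -426, 566, 54, -698, 352, 216, -162], 4, 0),
   ([0, 0, 0, 0, 0, -4, 63, -384, 1015, -308, -4307, 7496, 3477, -18776, 6671, 20904, -16311, -9932, 12993, 72, -3645, 972], 6, 0),
   ([0, 0, 0, 0, 0, -1, 17, -114, 344, -176, -1804, 4676, -1286, -11334, 15366, 5714, -26934, 13580, 16246, -19786, 324, 7983, -2349, -486], 6, 0)]"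

lemma alpha_check:
  "list_all2 ratfun_eq (series_add (series_add (series_mult g_list (series_const ([1, -2, 1], 0, 0)))
     (series_mult (series_const ([-1, 1], 0, 0)) w_list)) x2_list) alpha_list"
  by code_simp

lemma beta_check:
  "list_all2 ratfun_eq (series_add w_list (series_mult (series_const ([-2, 2], 0, 0)) g_list)) beta_list"
  by code_simp

lemma delta_check:
  "list_all2 ratfun_eq (series_add (series_mult w_list w_list) (series_mult (series_const ([0, 0, -4], 0, 0)) g_list)) delta_list"
  by code_simp

lemma F_check:
  "list_all2 ratfun_eq (series_mult alpha_list F_list) (series_mult (series_const ([0, 0, -1], 0, 0)) beta_list)"
  by code_simp

text \<open>The root is verified by squaring. The odd power of \<open>sqrt_disc\<close> in each
  coefficient contributes one factor 1 - 2x - 3x^2 to the square, apart from the powers absorbed by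
  \<open>series_scale\<close>.\<close>

lemma R_check:
  "list_all2 ratfun_eq (series_mult (series_const ([1, -2, -3], 0, 0)) (series_mult R_list R_list)) (series_scale delta_list)"
  by code_simp

lemma G_check:
  "list_all2 ratfun_eq (series_mult (series_scale alpha_list) G_list) (series_mult (series_const ([0, 0, -1], 0, 0)) R_list)"
  by code_simp

subsection \<open>Exchanging the two variables\<close>

text \<open>The outer variable becomes q, and the coefficients lie in a field, where the leading
  coefficient x^2 of \<alpha> is invertible.\<close>

definition flip :: "real fps fps \<Rightarrow> real fls fps" where
  "flip F = Abs_fps (\<lambda>k. fps_to_fls (Abs_fps (\<lambda>n. fps_nth (fps_nth F n) k)))"

lemma flip_nth: "fps_nth (flip F) k = fps_to_fls (Abs_fps (\<lambda>n. fps_nth (fps_nth F n) k))"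
  by (simp add: flip_def)

lemma flip_add: "flip (F + G) = flip F + flip G"
  by (rule fps_ext) (simp add: flip_nth fps_eq_iff flip: fps_to_fls_plus)

lemma flip_diff: "flip (F - G) = flip F - flip G"
  by (rule fps_ext) (simp add: flip_nth fps_eq_iff flip: fps_to_fls_minus)

lemma fps_to_fls_sum: "fps_to_fls (sum f A) = (\<Sum>x\<in>A. fps_to_fls (f x))"
  by (induction A rule: infinite_finite_induct) (simp_all add: fps_to_fls_plus)

lemma flip_mult: "flip (F * G) = flip F * flip G"
proof (rule fps_ext)
  fix k
  have "Abs_fps (\<lambda>n. fps_nth (fps_nth (F * G) n) k) =
      (\<Sum>j = 0..k. Abs_fps (\<lambda>n. fps_nth (fps_nth F n) j) * Abs_fps (\<lambda>n. fps_nth (fps_nth G n) (k - j)))"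
  proof (rule fps_ext)
    fix n
    have "fps_nth (fps_nth (F * G) n) k =
        (\<Sum>i = 0..n. \<Sum>j = 0..k. fps_nth (fps_nth F i) j * fps_nth (fps_nth G (n - i)) (k - j))"
      by (simp add: fps_mult_nth fps_sum_nth)
    also have "\<dots> = (\<Sum>j = 0..k. \<Sum>i = 0..n. fps_nth (fps_nth F i) j * fps_nth (fps_nth G (n - i)) (k - j))"
      by (rule sum.swap)
    finally show "fps_nth (Abs_fps (\<lambda>n. fps_nth (fps_nth (F * G) n) k)) n =
        fps_nth (\<Sum>j = 0..k. Abs_fps (\<lambda>n. fps_nth (fps_nth F n) j) * Abs_fps (\<lambda>n. fps_nth (fps_nth G n) (k - j))) n"
      by (simp add: fps_mult_nth fps_sum_nth)
  qed
  then show "fps_nth (flip (F * G)) k = fps_nth (flip F * flip G) k"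
    by (simp add: flip_nth fps_mult_nth fps_to_fls_sum fls_times_fps_to_fls)
qed

lemma flip_fps_const: "fps_nth (flip (fps_const c)) k = fls_const (fps_nth c k)"
proof -
  have "Abs_fps (\<lambda>n. fps_nth (fps_nth (fps_const c) n) k) = fps_const (fps_nth c k)"
    by (rule fps_ext) simp
  then show ?thesis by (simp add: flip_nth)
qed

lemma flip_const: "flip (fps_const (fps_const c)) = fps_const (fls_const c)"
  by (rule fps_ext) (auto simp: flip_fps_const)

lemma flip_const_X: "flip (fps_const fps_X) = fps_X"
  by (rule fps_ext) (auto simp: flip_fps_const)

lemma flip_X: "flip fps_X = fps_const fls_X"
proof (rule fps_ext)
  fix k
  have "Abs_fps (\<lambda>n. fps_nth (fps_nth fps_X n) k) = (if k = 0 then fps_X else 0 :: real fps)"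
    by (rule fps_ext) auto
  then show "fps_nth (flip fps_X) k = fps_nth (fps_const fls_X) k" by (simp add: flip_nth)
qed

lemma flip_1: "flip 1 = 1"
  using flip_const [of 1] by simp

lemma flip_0: "flip 0 = 0"
  using flip_const [of 0] by simp

lemma flip_2: "flip 2 = 2"
  by (metis flip_1 flip_add one_add_one)

lemma flip_power: "flip (F ^ n) = flip F ^ n"
  by (induction n) (simp_all add: flip_1 flip_mult)

lemma flip_const_X_power: "flip (fps_const (fps_X ^ n)) = fps_X ^ n"
  by (metis flip_const_X flip_power fps_const_power)

lemmas flip_simps = flip_add flip_diff flip_mult flip_X flip_const_X flip_1 flip_0 flip_2 flip_power flip_const_X_power

lemma represents_nthI: "(\<And>k. k < 8 \<Longrightarrow> fps_nth F k = ratfun_val (r ! k)) \<Longrightarrow> length r = 8 \<Longrightarrow> represents r F"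
  by (simp add: represents_def)

lemma less_8_cases: "k < 8 \<longleftrightarrow> k = 0 \<or> k = 1 \<or> k = 2 \<or> k = 3 \<or> k = 4 \<or> k = 5 \<or> k = 6 \<or> k = (7::nat)"
  by auto

text \<open>The identity for \<open>T_hat\<close> is flipped and compared coefficient by
  coefficient, after multiplying the list by the same nonzero denominator.\<close>

lemma represents_T: "represents T_list (flip T_hat)"
proof -
  let ?u = "1 - fls_X :: real fls"
  have e: "fps_const ?u * flip T_hat = fps_X ^ 4 + fps_X ^ 6 * fps_const (fls_X - fls_X ^ 2)"
    using arg_cong [OF T_hat, of flip] by (simp add: flip_simps algebra_simps fps_const_power flip: fps_const_sub)
  have "?u * fps_nth (flip T_hat) k = (if k = 4 then 1 else 0) + (if k = 6 then fls_X - fls_X ^ 2 else 0)" for k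
    using arg_cong [OF e, of "\<lambda>F. fps_nth F k"]
    unfolding fps_mult_left_const_nth fps_add_nth fps_mult_right_const_nth fps_X_power_nth by auto
  moreover have "?u * ratfun_val (T_list ! k) = (if k = 4 then 1 else 0) + (if k = 6 then fls_X - fls_X ^ 2 else 0)"
    if "k < 8" for k
    using that unfolding less_8_cases
    by (elim disjE) (simp_all add: T_list_def ratfun_val_def algebra_simps power2_eq_square)
  ultimately have "?u * fps_nth (flip T_hat) k = ?u * ratfun_val (T_list ! k)" if "k < 8" for k
    using that by simp
  moreover have "?u \<noteq> 0" by simp
  ultimately show ?thesis by (intro represents_nthI) (auto simp: T_list_def)
qed

lemma represents_S: "represents S_list (flip S_hat)"
proof -
  let ?x = "fls_X :: real fls" let ?u = "(1 - ?x) * (1 - ?x ^ 2)" and ?c = "\<lambda>z. fps_const z :: real fls fps"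
  let ?rhs = "\<lambda>k. (if k = 1 then 1 - ?x ^ 2 else 0) + (if k = 3 then ?x ^ 2 - ?x ^ 3 else 0) +
      (if k = 5 then 2 * (?x ^ 3 - ?x ^ 4) else 0) +
      (if k = 6 then ?x ^ 4 else 0) + (if k = 7 then ?x ^ 3 + ?x ^ 4 - 2 * ?x ^ 5 else 0)"
  have "(1 - ?c ?x) * (1 - ?c ?x ^ 2) * flip S_hat =
      fps_X - fps_X * ?c ?x ^ 2 + fps_X ^ 3 * ?c ?x ^ 2 - fps_X ^ 3 * ?c ?x ^ 3 + 2 * (fps_X ^ 5 * ?c ?x ^ 3)
      - 2 * (fps_X ^ 5 * ?c ?x ^ 4) + fps_X ^ 6 * ?c ?x ^ 4 + fps_X ^ 7 * ?c ?x ^ 3 + fps_X ^ 7 * ?c ?x ^ 4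
      - 2 * (fps_X ^ 7 * ?c ?x ^ 5)"
    using arg_cong [OF S_hat, of flip] by (simp only: flip_simps)
  moreover have "(1 - ?c ?x) * (1 - ?c ?x ^ 2) = ?c ?u"
    by (simp add: fps_const_power flip: fps_const_sub fps_const_mult fps_const_1_eq_1)
  ultimately have e: "?c ?u * flip S_hat =
      fps_X - fps_X * ?c ?x ^ 2 + fps_X ^ 3 * ?c ?x ^ 2 - fps_X ^ 3 * ?c ?x ^ 3 + 2 * (fps_X ^ 5 * ?c ?x ^ 3)
      - 2 * (fps_X ^ 5 * ?c ?x ^ 4) + fps_X ^ 6 * ?c ?x ^ 4 + fps_X ^ 7 * ?c ?x ^ 3 + fps_X ^ 7 * ?c ?x ^ 4
      - 2 * (fps_X ^ 7 * ?c ?x ^ 5)" by (simp only:)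
  have "?u * fps_nth (flip S_hat) k = ?rhs k" for k
    using arg_cong [OF e, of "\<lambda>F. fps_nth F k"] unfolding fps_const_power fps_mult_left_const_nth fps_add_nth fps_sub_nth fps_nth_2_mult
      fps_mult_right_const_nth fps_X_power_nth fps_X_nth
    by (auto simp: algebra_simps)
  moreover have u: "1 - ?x ^ 2 = (1 - ?x) * (1 + ?x)" by (simp add: algebra_simps power2_eq_square)
  have cancel: "a * (a * b) * (z / (a * b)) = a * z" "a * (a * b) * (z / (a ^ 2 * b)) = z" "a * (a * b) * (z / a) = a * b * z"
    if "a \<noteq> 0" "b \<noteq> 0" for a b z :: "real fls"
    using that by (simp_all add: field_simps power2_eq_square)
  have val: "?u * ratfun_val (p, 1, 1) = (1 - ?x) * poly_val p" "?u * ratfun_val (p, 2, 1) = poly_val p"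
    "?u * ratfun_val (p, 1, 0) = (1 - ?x) * (1 + ?x) * poly_val p" "?u * ratfun_val ([], 0, 0) = 0" for p
    unfolding u ratfun_val_def prod.case power_one_right power_0 mult_1_right
    by (rule cancel; simp)+ simp
  have "?u * ratfun_val (S_list ! k) = ?rhs k" if "k < 8" for k
  proof -
    from that consider "k = 0 \<or> k = 2 \<or> k = 4" | "k = 1" | "k = 3" | "k = 5" | "k = 6" | "k = 7" by linarith
    then show ?thesis
    proof cases
      case 1
      then have "S_list ! k = ([], 0, 0)" by (auto simp: S_list_def)
      then show ?thesis using 1 val(4) by auto
    next
      case 2
      then have "S_list ! k = ([1], 1, 0)" by (simp add: S_list_def)
      then show ?thesis using 2 by (simp only: val) (simp add: algebra_simps power2_eq_square)
    next
      case 3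
      then have "S_list ! k = ([0, 0, 1], 1, 1)" by (simp add: S_list_def)
      then show ?thesis using 3 by (simp only: val) (simp add: algebra_simps eval_nat_numeral)
    next
      case 4
      then have "S_list ! k = ([0, 0, 0, 2], 1, 1)" by (simp add: S_list_def)
      then show ?thesis using 4 by (simp only: val) (simp add: algebra_simps eval_nat_numeral)
    next
      case 5
      then have "S_list ! k = ([0, 0, 0, 0, 1], 2, 1)" by (simp add: S_list_def)
      then show ?thesis using 5 by (simp only: val) (simp add: algebra_simps eval_nat_numeral)
    next
      case 6
      then have "S_list ! k = ([0, 0, 0, 1, 2], 1, 1)" by (simp add: S_list_def)
      then show ?thesis using 6 by (simp only: val) (simp add: algebra_simps eval_nat_numeral)
    qed
  qed
  ultimately have "?u * fps_nth (flip S_hat) k = ?u * ratfun_val (S_list ! k)" if "k < 8" for k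
    using that by simp
  moreover have "?u \<noteq> 0" unfolding u by simp
  ultimately show ?thesis by (intro represents_nthI) (auto simp: S_list_def)
qed

subsection \<open>Solving the quadratic equation\<close>

lemma sqrt_disc_square: "sqrt_disc ^ 2 = 1 - 2 * fls_X - 3 * fls_X ^ 2"
proof -
  let ?a = "1 - 2 * fps_X - 3 * fps_X ^ 2 :: real fps"
  have a0: "fps_nth ?a 0 = 1" by simp
  have "fps_radical root (Suc 1) ?a ^ Suc 1 = ?a"
    using power_radical [of ?a root 1] a0 by simp
  then have "fps_radical root 2 ?a ^ 2 = ?a" by (simp add: numeral_2_eq_2)
  then have "sqrt_disc ^ 2 = fps_to_fls ?a"
    unfolding sqrt_disc_def by (metis fps_to_fls_power)
  then show ?thesis
    by (simp add: fps_to_fls_minus fls_times_fps_to_fls fps_to_fls_power)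
qed

lemma sqrt_disc_nth_0: "fls_nth sqrt_disc 0 = 1"
  by (simp add: sqrt_disc_def fps_radical_nth_0)

lemma sqrt_disc_neq_0: "sqrt_disc \<noteq> 0"
  using sqrt_disc_nth_0 by auto

definition eq_upto_7 :: "real fls fps \<Rightarrow> real fls fps \<Rightarrow> bool" where
  "eq_upto_7 F G \<longleftrightarrow> (\<forall>k<8. fps_nth F k = fps_nth G k)"

lemma eq_upto_7_mult: "eq_upto_7 F F' \<Longrightarrow> eq_upto_7 G G' \<Longrightarrow> eq_upto_7 (F * G) (F' * G')"
  by (auto simp: eq_upto_7_def fps_mult_nth intro!: sum.cong)

lemma eq_upto_7_cancel:
  assumes "eq_upto_7 (A * B) 0" "fps_nth A 0 \<noteq> 0"
  shows "eq_upto_7 B 0"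
proof -
  have "fps_nth B k = 0" if "k < 8" for k
    using that
  proof (induction k rule: less_induct)
    case (less k)
    have "0 = fps_nth (A * B) k" using assms(1) less(2) by (simp add: eq_upto_7_def)
    also have "\<dots> = fps_nth A 0 * fps_nth B k + (\<Sum>i = Suc 0..k. fps_nth A i * fps_nth B (k - i))"
      by (simp add: fps_mult_nth sum.atLeast_Suc_atMost)
    also have "(\<Sum>i = Suc 0..k. fps_nth A i * fps_nth B (k - i)) = 0"
      using less by (intro sum.neutral) auto
    finally show ?case using assms(2) by simp
  qed
  then show ?thesis by (simp add: eq_upto_7_def)
qed

text \<open>Substitution of \<open>q / (1 - 2x - 3x\<^sup>2)\<close> for the outer variable \<open>q\<close>.\<close>

definition rescale :: "real fls fps \<Rightarrow> real fls fps" where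
  "rescale F = Abs_fps (\<lambda>k. fps_nth F k / (sqrt_disc ^ 2) ^ k)"

lemma rescale_mult: "rescale (F * G) = rescale F * rescale G"
proof (rule fps_ext)
  fix k
  have *: "fps_nth F i * fps_nth G (k - i) / (sqrt_disc ^ 2) ^ k =
      fps_nth F i / (sqrt_disc ^ 2) ^ i * (fps_nth G (k - i) / (sqrt_disc ^ 2) ^ (k - i))" if "i \<le> k" for i
  proof -
    have "(sqrt_disc ^ 2) ^ k = (sqrt_disc ^ 2) ^ i * (sqrt_disc ^ 2) ^ (k - i)"
      using that by (metis le_add_diff_inverse power_add)
    then show ?thesis by simp
  qed
  then show "fps_nth (rescale (F * G)) k = fps_nth (rescale F * rescale G) k"
    unfolding rescale_def fps_mult_nth fps_nth_Abs_fps sum_divide_distrib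
    by (intro sum.cong refl *) simp
qed

lemma rescale_const: "rescale (fps_const c) = fps_const c"
  by (rule fps_ext) (simp add: rescale_def)

lemma rescale_eq: "eq_upto_7 F G \<Longrightarrow> eq_upto_7 (rescale F) (rescale G)"
  by (simp add: eq_upto_7_def rescale_def)

text \<open>The series \<open>?F\<close> undoes \<open>rescale\<close>. Only even powers of
  \<open>sqrt_disc\<close> occur in it, so its coefficients remain rational functions and can be
  represented.\<close>

lemma represents_scale:
  assumes "represents r F"
  obtains F' where "represents (series_scale r) F'" "eq_upto_7 (rescale F') F"
proof
  let ?F = "Abs_fps (\<lambda>k. (sqrt_disc ^ 2) ^ k * fps_nth F k)"
  have val: "ratfun_val (poly_power [1, -2, -3] k, 0, 0) = (sqrt_disc ^ 2) ^ k" for k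
    unfolding sqrt_disc_square by (simp add: ratfun_val_def poly_val_power algebra_simps power2_eq_square)
  show "represents (series_scale r) ?F"
    using assms by (simp add: represents_def series_scale_def ratfun_val_mult val del: power2_eq_iff)
  show "eq_upto_7 (rescale ?F) F"
    using sqrt_disc_neq_0 by (simp add: eq_upto_7_def rescale_def)
qed

lemma represents_unique:
  assumes "represents r F" "represents s G" "list_all2 ratfun_eq r s"
  shows "eq_upto_7 F G"
  using represents_eq [OF assms(1,3)] assms(2) by (simp add: represents_def eq_upto_7_def)

lemma eq_upto_7_refl: "eq_upto_7 F F"
  by (simp add: eq_upto_7_def)

lemma eq_upto_7_sym: "eq_upto_7 F G \<Longrightarrow> eq_upto_7 G F"
  by (simp add: eq_upto_7_def)

lemma eq_upto_7_trans [trans]: "eq_upto_7 F G \<Longrightarrow> eq_upto_7 G H \<Longrightarrow> eq_upto_7 F H"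
  by (simp add: eq_upto_7_def)

lemma eq_upto_7_add: "eq_upto_7 F F' \<Longrightarrow> eq_upto_7 G G' \<Longrightarrow> eq_upto_7 (F + G) (F' + G')"
  by (simp add: eq_upto_7_def)

lemma eq_upto_7_iff_diff: "eq_upto_7 F G \<longleftrightarrow> eq_upto_7 (F - G) 0"
  by (simp add: eq_upto_7_def)

text \<open>The series \<rho> = 2 \<alpha> j + \<beta> squares to the discriminant, and up to the
  seventh coefficient so does \<mu>, built from \<open>R_list\<close>. Once the sign is settled as
  \<rho> = - \<mu>, the series 2 x^2 j is - x^2 (\<beta> + \<mu>) divided by \<alpha>, with the two
  summands given by \<open>F_list\<close> and \<open>G_list\<close>.\<close>

lemma gf_formula:
  assumes k: "k < 8"
  shows "2 * fls_X ^ 2 * fps_to_fls (Abs_fps (\<lambda>n. fps_nth (W n 0) k)) =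
    ratfun_val (F_list ! k) + ratfun_val (G_list ! k) * (sqrt_disc / (sqrt_disc ^ 2) ^ k)"
proof -
  obtain I where I: "eqx (W_gf 0) I" 
    "(1 + fps_X ^ 2 * T_hat) ^ 2 * ((1 - fps_X) * I - 1) ^ 2 - (1 - fps_X - fps_X ^ 2 * S_hat) * I * ((1 - fps_X) * I - 1) +
      fps_X ^ 2 * I ^ 2 = 0"
    by (rule W_gf_quadratic)
  define j where "j = flip I"
  define c :: "real fls \<Rightarrow> real fls fps" where "c = fps_const"
  define x where "x = c fls_X"
  define g where "g = (1 + x ^ 2 * flip T_hat) ^ 2"
  define w where "w = 1 - x - x ^ 2 * flip S_hat"
  define \<alpha> where "\<alpha> = g * (1 - x) ^ 2 - w * (1 - x) + x ^ 2"
  define \<beta> where "\<beta> = w - 2 * g * (1 - x)"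
  have "g * ((1 - x) * j - 1) ^ 2 - w * j * ((1 - x) * j - 1) + x ^ 2 * j ^ 2 = 0"
    using arg_cong [OF I(2), of flip] unfolding flip_simps g_def w_def j_def x_def c_def .
  then have quad: "\<alpha> * j ^ 2 + \<beta> * j + g = 0"
    unfolding \<alpha>_def \<beta>_def by (simp add: algebra_simps power2_eq_square)
  define \<rho> where "\<rho> = 2 * \<alpha> * j + \<beta>"
  have "\<rho> ^ 2 = 4 * \<alpha> * (\<alpha> * j ^ 2 + \<beta> * j + g) + (\<beta> ^ 2 - 4 * \<alpha> * g)"
    unfolding \<rho>_def by (simp add: algebra_simps power2_eq_square)
  also have "\<dots> = w * w - 4 * x ^ 2 * g"
    unfolding quad unfolding \<alpha>_def \<beta>_def by (simp add: algebra_simps power2_eq_square)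
  finally have rho2: "\<rho> ^ 2 = w * w - 4 * x ^ 2 * g" .

  have val: "ratfun_val ([1], 0, 0) = 1" "ratfun_val ([0, 0, 1], 0, 0) = fls_X ^ 2"
    "ratfun_val ([1, -1], 0, 0) = 1 - fls_X" "ratfun_val ([0, 0, -1], 0, 0) = - (fls_X ^ 2)"
    "ratfun_val ([1, -2, 1], 0, 0) = (1 - fls_X) ^ 2" "ratfun_val ([-1, 1], 0, 0) = fls_X - 1"
    "ratfun_val ([-2, 2], 0, 0) = 2 * (fls_X - 1)" "ratfun_val ([0, 0, -4], 0, 0) = - 4 * fls_X ^ 2"
    "ratfun_val ([1, -2, -3], 0, 0) = sqrt_disc ^ 2"
    unfolding sqrt_disc_square by (simp_all add: ratfun_val_def algebra_simps power2_eq_square)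
  have cval: "fps_const (ratfun_val ([1], 0, 0)) = 1" "fps_const (ratfun_val ([0, 0, 1], 0, 0)) = x ^ 2"
    "fps_const (ratfun_val ([1, -1], 0, 0)) = 1 - x" "fps_const (ratfun_val ([0, 0, -1], 0, 0)) = - (x ^ 2)"
    "fps_const (ratfun_val ([1, -2, 1], 0, 0)) = (1 - x) ^ 2" "fps_const (ratfun_val ([-1, 1], 0, 0)) = x - 1"
    "fps_const (ratfun_val ([-2, 2], 0, 0)) = 2 * (x - 1)" "fps_const (ratfun_val ([0, 0, -4], 0, 0)) = - 4 * x ^ 2"
    "fps_const (ratfun_val ([1, -2, -3], 0, 0)) = fps_const sqrt_disc ^ 2"
    unfolding val by (simp_all add: x_def c_def fps_const_power numeral_fps_const flip: fps_const_1_eq_1)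
  have "represents (series_const r) C" if "fps_const (ratfun_val r) = C" for r C
    using represents_const [of r] that by simp
  note rc = cval [THEN this]
  have rg: "represents g_list g"
    unfolding g_list_def Let_def g_def power2_eq_square [of "1 + _"]
    by (intro represents_mult represents_add rc represents_T)
  have "represents w_list ((1 - x) + - (x ^ 2) * flip S_hat)"
    unfolding w_list_def by (intro represents_mult represents_add rc represents_S)
  then have rw: "represents w_list w" by (simp add: w_def algebra_simps)
  have "represents alpha_list (g * (1 - x) ^ 2 + (x - 1) * w + x ^ 2)"
    by (rule represents_eq [OF _ alpha_check]) (intro represents_mult represents_add rc rg rw)
  then have ra: "represents alpha_list \<alpha>" by (simp add: \<alpha>_def algebra_simps)
  have "represents beta_list (w + 2 * (x - 1) * g)"
    by (rule represents_eq [OF _ beta_check]) (intro represents_mult represents_add rc rg rw)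
  then have rb: "represents beta_list \<beta>" by (simp add: \<beta>_def algebra_simps)
  have "represents delta_list (w * w + - 4 * x ^ 2 * g)"
    by (rule represents_eq [OF _ delta_check]) (intro represents_mult represents_add rc rg rw)
  then have rd: "represents delta_list (\<rho> ^ 2)" by (simp add: rho2 algebra_simps)

  define F where "F = Abs_fps (\<lambda>k. ratfun_val (F_list ! k))"
  define G where "G = Abs_fps (\<lambda>k. ratfun_val (G_list ! k))"
  define R where "R = Abs_fps (\<lambda>k. ratfun_val (R_list ! k))"
  have rF: "represents F_list F" and rG: "represents G_list G" and rR: "represents R_list R"
    by (simp_all add: represents_def F_def G_def R_def F_list_def G_list_def R_list_def)
  \<comment> \<open>Its k-th coefficient is \<open>R_list ! k\<close> times the power 1 - 2k of
    \<open>sqrt_disc\<close>.\<close>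
  define \<mu> where "\<mu> = fps_const sqrt_disc * rescale R"

  have F: "eq_upto_7 (\<alpha> * F) (- (x ^ 2) * \<beta>)"
    by (rule represents_unique [OF _ _ F_check]) (intro represents_mult rc ra rb rF)+
  obtain \<delta> where d: "represents (series_scale delta_list) \<delta>" "eq_upto_7 (rescale \<delta>) (\<rho> ^ 2)"
    using represents_scale [OF rd] .
  have "eq_upto_7 (fps_const sqrt_disc ^ 2 * (R * R)) \<delta>"
    by (rule represents_unique [OF _ d(1) R_check]) (intro represents_mult rc rR)
  then have "eq_upto_7 (rescale (fps_const sqrt_disc ^ 2 * (R * R))) (rescale \<delta>)"
    by (rule rescale_eq)
  also have "rescale (fps_const sqrt_disc ^ 2 * (R * R)) = \<mu> ^ 2"
    by (simp add: \<mu>_def rescale_mult rescale_const fps_const_power power2_eq_square mult_ac flip: fps_const_mult)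
  finally have mu2: "eq_upto_7 (\<mu> ^ 2) (\<rho> ^ 2)" using d(2) eq_upto_7_trans by blast
  have "eq_upto_7 ((\<rho> - \<mu>) * (\<rho> + \<mu>)) 0"
  proof -
    have "(\<rho> - \<mu>) * (\<rho> + \<mu>) = \<rho> ^ 2 - \<mu> ^ 2" by (simp add: algebra_simps power2_eq_square)
    then show ?thesis using mu2 by (simp add: eq_upto_7_def)
  qed
  \<comment> \<open>The sign of the root: as series in x, the constant coefficient of \<rho> begins
    with -1 and that of \<mu> with 1.\<close>
  moreover have "fps_nth (\<rho> - \<mu>) 0 \<noteq> 0"
  proof
    assume "fps_nth (\<rho> - \<mu>) 0 = 0"
    then have "fps_nth \<rho> 0 = sqrt_disc"
      by (simp add: \<mu>_def rescale_def R_def R_list_def ratfun_val_def)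
    moreover have "fps_nth \<alpha> 0 = fls_X ^ 2" "fps_nth \<beta> 0 = fls_X - 1"
      using ra rb by (simp_all add: represents_def alpha_list_def beta_list_def ratfun_val_def power2_eq_square)
    then have "fps_nth \<rho> 0 = 2 * fls_X ^ 2 * fps_nth j 0 + (fls_X - 1)"
      by (simp add: \<rho>_def)
    ultimately have "fls_nth (2 * fls_X ^ 2 * fps_nth j 0 + (fls_X - 1)) 0 = 1"
      using sqrt_disc_nth_0 by simp
    moreover have "fls_nth (2 * fls_X ^ 2 * fps_nth j 0) 0 = 0"
    proof -
      let ?h = "Abs_fps (\<lambda>n. fps_nth (fps_nth I n) 0)"
      have "2 * fls_X ^ 2 * fps_nth j 0 = fps_to_fls (fps_X ^ 2 * (2 * ?h))"
        by (simp add: fls_times_fps_to_fls fps_to_fls_power j_def flip_nth mult_ac)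
      then show ?thesis by simp
    qed
    ultimately show False by simp
  qed
  ultimately have rho: "eq_upto_7 (\<rho> + \<mu>) 0" by (rule eq_upto_7_cancel)

  obtain \<alpha>' where a: "represents (series_scale alpha_list) \<alpha>'" "eq_upto_7 (rescale \<alpha>') \<alpha>"
    using represents_scale [OF ra] .
  have "eq_upto_7 (\<alpha>' * G) (- (x ^ 2) * R)"
    by (rule represents_unique [OF _ _ G_check]) (intro represents_mult rc rG a rR)+
  then have "eq_upto_7 (rescale (\<alpha>' * G)) (rescale (- (x ^ 2) * R))" by (rule rescale_eq)
  moreover have "rescale (- (x ^ 2) * R) = - (x ^ 2) * rescale R"
    unfolding rescale_mult by (metis cval(4) rescale_const)
  ultimately have "eq_upto_7 (rescale \<alpha>' * rescale G) (- (x ^ 2) * rescale R)" by (simp add: rescale_mult)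
  then have "eq_upto_7 (\<alpha> * rescale G) (- (x ^ 2) * rescale R)"
    by (rule eq_upto_7_trans [OF eq_upto_7_mult [OF eq_upto_7_sym [OF a(2)] eq_upto_7_refl]])
  then have "eq_upto_7 (fps_const sqrt_disc * (\<alpha> * rescale G)) (fps_const sqrt_disc * (- (x ^ 2) * rescale R))"
    by (rule eq_upto_7_mult [OF eq_upto_7_refl])
  then have G: "eq_upto_7 (\<alpha> * (fps_const sqrt_disc * rescale G)) (- (x ^ 2) * \<mu>)"
    unfolding \<mu>_def by (simp only: mult_ac)
  have "eq_upto_7 (\<alpha> * (F + fps_const sqrt_disc * rescale G)) (- (x ^ 2) * (\<beta> + \<mu>))"
    using eq_upto_7_add [OF F G] by (simp add: algebra_simps)
  moreover have "eq_upto_7 (- (x ^ 2) * (\<beta> + \<mu>)) (\<alpha> * (2 * x ^ 2 * j))"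
  proof -
    have "eq_upto_7 (- (x ^ 2) * (\<rho> + \<mu>)) (- (x ^ 2) * 0)" using rho by (intro eq_upto_7_mult eq_upto_7_refl)
    then have "eq_upto_7 (- (x ^ 2) * (\<beta> + \<mu>) - \<alpha> * (2 * x ^ 2 * j)) 0"
      by (simp add: \<rho>_def algebra_simps)
    then show ?thesis by (simp only: eq_upto_7_iff_diff [of "- (x ^ 2) * (\<beta> + \<mu>)"])
  qed
  ultimately have "eq_upto_7 (\<alpha> * (F + fps_const sqrt_disc * rescale G)) (\<alpha> * (2 * x ^ 2 * j))"
    by (rule eq_upto_7_trans)
  then have "eq_upto_7 (\<alpha> * (F + fps_const sqrt_disc * rescale G - 2 * x ^ 2 * j)) 0"
    by (simp only: eq_upto_7_iff_diff [of "\<alpha> * _"] right_diff_distrib)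
  moreover have "fps_nth \<alpha> 0 \<noteq> 0"
    using ra by (simp add: represents_def alpha_list_def ratfun_val_def)
  ultimately have "eq_upto_7 (F + fps_const sqrt_disc * rescale G - 2 * x ^ 2 * j) 0" by (rule eq_upto_7_cancel)
  then have "fps_nth (F + fps_const sqrt_disc * rescale G - 2 * x ^ 2 * j) k = 0"
    using k by (simp add: eq_upto_7_def)
  moreover have "2 * x ^ 2 * j = fps_const (2 * fls_X ^ 2) * j"
    by (simp add: x_def c_def fps_const_power numeral_fps_const)
  ultimately have "2 * fls_X ^ 2 * fps_nth j k = fps_nth F k + sqrt_disc * fps_nth (rescale G) k" by simp
  moreover have "fps_nth j k = fps_to_fls (Abs_fps (\<lambda>n. fps_nth (W n 0) k))"
  proof -
    have "fps_nth (fps_nth I n) k = fps_nth (W n 0) k" for n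
      using I(1) k by (simp add: eqx_def eq8_def W_gf_def)
    then show ?thesis by (simp add: j_def flip_nth)
  qed
  ultimately show ?thesis by (simp add: F_def rescale_def G_def mult.commute)
qed

subsection \<open>Occurrences as sets of positions\<close>

lemma nths_sorted_list_of_set:
  assumes "I \<subseteq> {..<length w}"
  shows "nths w I = map ((!) w) (sorted_list_of_set I)"
proof -
  have "zip w [0..<length w] = map (\<lambda>i. (w ! i, i)) [0..<length w]"
    by (rule nth_equalityI) auto
  then have "nths w I = map ((!) w) (filter (\<lambda>i. i \<in> I) [0..<length w])"
    by (simp add: nths_def filter_map o_def)
  moreover have "filter (\<lambda>i. i \<in> I) [0..<length w] = sorted_list_of_set I"
  proof (rule sorted_distinct_set_unique)
    show "set (filter (\<lambda>i. i \<in> I) [0..<length w]) = set (sorted_list_of_set I)"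
      using assms finite_subset [OF assms] by auto
  qed (auto simp: sorted_wrt_filter)
  ultimately show ?thesis by simp
qed

lemma order_isomorphic_3412_iff:
  "order_isomorphic u [3, 4, 1, 2] \<longleftrightarrow>
     (\<exists>a b c d. u = [a, b, c, d] \<and> c < d \<and> d < a \<and> a < b)" (is "?L \<longleftrightarrow> ?R")
proof
  assume L: ?L
  then have "length u = Suc (Suc (Suc (Suc 0)))" by (simp add: order_isomorphic_def)
  then obtain a b c d where u: "u = [a, b, c, d]" by (auto simp: length_Suc_conv)
  have "\<forall>i<4. \<forall>j<4. u ! i < u ! j \<longleftrightarrow> [3, 4, 1, 2::nat] ! i < [3, 4, 1, 2] ! j"
    using L u by (simp add: order_isomorphic_def)
  from this [rule_format, of 2 3] this [rule_format, of 3 0] this [rule_format, of 0 1]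
  show ?R using u by simp
next
  assume ?R
  then obtain a b c d where "u = [a, b, c, d]" "c < d" "d < a" "a < b" by blast
  then show ?L by (auto simp: order_isomorphic_def less_Suc_eq nth_Cons')
qed

text \<open>A set of four positions corresponds to its increasing enumeration.\<close>

lemma card_occurrences: "card (occurrences [3, 4, 1, 2] w) = occ {..<length w} ((!) w)"
proof -
  let ?g = "\<lambda>(i, j, k, l). {i, j, k, l :: nat}"
  have list: "sorted_list_of_set {i, j, k, l} = [i, j, k, l]" if "i < j" "j < k" "k < l" for i j k l :: nat
    using that by (simp add: insort_insert_insort insort_insert_triv flip: sorted_list_of_set.sorted_key_list_of_set_insert_remove) 
  have "bij_betw ?g (occ_tuples {..<length w} ((!) w)) (occurrences [3, 4, 1, 2] w)"
  proof (rule bij_betw_byWitness [where f' = "\<lambda>I. let s = sorted_list_of_set I in (s ! 0, s ! 1, s ! 2, s ! 3)"])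
    show "\<forall>p\<in>occ_tuples {..<length w} ((!) w).
        (let s = sorted_list_of_set (?g p) in (s ! 0, s ! 1, s ! 2, s ! 3)) = p"
      by (auto simp: occ_tuples_def list)
    show "?g ` occ_tuples {..<length w} ((!) w) \<subseteq> occurrences [3, 4, 1, 2] w"
    proof
      fix I assume "I \<in> ?g ` occ_tuples {..<length w} ((!) w)"
      then obtain i j k l where I: "I = {i, j, k, l}" and o: "(i, j, k, l) \<in> occ_tuples {..<length w} ((!) w)"
        by auto
      then have "I \<subseteq> {..<length w}" by (auto simp: occ_tuples_def)
      moreover have "nths w I = [w ! i, w ! j, w ! k, w ! l]"
        using nths_sorted_list_of_set [OF calculation] list [of i j k l] o
        unfolding I by (auto simp: occ_tuples_def)
      ultimately show "I \<in> occurrences [3, 4, 1, 2] w"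
        using o unfolding occurrences_def order_isomorphic_3412_iff by (auto simp: occ_tuples_def)
    qed
    have inv: "\<exists>i j k l. I = {i, j, k, l} \<and> sorted_list_of_set I = [i, j, k, l] \<and>
        (i, j, k, l) \<in> occ_tuples {..<length w} ((!) w)" if "I \<in> occurrences [3, 4, 1, 2] w" for I
    proof -
      have sub: "I \<subseteq> {..<length w}" and iso: "order_isomorphic (nths w I) [3, 4, 1, 2]"
        using that by (auto simp: occurrences_def)
      then obtain a b c d where v: "map ((!) w) (sorted_list_of_set I) = [a, b, c, d]" "c < d" "d < a" "a < b"
        unfolding order_isomorphic_3412_iff nths_sorted_list_of_set [OF sub] by (elim exE conjE) (rule that)
      then obtain i j k l where s: "sorted_list_of_set I = [i, j, k, l]" "w ! i = a" "w ! j = b" "w ! k = c" "w ! l = d"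
        by (auto simp: map_eq_Cons_conv)
      have fin: "finite I" using sub finite_subset by blast
      have I: "I = {i, j, k, l}" using set_sorted_list_of_set [OF fin] s by simp
      have "sorted_wrt (<) [i, j, k, l]" using strict_sorted_list_of_set [of I] s by simp
      then have "(i, j, k, l) \<in> occ_tuples {..<length w} ((!) w)"
        using s v sub I by (auto simp: occ_tuples_def)
      then show ?thesis using s I by blast
    qed
    show "\<forall>I\<in>occurrences [3, 4, 1, 2] w.
        ?g (let s = sorted_list_of_set I in (s ! 0, s ! 1, s ! 2, s ! 3)) = I"
    proof
      fix I assume "I \<in> occurrences [3, 4, 1, 2] w"
      from inv [OF this] show "?g (let s = sorted_list_of_set I in (s ! 0, s ! 1, s ! 2, s ! 3)) = I"
        by (auto simp: Let_def)
    qed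
    show "(\<lambda>I. let s = sorted_list_of_set I in (s ! 0, s ! 1, s ! 2, s ! 3)) ` occurrences [3, 4, 1, 2] w
        \<subseteq> occ_tuples {..<length w} ((!) w)"
    proof (rule image_subsetI)
      fix I assume "I \<in> occurrences [3, 4, 1, 2] w"
      from inv [OF this] show "(let s = sorted_list_of_set I in (s ! 0, s ! 1, s ! 2, s ! 3)) \<in> occ_tuples {..<length w} ((!) w)"
        by (auto simp: Let_def)
    qed
  qed
  then show ?thesis unfolding occ_def by (rule bij_betw_same_card [symmetric])
qed

lemma card_occurrences_one_line: "card (occurrences [3, 4, 1, 2] (one_line n f)) = occ {1..n} f"
proof -
  have "occ (Suc ` {..<n}) f = occ {..<n} ((!) (one_line n f))"
    by (rule occ_iso) (auto simp: one_line_def nth_append simp del: upt_Suc)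
  moreover have "Suc ` {..<n} = {1..n}" by (simp add: image_Suc_lessThan)
  moreover have "length (one_line n f) = n" by (simp add: one_line_def del: upt_Suc)
  ultimately show ?thesis by (simp only: card_occurrences)
qed

lemma involutions_eq: "involutions n = involutions_on {1..n}"
proof (intro set_eqI iffI)
  fix f assume "f \<in> involutions n"
  then have p: "f permutes {1..n}" "f = inv f" by (auto simp: involutions_def)
  then have "f (f y) = y" for y using permutes_inverses(2) [OF p(1), of y] by simp
  then show "f \<in> involutions_on {1..n}"
    using p(1) permutes_in_image [OF p(1)] by (auto simp: involutions_on_def permutes_def)
next
  fix f assume f: "f \<in> involutions_on {1..n}"
  then have ff: "f (f y) = y" for y by (simp add: involutions_on_def)
  have "f permutes {1..n}"
    using f ff unfolding permutes_def involutions_on_def by (auto, metis)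
  moreover have "inv f = f" using ff by (intro inv_unique_comp) auto
  ultimately show "f \<in> involutions n" by (simp add: involutions_def)
qed

lemma num_involutions_3412_eq: "real (num_involutions_3412 n r) = fps_nth (W n 0) r"
proof -
  have "W n 0 = (\<Sum>f\<in>involutions_on {1..n}. fps_X ^ occ {1..n} f)"
    using total_weight_W [of "{1..n}" "{}"]
    by (simp add: total_weight_def weight_def nested_end_empty)
  also have "fps_nth \<dots> r = (\<Sum>f\<in>involutions_on {1..n}. if occ {1..n} f = r then 1 else 0)"
    by (auto simp: fps_sum_nth intro!: sum.cong)
  also have "\<dots> = real (card {f \<in> involutions_on {1..n}. occ {1..n} f = r})"
    by (simp flip: sum.inter_filter)
  finally show ?thesis
    unfolding num_involutions_3412_def involutions_eq card_occurrences_one_line by simp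
qed

section \<open>Comparison with the claimed polynomials\<close>

text \<open>Unlike the nested form of \<open>poly_val\<close>, this unfolds to the sum of monomials
  in which the polynomials of the theorem are written.\<close>

fun poly_val_from :: "nat \<Rightarrow> int list \<Rightarrow> real fls" where
  "poly_val_from k [] = 0"
| "poly_val_from k (c # cs) = of_int c * fls_X ^ k + poly_val_from (k + 1) cs"

lemma poly_val_from: "poly_val_from k p = fls_X ^ k * poly_val p"
  by (induction p arbitrary: k) (simp_all add: algebra_simps)

lemma poly_val_eq: "poly_val p = poly_val_from 0 p"
  by (simp add: poly_val_from)

lemma ratfun_val_eqI:
  assumes "(1 - fls_X) ^ a * (1 + fls_X) ^ b * F = poly_val p"
  shows "F = ratfun_val (p, a, b)"
proof -
  have "(1 - fls_X) ^ a * (1 + fls_X) ^ b \<noteq> (0 :: real fls)" by simp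
  then show ?thesis
    unfolding ratfun_val_def prod.case using assms by (metis nonzero_mult_div_cancel_left)
qed

text \<open>The denominators in the hypotheses are nonzero Laurent series, so \<open>F r\<close> and
  \<open>G r\<close> are determined and equal entry \<open>r\<close> of \<open>F_list\<close> and of
  \<open>G_list\<close>.\<close>

theorem corollary3p6:
  fixes F G :: "nat \<Rightarrow> real fls" and r :: nat
  assumes "r \<in> {3, 4, 5, 6, 7}"
    and "(1 - X ^ 2) * F 3 =
       -(1 - 2 * X) * (1 + X + X ^ 2)"
    and "(1 - X ^ 2) * F 4 =
       -1 + 3 * X + 4 * X ^ 2 - 8 * X ^ 3 - 2 * X ^ 4"
    and "(1 - X ^ 2) * F 5 =
       3 - 7 * X - 7 * X ^ 2 + 12 * X ^ 3 + 6 * X ^ 4"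
    and "(1 - X ^ 2) ^ 2 * F 6 =
       -5 + 9 * X + 21 * X ^ 2 - 25 * X ^ 3 - 34 * X ^ 4 + 16 * X ^ 5 + 24 * X ^ 6 - 2 * X ^ 7
       - 2 * X ^ 8"
    and "(1 - X ^ 2) ^ 2 * F 7 =
       7 - 11 * X - 28 * X ^ 2 + 20 * X ^ 3 + 54 * X ^ 4 - 2 * X ^ 5 - 46 * X ^ 6 + 2 * X ^ 8"
    and "(1 - X) ^ 2 * G 3 =
       1 - 8 * X + 18 * X ^ 2 + X ^ 3 - 29 * X ^ 4 - 12 * X ^ 5 + 14 * X ^ 6 + 41 * X ^ 7
       + 2 * X ^ 8 - 18 * X ^ 9"
    and "(1 - X) ^ 4 * G 4 =
       1 - 14 * X + 71 * X ^ 2 - 124 * X ^ 3 - 166 * X ^ 4 + 874 * X ^ 5 - 624 * X ^ 6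
       - 1332 * X ^ 7 + 1909 * X ^ 8 + 426 * X ^ 9 - 1585 * X ^ 10 + 292 * X ^ 11
       + 400 * X ^ 12 - 126 * X ^ 13"
    and "(1 - X) ^ 4 * G 5 =
       -3 + 46 * X - 267 * X ^ 2 + 627 * X ^ 3 + 134 * X ^ 4 - 3321 * X ^ 5 + 3954 * X ^ 6
       + 5214 * X ^ 7 - 11775 * X ^ 8 - 2186 * X ^ 9 + 14525 * X ^ 10 - 1701 * X ^ 11
       - 8824 * X ^ 12 + 1537 * X ^ 13 + 2594 * X ^ 14 - 216 * X ^ 15 - 324 * X ^ 16"
    and "(1 - X) ^ 6 * G 6 =
       5 - 94 * X + 712 * X ^ 2 - 2582 * X ^ 3 + 3124 * X ^ 4 + 8364 * X ^ 5 - 31620 * X ^ 6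
       + 15464 * X ^ 7 + 77508 * X ^ 8 - 107098 * X ^ 9 - 76814 * X ^ 10 + 214160 * X ^ 11
       + 5782 * X ^ 12 - 231050 * X ^ 13 + 62700 * X ^ 14 + 146176 * X ^ 15 - 65653 * X ^ 16
       - 50328 * X ^ 17 + 29646 * X ^ 18 + 6462 * X ^ 19 - 5346 * X ^ 20 + 486 * X ^ 21"
    and "(1 - X) ^ 6 * G 7 =
       -7 + 144 * X - 1210 * X ^ 2 + 5020 * X ^ 3 - 8206 * X ^ 4 - 12180 * X ^ 5
       + 69464 * X ^ 6 - 54210 * X ^ 7 - 181468 * X ^ 8 + 315366 * X ^ 9 + 239852 * X ^ 10
       - 779338 * X ^ 11 - 124766 * X ^ 12 + 1226006 * X ^ 13 - 168810 * X ^ 14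
       - 1272344 * X ^ 15 + 418555 * X ^ 16 + 813368 * X ^ 17 - 373802 * X ^ 18
       - 279554 * X ^ 19 + 153648 * X ^ 20 + 37188 * X ^ 21 - 23166 * X ^ 22 + 486 * X ^ 23"
  shows "fps_to_fls (gf_involutions_3412 r) =
           1 / (2 * X ^ 2) * F r + 1 / (2 * X ^ 2) * G r * sqrt_disc powi (1 - 2 * int r)"
proof -
  have u: "1 - X ^ 2 = (1 - X) * (1 + X)" by (simp add: algebra_simps power2_eq_square)
  have F: "F 3 = ratfun_val (F_list ! 3)" "F 4 = ratfun_val (F_list ! 4)" "F 5 = ratfun_val (F_list ! 5)"
    "F 6 = ratfun_val (F_list ! 6)" "F 7 = ratfun_val (F_list ! 7)"
    unfolding F_list_def
    by (simp, rule ratfun_val_eqI, use assms(2-6) in \<open>simp add: u algebra_simps eval_nat_numeral\<close>)+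
  have cancel: "y = z" if "(1 - X) ^ m * y = w" "(1 - X) ^ m * z = w" for y z w m
  proof -
    have "(1 - X) ^ m \<noteq> 0" by simp
    moreover have "(1 - X) ^ m * y = (1 - X) ^ m * z" using that by (simp only:)
    ultimately show ?thesis by (rule mult_left_cancel [THEN iffD1])
  qed
  have G: "G 3 = ratfun_val (G_list ! 3)" "G 4 = ratfun_val (G_list ! 4)" "G 5 = ratfun_val (G_list ! 5)"
    "G 6 = ratfun_val (G_list ! 6)" "G 7 = ratfun_val (G_list ! 7)"
    by (rule cancel [OF assms(7)] cancel [OF assms(8)] cancel [OF assms(9)] cancel [OF assms(10)]
        cancel [OF assms(11)],
        simp add: G_list_def ratfun_val_def poly_val_eq del: poly_val.simps One_nat_def)+
  have r: "r < 8" "F r = ratfun_val (F_list ! r)" "G r = ratfun_val (G_list ! r)"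
    using assms(1) F G by auto
  have "gf_involutions_3412 r = Abs_fps (\<lambda>n. fps_nth (W n 0) r)"
    by (simp add: gf_involutions_3412_def num_involutions_3412_eq)
  then have "2 * X ^ 2 * fps_to_fls (gf_involutions_3412 r) = F r + G r * (sqrt_disc / (sqrt_disc ^ 2) ^ r)"
    using gf_formula [OF r(1)] r by simp
  moreover have "sqrt_disc / (sqrt_disc ^ 2) ^ r = sqrt_disc powi (1 - 2 * int r)"
  proof -
    have "sqrt_disc powi (1 - int (2 * r)) = sqrt_disc powi 1 / sqrt_disc powi int (2 * r)"
      using sqrt_disc_neq_0 by (intro power_int_diff) simp
    also have "\<dots> = sqrt_disc / (sqrt_disc ^ 2) ^ r"
      unfolding power_int_of_nat power_int_1_right power_mult ..
    finally show ?thesis by simp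
  qed
  ultimately have *: "2 * X ^ 2 * fps_to_fls (gf_involutions_3412 r) = F r + G r * sqrt_disc powi (1 - 2 * int r)"
    by simp
  have "fps_to_fls (gf_involutions_3412 r) = 1 / (2 * X ^ 2) * (2 * X ^ 2 * fps_to_fls (gf_involutions_3412 r))"
    by simp
  also have "\<dots> = 1 / (2 * X ^ 2) * F r + 1 / (2 * X ^ 2) * G r * sqrt_disc powi (1 - 2 * int r)"
    unfolding * by (simp only: distrib_left mult.assoc)
  finally show ?thesis .
qed

end
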